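(* Let $d\in\mathbf{Z}\setminus\{0\}$ and $0<\kappa<\infty$ be fixed. For any sequence of absolute minimizers $(f_g,S_g,m_g)\in Y$ of $\mathcal{E}_{\kappa,g}$ over $Y$, with $f_g\ge0$ and $m_g\ge0$, along $g\to0^+$, we have $f_g\to0$ in $X_{loc}$, $S_g\to0$ locally uniformly, and $m_g\to1$ in $H_{loc}$.
   Context: All functions are real-valued functions of $r$, and $\int u\,r\,dr=\int_0^\infty u(r)\,r\,dr$. $H$ is the space of radial functions in $H^1(\mathbf{R}^2)$, with $\|u\|_H^2=\int[(u')^2+u^2]\,r\,dr$; $X=\{u\in H:\int\frac{u^2}{r^2}\,r\,dr<\infty\}$ with $\|u\|_X^2=\int[(u')^2+u^2+\frac{u^2}{r^2}]\,r\,dr$. Convergence in $X_{loc}$ (resp. $H_{loc}$) means that for every $R>0$ the corresponding norm with the integral restricted to $0<r<R$ of the difference tends to $0$. Fix $\eta\in C^\infty([0,\infty))$ with $\eta=0$ on $[0,1]$, $\eta=1$ on $[2,\infty)$, $0\le\eta\le1$, and set $f_0=\eta$, $S_0=d\,\eta$. $Y=\{(f_0+u,S_0+rv,m):u,v\in X,\ m\in H\}$. For $g>0$, $$\mathcal{E}_{\kappa,g}(f,S,m)=\frac12\int\Big\{(f')^2+\big[\tfrac{S'}{r}\big]^2+(m')^2+\kappa^2gm^2+\tfrac{(d-S)^2f^2}{r^2}+\tfrac{\kappa^2}{2}(1-f^2-m^2)^2\Big\}r\,dr.$$ *)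

theory Defs
  imports "HOL-Analysis.Analysis"
begin

text \<open>Derivatives are taken within \<open>A\<close>, so the definition covers open sets as well as the closed
  half-line, where it uses one-sided derivatives at the end point.\<close>

primrec Ck_on :: "nat \<Rightarrow> 'a::euclidean_space set \<Rightarrow> ('a \<Rightarrow> real) \<Rightarrow> bool" where
  "Ck_on 0 A f \<longleftrightarrow> continuous_on A f"
| "Ck_on (Suc k) A f \<longleftrightarrow>
     (\<exists>f'. (\<forall>x\<in>A. (f has_derivative f' x) (at x within A)) \<and> (\<forall>b\<in>Basis. Ck_on k A (\<lambda>x. f' x b)))"

definition smooth_on :: "'a::euclidean_space set \<Rightarrow> ('a \<Rightarrow> real) \<Rightarrow> bool" where
  "smooth_on A f \<longleftrightarrow> (\<forall>k. Ck_on k A f)"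

definition test_functions :: "'a::euclidean_space set \<Rightarrow> ('a \<Rightarrow> real) set" where
  "test_functions \<Omega> = {\<phi>. smooth_on UNIV \<phi> \<and> (\<exists>K. compact K \<and> K \<subseteq> \<Omega> \<and> (\<forall>x. x \<notin> K \<longrightarrow> \<phi> x = 0))}"

definition locally_integrable_on :: "'a::euclidean_space set \<Rightarrow> ('a \<Rightarrow> real) \<Rightarrow> bool" where
  "locally_integrable_on \<Omega> u \<longleftrightarrow> (\<forall>K. compact K \<and> K \<subseteq> \<Omega> \<longrightarrow> set_integrable lborel K u)"

definition has_weak_partial ::
    "'a::euclidean_space set \<Rightarrow> 'a \<Rightarrow> ('a \<Rightarrow> real) \<Rightarrow> ('a \<Rightarrow> real) \<Rightarrow> bool" where
  "has_weak_partial \<Omega> b u w \<longleftrightarrow>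
     locally_integrable_on \<Omega> u \<and> locally_integrable_on \<Omega> w \<and>
     (\<forall>\<phi>\<in>test_functions \<Omega>.
        (LINT x:\<Omega>|lborel. u x * frechet_derivative \<phi> (at x) b) = - (LINT x:\<Omega>|lborel. w x * \<phi> x))"

definition L2_space :: "'a::euclidean_space set \<Rightarrow> ('a \<Rightarrow> real) set" where
  "L2_space \<Omega> = {u. set_borel_measurable lborel \<Omega> u \<and> set_integrable lborel \<Omega> (\<lambda>x. (u x)\<^sup>2)}"

definition H1_space :: "'a::euclidean_space set \<Rightarrow> ('a \<Rightarrow> real) set" where
  "H1_space \<Omega> = {u \<in> L2_space \<Omega>. \<forall>b\<in>Basis. \<exists>w\<in>L2_space \<Omega>. has_weak_partial \<Omega> b u w}"

text \<open>The derivative of a function of \<open>r > 0\<close>.  It is determined only up to null sets, and it is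
  used below only under integrals.\<close>

definition weak_deriv :: "(real \<Rightarrow> real) \<Rightarrow> real \<Rightarrow> real" where
  "weak_deriv u = (SOME w. has_weak_partial {0<..} 1 u w)"

text \<open>Functions of \<open>r\<close> are total functions on the reals; their values at negative arguments play no
  role.  A radial \<open>H\<^sup>1\<close> function on the plane is continuous away from the origin after modification
  on a null set, and \<open>H_space\<close> consists of these continuous representatives, so that pointwise
  statements about them are meaningful.\<close>

definition H_space :: "(real \<Rightarrow> real) set" where
  "H_space = {u. continuous_on {0<..} u \<and> (\<lambda>x::real^2. u (norm x)) \<in> H1_space UNIV}"

definition X_space :: "(real \<Rightarrow> real) set" where
  "X_space = {u \<in> H_space. (\<integral>\<^sup>+r\<in>{0<..}. ennreal ((u r)\<^sup>2 / r\<^sup>2 * r) \<partial>lborel) < \<infinity>}"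

text \<open>Squared norms with the integrals restricted to \<open>0 < r < R\<close>.\<close>

definition H_sqnorm_upto :: "real \<Rightarrow> (real \<Rightarrow> real) \<Rightarrow> ennreal" where
  "H_sqnorm_upto R u = (\<integral>\<^sup>+r\<in>{0<..<R}. ennreal (((weak_deriv u r)\<^sup>2 + (u r)\<^sup>2) * r) \<partial>lborel)"

definition X_sqnorm_upto :: "real \<Rightarrow> (real \<Rightarrow> real) \<Rightarrow> ennreal" where
  "X_sqnorm_upto R u =
     (\<integral>\<^sup>+r\<in>{0<..<R}. ennreal (((weak_deriv u r)\<^sup>2 + (u r)\<^sup>2 + (u r)\<^sup>2 / r\<^sup>2) * r) \<partial>lborel)"

definition tendsto_H_loc :: "(nat \<Rightarrow> real \<Rightarrow> real) \<Rightarrow> (real \<Rightarrow> real) \<Rightarrow> bool" where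
  "tendsto_H_loc u l \<longleftrightarrow> (\<forall>R>0. (\<lambda>n. H_sqnorm_upto R (\<lambda>r. u n r - l r)) \<longlonglongrightarrow> 0)"

definition tendsto_X_loc :: "(nat \<Rightarrow> real \<Rightarrow> real) \<Rightarrow> (real \<Rightarrow> real) \<Rightarrow> bool" where
  "tendsto_X_loc u l \<longleftrightarrow> (\<forall>R>0. (\<lambda>n. X_sqnorm_upto R (\<lambda>r. u n r - l r)) \<longlonglongrightarrow> 0)"

definition cutoff :: "(real \<Rightarrow> real) \<Rightarrow> bool" where
  "cutoff \<eta> \<longleftrightarrow> smooth_on {0..} \<eta> \<and> (\<forall>r\<in>{0..1}. \<eta> r = 0) \<and> (\<forall>r\<ge>2. \<eta> r = 1) \<and>
     (\<forall>r\<ge>0. 0 \<le> \<eta> r \<and> \<eta> r \<le> 1)"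

definition Y_space ::
    "int \<Rightarrow> (real \<Rightarrow> real) \<Rightarrow> ((real \<Rightarrow> real) \<times> (real \<Rightarrow> real) \<times> (real \<Rightarrow> real)) set" where
  "Y_space d \<eta> = {(\<lambda>r. \<eta> r + u r, \<lambda>r. of_int d * \<eta> r + r * v r, m) | u v m.
     u \<in> X_space \<and> v \<in> X_space \<and> m \<in> H_space}"

definition energy ::
    "int \<Rightarrow> real \<Rightarrow> real \<Rightarrow> (real \<Rightarrow> real) \<times> (real \<Rightarrow> real) \<times> (real \<Rightarrow> real) \<Rightarrow> ennreal" where
  "energy d \<kappa> g = (\<lambda>(f, S, m). 1 / 2 *
     (\<integral>\<^sup>+r\<in>{0<..}. ennreal (((weak_deriv f r)\<^sup>2 + (weak_deriv S r / r)\<^sup>2 + (weak_deriv m r)\<^sup>2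
        + \<kappa>\<^sup>2 * g * (m r)\<^sup>2 + (of_int d - S r)\<^sup>2 * (f r)\<^sup>2 / r\<^sup>2
        + \<kappa>\<^sup>2 / 2 * (1 - (f r)\<^sup>2 - (m r)\<^sup>2)\<^sup>2) * r) \<partial>lborel))"

end

theory Submission
  imports Defs
begin

text \<open>The minimal energy tends to \<open>0\<close> as \<open>g \<rightarrow> 0\<close>: take \<open>f = sin \<theta>\<close>, \<open>m = cos \<theta>\<close> with an angle
  \<open>\<theta>\<close> rising from \<open>0\<close> to \<open>\<pi>/2\<close> logarithmically on \<open>[A, A exp L]\<close>, and \<open>S\<close> equal to \<open>d\<close> beyond \<open>A\<close>.
  The potential and the coupling term vanish, the gradient terms cost \<open>O(1/L + 1/A\<^sup>2)\<close>, and the mass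
  term is \<open>O(g)\<close> for fixed \<open>A\<close>, \<open>L\<close>.  Hence every term of the energy of the minimizers tends to \<open>0\<close>.
  Since \<open>S\<close> vanishes at the origin (because \<open>\<integral> v\<^sup>2/r dr < \<infinity>\<close>), the term \<open>(S'/r)\<^sup>2\<close> forces \<open>S \<rightarrow> 0\<close> locally
  uniformly; then \<open>\<bar>d - S\<bar> \<ge> 1/2\<close> on \<open>[0, R]\<close> and the coupling term controls \<open>f\<^sup>2/r\<^sup>2\<close>; finally
  \<open>(1 - m)\<^sup>2 \<le> \<bar>1 - m\<^sup>2\<bar>\<close> for \<open>m \<ge> 0\<close>, and the potential term gives \<open>m \<rightarrow> 1\<close>.

  The definition of \<open>weak_deriv\<close> is a choice, so these estimates need that a radial \<open>H\<^sup>1\<close> function on the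
  plane has a weak derivative in \<open>r\<close>.  Testing against the vector fields \<open>\<phi>(\<bar>x\<bar>) x/\<bar>x\<bar>\<^sup>2\<close>, whose divergence
  is \<open>\<phi>'(\<bar>x\<bar>)/\<bar>x\<bar>\<close>, yields it as a Radon-Nikodym density of an image measure under the norm.\<close>

section \<open>Calculus of continuously differentiable functions\<close>

text \<open>In the variable \<open>ln r\<close> the Dirichlet integral of the angle is
  one-dimensional, so a fixed rise spread over length \<open>L\<close> costs O(1/L).
  \<open>A\<close> and \<open>L\<close> are fixed by the target accuracy alone and only then does
  \<open>g\<close> tend to 0, so the huge radius \<open>A * exp L\<close> in the mass term is
  harmless. \<open>S\<close> makes its transition on [A/2, A], where \<open>f\<close> still
  vanishes, so \<open>f\<close> and \<open>d - S\<close> are never both nonzero.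

  Weak derivatives are needed in opposite ways. For the competitor it is uniqueness up to null sets,
  which makes the chosen \<open>weak_deriv\<close> the classical derivative. For the minimizers it
  is existence: only then does \<open>weak_deriv\<close> obey the fundamental theorem of calculus
  and is the energy integrand measurable.

  The given cutoff is the only source of smooth functions: the derivative of its extension has unit
  mass and acts as a mollifier, differences of rescaled copies are the test functions, and further
  copies are the profiles of the competitor. Young's inequality with a free \<epsilon> takes the
  place of Cauchy-Schwarz, so that every bound is affine in the energy and can be integrated
  directly in \<open>ennreal\<close>.\<close>

lemma Ck_on_const: "Ck_on k A (\<lambda>x. c)"
proof (induction k arbitrary: c)
  case (Suc k)
  show ?case unfolding Ck_on.simps
    by (rule exI[of _ "\<lambda>x h. 0"]) (auto intro!: derivative_eq_intros Suc)
qed simp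

lemma Ck_on_SucD: "Ck_on (Suc k) A f \<Longrightarrow> Ck_on k A f"
proof (induction k arbitrary: f)
  case 0
  then show ?case
    by (auto simp: continuous_on_eq_continuous_within intro: has_derivative_continuous)
next
  case (Suc k)
  from Suc.prems obtain f' where "\<forall>x\<in>A. (f has_derivative f' x) (at x within A)"
    and "\<forall>b\<in>Basis. Ck_on (Suc k) A (\<lambda>x. f' x b)"
    unfolding Ck_on.simps(2)[of "Suc k"] by blast
  with Suc.IH show ?case unfolding Ck_on.simps by blast
qed

lemma Ck_on_continuous: "Ck_on k A f \<Longrightarrow> continuous_on A f"
proof (induction k arbitrary: f)
  case (Suc k)
  show ?case by (rule Suc.IH[OF Ck_on_SucD[OF Suc.prems]])
qed simp

lemma Ck_on_cong: "Ck_on k A f \<Longrightarrow> (\<And>x. x \<in> A \<Longrightarrow> f x = h x) \<Longrightarrow> Ck_on k A h"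
proof (induction k)
  case 0
  then show ?case by (simp cong: continuous_on_cong)
next
  case (Suc k)
  then obtain f' where f': "\<forall>x\<in>A. (f has_derivative f' x) (at x within A)"
    "\<forall>b\<in>Basis. Ck_on k A (\<lambda>x. f' x b)" by auto
  have "(h has_derivative f' x) (at x within A)" if "x \<in> A" for x
    using f'(1) Suc.prems(2) that has_derivative_transform[of x A h f] by force
  then show ?case using f'(2) by auto
qed

lemma Ck_on_subset: "Ck_on k A f \<Longrightarrow> B \<subseteq> A \<Longrightarrow> Ck_on k B f"
proof (induction k arbitrary: f)
  case (Suc k)
  then show ?case
    unfolding Ck_on.simps by (meson has_derivative_subset subsetD)
qed (auto intro: continuous_on_subset)

lemma Ck_on_add: "Ck_on k A f \<Longrightarrow> Ck_on k A h \<Longrightarrow> Ck_on k A (\<lambda>x. f x + h x)"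
proof (induction k arbitrary: f h)
  case (Suc k)
  then obtain f' h' where *:
    "\<forall>x\<in>A. (f has_derivative f' x) (at x within A)" "\<forall>b\<in>Basis. Ck_on k A (\<lambda>x. f' x b)"
    "\<forall>x\<in>A. (h has_derivative h' x) (at x within A)" "\<forall>b\<in>Basis. Ck_on k A (\<lambda>x. h' x b)"
    by auto
  show ?case unfolding Ck_on.simps
    by (rule exI[of _ "\<lambda>x y. f' x y + h' x y"]) (use * Suc.IH in \<open>auto intro!: derivative_intros\<close>)
qed (auto intro: continuous_intros)

lemma Ck_on_mult: "Ck_on k A f \<Longrightarrow> Ck_on k A h \<Longrightarrow> Ck_on k A (\<lambda>x. f x * h x)"
proof (induction k arbitrary: f h)
  case (Suc k)
  then obtain f' h' where *:
    "\<forall>x\<in>A. (f has_derivative f' x) (at x within A)" "\<forall>b\<in>Basis. Ck_on k A (\<lambda>x. f' x b)"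
    "\<forall>x\<in>A. (h has_derivative h' x) (at x within A)" "\<forall>b\<in>Basis. Ck_on k A (\<lambda>x. h' x b)"
    by auto
  have "Ck_on k A f" "Ck_on k A h" using Suc.prems Ck_on_SucD by blast+
  then show ?case unfolding Ck_on.simps
    by (intro exI[of _ "\<lambda>x y. f x * h' x y + f' x y * h x"])
      (use * Suc.IH in \<open>auto intro!: derivative_intros Ck_on_add\<close>)
qed (auto intro: continuous_intros)

lemma Ck_on_diff: "Ck_on k A f \<Longrightarrow> Ck_on k A h \<Longrightarrow> Ck_on k A (\<lambda>x. f x - h x)"
  using Ck_on_add[of k A f "\<lambda>x. (-1) * h x"] Ck_on_mult[of k A "\<lambda>x. -1" h] Ck_on_const by auto

text \<open>With a real argument the outer derivative is multiplication by
  \<open>f' (q x) 1\<close>. Writing the chain rule as this product of scalars makes each partial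
  derivative a product of functions already known to be \<open>Ck_on k\<close>, so the induction
  closes.\<close>

lemma Ck_on_compose:
  fixes f :: "real \<Rightarrow> real"
  shows "Ck_on k B f \<Longrightarrow> Ck_on k A q \<Longrightarrow> q ` A \<subseteq> B \<Longrightarrow> Ck_on k A (\<lambda>x. f (q x))"
proof (induction k arbitrary: f q)
  case 0
  then show ?case by (auto intro: continuous_on_compose2)
next
  case (Suc k)
  then obtain f' q' where *:
    "\<forall>x\<in>B. (f has_derivative f' x) (at x within B)" "Ck_on k B (\<lambda>x. f' x 1)"
    "\<forall>x\<in>A. (q has_derivative q' x) (at x within A)" "\<forall>b\<in>Basis. Ck_on k A (\<lambda>x. q' x b)"
    by auto
  have q: "Ck_on k A q" using Suc.prems Ck_on_SucD by blast
  have "((\<lambda>x. f (q x)) has_derivative (\<lambda>y. f' (q x) 1 * q' x y)) (at x within A)" if "x \<in> A" for x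
  proof -
    have qx: "q x \<in> B" using Suc.prems that by auto
    have "((\<lambda>x. f (q x)) has_derivative (\<lambda>y. f' (q x) (q' x y))) (at x within A)"
      using *(1,3) that qx Suc.prems(3)
      by (intro has_derivative_in_compose2[of B f f' q A x "q' x"]) auto
    moreover have "(\<lambda>y. f' (q x) (q' x y)) = (\<lambda>y. f' (q x) 1 * q' x y)"
    proof
      interpret bounded_linear "f' (q x)"
        by (rule has_derivative_bounded_linear) (use *(1) qx in blast)
      show "f' (q x) (q' x y) = f' (q x) 1 * q' x y" for y
        using scaleR[of "q' x y" 1] by (simp add: mult.commute)
    qed
    ultimately show ?thesis by simp
  qed
  moreover have "Ck_on k A (\<lambda>x. f' (q x) 1)"
    using Suc.IH[OF *(2) q Suc.prems(3)] .
  ultimately show ?case unfolding Ck_on.simps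
    by (intro exI[of _ "\<lambda>x y. f' (q x) 1 * q' x y"]) (use * in \<open>auto intro!: Ck_on_mult\<close>)
qed

lemma Ck_on_linear:
  assumes "bounded_linear f" shows "Ck_on k A f"
proof (cases k)
  case 0
  then show ?thesis using assms by (auto intro: linear_continuous_on)
next
  case (Suc n)
  then show ?thesis unfolding Suc Ck_on.simps
    by (intro exI[of _ "\<lambda>x. f"]) (auto intro: Ck_on_const bounded_linear_imp_has_derivative assms)
qed

text \<open>The exponent is arbitrary because differentiation lowers it by one. The exponents 1/2
  and -1 later express functions of the norm through \<open>x \<bullet> x\<close>.\<close>

lemma Ck_on_powr: "Ck_on k {0<..} (\<lambda>x::real. x powr a)"
proof (induction k arbitrary: a)
  case 0
  show ?case by (auto intro!: continuous_intros)
next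
  case (Suc k)
  have "((\<lambda>x. x powr a) has_derivative (\<lambda>h. (a * x powr (a - 1)) * h)) (at x within {0<..})"
    if "x > 0" for x :: real
  proof -
    have "((\<lambda>x. x powr a) has_real_derivative a * x powr (a - 1)) (at x)"
      using that by (rule has_real_derivative_powr)
    then show ?thesis
      unfolding has_field_derivative_def by (rule has_derivative_at_withinI)
  qed
  then show ?case unfolding Ck_on.simps
    by (intro exI[of _ "\<lambda>x h. (a * x powr (a - 1)) * h"])
      (auto intro!: Ck_on_mult Ck_on_const Suc)
qed

text \<open>\<open>A\<close> and the complement of \<open>K\<close> are open and cover the space,
  and \<open>f\<close> is zero on the second. The derivative \<open>F\<close> is set to 0 off
  \<open>K\<close> by hand so that it satisfies the support condition of the induction hypothesis;
  on \<open>A\<close> outside \<open>K\<close> it agrees with \<open>f'\<close> by uniqueness of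
  derivatives.\<close>

lemma Ck_on_zero_extend:
  assumes "Ck_on k A f" "open A" "closed K" "K \<subseteq> A" "\<And>x. x \<notin> K \<Longrightarrow> f x = 0"
  shows "Ck_on k UNIV f"
  using assms(1,5)
proof (induction k arbitrary: f)
  case 0
  have "continuous_on (A \<union> -K) f"
    using 0 assms(2,3) continuous_on_cong[of "-K" "-K" f "\<lambda>x. 0"]
    by (intro continuous_on_open_Un) auto
  moreover have "A \<union> -K = UNIV" using assms(4) by auto
  ultimately show ?case by simp
next
  case (Suc k)
  then obtain f' where f': "\<forall>x\<in>A. (f has_derivative f' x) (at x within A)"
    "\<forall>b\<in>Basis. Ck_on k A (\<lambda>x. f' x b)" by auto
  define F where "F = (\<lambda>x y. if x \<in> K then f' x y else 0)"
  have zero: "(f has_derivative (\<lambda>y. 0)) (at x)" if "x \<notin> K" for x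
  proof -
    have "((\<lambda>x. 0::real) has_derivative (\<lambda>y. 0)) (at x)" by simp
    then show ?thesis
      by (rule has_derivative_transform_within_open[where s="-K"]) (use assms(3) that Suc.prems in auto)
  qed
  have fA: "(f has_derivative f' x) (at x)" if "x \<in> A" for x
    using f'(1) that assms(2) at_within_open by metis
  have eq: "F x b = f' x b" if "x \<in> A" for x b
    using has_derivative_unique[OF fA[OF that] zero] by (auto simp: F_def)
  have "(f has_derivative F x) (at x)" for x
    using fA[of x] zero[of x] assms(4) eq[of x] by (cases "x \<in> K") (auto simp: F_def)
  moreover have "Ck_on k UNIV (\<lambda>x. F x b)" if "b \<in> Basis" for b
  proof (rule Suc.IH)
    show "Ck_on k A (\<lambda>x. F x b)"
      by (rule Ck_on_cong[where f="\<lambda>x. f' x b"]) (use f'(2) that eq in auto)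
  qed (auto simp: F_def)
  ultimately show ?case by auto
qed

lemma smooth_on_has_derivative:
  assumes "smooth_on UNIV f"
  shows "(f has_derivative frechet_derivative f (at x)) (at x)"
    and "b \<in> Basis \<Longrightarrow> continuous_on UNIV (\<lambda>x. frechet_derivative f (at x) b)"
proof -
  have "Ck_on (Suc 0) UNIV f" using assms by (auto simp: smooth_on_def)
  then obtain f' where f': "\<And>x. (f has_derivative f' x) (at x)"
    "\<And>b. b \<in> Basis \<Longrightarrow> continuous_on UNIV (\<lambda>x. f' x b)" by auto
  then have "f' x = frechet_derivative f (at x)" for x
    using frechet_derivative_at by blast
  with f' show "(f has_derivative frechet_derivative f (at x)) (at x)"
    and "b \<in> Basis \<Longrightarrow> continuous_on UNIV (\<lambda>x. frechet_derivative f (at x) b)" by auto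
qed

section \<open>Integration by parts against test functions\<close>

lemma integrable_continuous_compact_support:
  fixes h :: "'a::euclidean_space \<Rightarrow> real"
  assumes "continuous_on UNIV h" "compact K" "\<And>x. x \<notin> K \<Longrightarrow> h x = 0"
  shows "integrable lborel h"
proof -
  have "integrable lborel (\<lambda>x. indicator K x *\<^sub>R h x)"
    using assms by (intro borel_integrable_compact) (auto intro: continuous_on_subset)
  moreover have "(\<lambda>x. indicator K x *\<^sub>R h x) = h"
    using assms(3) by (auto simp: indicator_def fun_eq_iff)
  ultimately show ?thesis by simp
qed

lemma bounded_continuous_compact_support:
  fixes h :: "'a::euclidean_space \<Rightarrow> real"
  assumes "continuous_on UNIV h" "compact K" "\<And>x. x \<notin> K \<Longrightarrow> h x = 0"
  obtains C where "C \<ge> 0" "\<And>x. \<bar>h x\<bar> \<le> C"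
proof -
  have "bounded (h ` K)"
    using assms by (intro compact_imp_bounded compact_continuous_image) (auto intro: continuous_on_subset)
  then obtain C where "\<forall>x\<in>K. \<bar>h x\<bar> \<le> C" by (auto simp: bounded_iff)
  then have "\<bar>h x\<bar> \<le> max C 0" for x using assms(3)[of x] by (cases "x \<in> K") auto
  then show ?thesis using that[of "max C 0"] by auto
qed

lemma has_derivative_zero_outside:
  fixes h :: "'a::real_normed_vector \<Rightarrow> real"
  assumes "(h has_derivative D) (at x)" "closed K" "\<And>x. x \<notin> K \<Longrightarrow> h x = 0" "x \<notin> K"
  shows "D = (\<lambda>_. 0)"
proof (rule has_derivative_unique[OF assms(1)])
  have "((\<lambda>x. 0::real) has_derivative (\<lambda>y. 0)) (at x)" by simp
  then show "(h has_derivative (\<lambda>_. 0)) (at x)"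
    by (rule has_derivative_transform_within_open[where s="-K"]) (use assms(2,3,4) in auto)
qed

text \<open>The difference quotients have integral zero by translation invariance, and they converge
  dominatedly to the directional derivative.\<close>

lemma integral_directional_derivative_zero:
  fixes h :: "'a::euclidean_space \<Rightarrow> real"
  assumes der: "\<And>x. (h has_derivative h' x) (at x)" and cont: "continuous_on UNIV (\<lambda>x. h' x b)"
    and K: "compact K" "\<And>x. x \<notin> K \<Longrightarrow> h x = 0"
  shows "(LINT x|lborel. h' x b) = 0"
proof -
  have zero: "h' x b = 0" if "x \<notin> K" for x
    using has_derivative_zero_outside[OF der compact_imp_closed[OF K(1)] K(2) that] by simp
  obtain C where C: "C \<ge> 0" "\<And>x. \<bar>h' x b\<bar> \<le> C"
    using bounded_continuous_compact_support[OF cont K(1) zero] by metis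
  obtain B where B: "K \<subseteq> cball 0 B"
    using compact_imp_bounded[OF K(1)] unfolding bounded_iff by (auto simp: subset_iff)
  have conth: "continuous_on UNIV h"
    using der by (meson continuous_at_imp_continuous_on has_derivative_continuous)
  have hint: "integrable lborel h"
    by (rule integrable_continuous_compact_support[OF conth K])
  have [measurable]: "h \<in> borel_measurable borel"
    using conth by (rule borel_measurable_continuous_onI)
  have [measurable]: "(\<lambda>x. h' x b) \<in> borel_measurable borel"
    using cont by (rule borel_measurable_continuous_onI)
  have path: "((\<lambda>t. h (x + t *\<^sub>R b)) has_real_derivative h' (x + t *\<^sub>R b) b) (at t)" for x t
  proof -
    have "((\<lambda>t. x + t *\<^sub>R b) has_derivative (\<lambda>t. t *\<^sub>R b)) (at t)"
      by (auto intro!: derivative_eq_intros)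
    from has_derivative_compose[OF this der]
    have "((\<lambda>t. h (x + t *\<^sub>R b)) has_derivative (\<lambda>s. h' (x + t *\<^sub>R b) (s *\<^sub>R b))) (at t)" .
    moreover have "(\<lambda>s. h' (x + t *\<^sub>R b) (s *\<^sub>R b)) = (*) (h' (x + t *\<^sub>R b) b)"
    proof
      fix s
      interpret bounded_linear "h' (x + t *\<^sub>R b)" using der by (rule has_derivative_bounded_linear)
      show "h' (x + t *\<^sub>R b) (s *\<^sub>R b) = h' (x + t *\<^sub>R b) b * s"
        by (simp add: scaleR mult.commute)
    qed
    ultimately show ?thesis by (simp add: has_field_derivative_def)
  qed
  \<comment> \<open>The mean value theorem along the line in direction \<open>b\<close> bounds all
    difference quotients by the same constant \<open>C\<close>.\<close>
  have lip: "\<bar>h (x + t *\<^sub>R b) - h x\<bar> \<le> C * t" if tpos: "t > 0" for x t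
  proof -
    obtain z where "h (x + t *\<^sub>R b) - h (x + 0 *\<^sub>R b) = (t - 0) * h' (x + z *\<^sub>R b) b"
      using MVT2[OF tpos, of "\<lambda>t. h (x + t *\<^sub>R b)" "\<lambda>t. h' (x + t *\<^sub>R b) b"] path by blast
    then show ?thesis using C(2)[of "x + z *\<^sub>R b"] that by (simp add: abs_mult mult.commute mult_right_mono)
  qed
  define t where "t n = inverse (real (Suc n))" for n
  have t: "t n > 0" "t n \<le> 1" for n by (auto simp: t_def inverse_le_1_iff)
  have t0: "t \<longlonglongrightarrow> 0" unfolding t_def by (rule LIMSEQ_inverse_real_of_nat)
  define q where "q n x = (h (x + t n *\<^sub>R b) - h x) / t n" for n x
  have "(LINT x|lborel. q n x) = 0" for n
  proof -
    have "(LINT x|lborel. h (x + t n *\<^sub>R b)) = (LINT x|distr lborel borel ((+) (t n *\<^sub>R b)). h x)"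
      by (subst integral_distr) (auto simp: add.commute)
    moreover have "integrable (distr lborel borel ((+) (t n *\<^sub>R b))) h"
      using hint by (simp add: lborel_distr_plus)
    then have "integrable lborel (\<lambda>x. h (x + t n *\<^sub>R b))"
      by (subst (asm) integrable_distr_eq) (auto simp: add.commute)
    ultimately show ?thesis
      using hint by (simp add: q_def lborel_distr_plus)
  qed
  moreover have "(\<lambda>n. LINT x|lborel. q n x) \<longlonglongrightarrow> (LINT x|lborel. h' x b)"
  \<comment> \<open>As \<open>t n \<le> 1\<close>, a point outside the ball of radius
    \<open>B + norm b\<close> stays outside \<open>K\<close> after the shift by
    \<open>t n *\<^sub>R b\<close>, so one ball carries all the quotients.\<close>
  proof (rule integral_dominated_convergence[where w="\<lambda>x. C * indicator (cball 0 (B + norm b)) x"])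
    have "emeasure lborel (cball (0::'a) (B + norm b)) < \<infinity>"
      by (rule emeasure_lborel_cball_finite)
    then have "integrable lborel (indicator (cball (0::'a) (B + norm b)) :: 'a \<Rightarrow> real)"
      by (intro integrable_real_indicator) auto
    then show "integrable lborel (\<lambda>x::'a. C * indicator (cball 0 (B + norm b)) x)"
      by simp
    show "AE x in lborel. (\<lambda>n. q n x) \<longlonglongrightarrow> h' x b"
    proof (rule AE_I2)
      fix x
      have "((\<lambda>y. (h (x + y *\<^sub>R b) - h x) / y) \<longlongrightarrow> h' x b) (at 0)"
        using path[of x 0] by (simp add: has_field_derivative_iff)
      moreover have "t n \<noteq> 0" for n using t(1)[of n] by simp
      then have "filterlim t (at 0) sequentially"
        using t0 by (simp add: filterlim_at)
      ultimately show "(\<lambda>n. q n x) \<longlonglongrightarrow> h' x b"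
        unfolding q_def by (rule filterlim_compose)
    qed
    fix n
    show "AE x in lborel. norm (q n x) \<le> C * indicator (cball 0 (B + norm b)) x"
    proof (rule AE_I2)
      fix x
      show "norm (q n x) \<le> C * indicator (cball 0 (B + norm b)) x"
      proof (cases "x \<in> cball 0 (B + norm b)")
        case True
        then show ?thesis using lip[OF t(1), of x n] t(1)[of n]
          by (simp add: q_def abs_divide pos_divide_le_eq)
      next
        case False
        have "norm x > B + norm b" using False by simp
        moreover have "norm (t n *\<^sub>R b) \<le> norm b" using t[of n] by (simp add: mult_left_le_one_le)
        moreover have "norm x \<le> norm (x + t n *\<^sub>R b) + norm (t n *\<^sub>R b)"
          using norm_triangle_ineq4[of "x + t n *\<^sub>R b" "t n *\<^sub>R b"] by simp
        ultimately have "norm (x + t n *\<^sub>R b) > B" "norm x > B"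
          using norm_ge_zero[of b] by linarith+
        then have "x + t n *\<^sub>R b \<notin> K" "x \<notin> K" using B by (auto simp: subset_iff)
        then show ?thesis using K(2) C(1) by (simp add: q_def)
      qed
    qed
  qed (auto simp: q_def)
  ultimately show ?thesis by (simp add: LIMSEQ_const_iff)
qed

lemma test_functions_facts:
  fixes \<phi> :: "'a::euclidean_space \<Rightarrow> real"
  assumes "\<phi> \<in> test_functions \<Omega>"
  obtains K where "compact K" "K \<subseteq> \<Omega>" "\<And>x. x \<notin> K \<Longrightarrow> \<phi> x = 0"
    "\<And>x. (\<phi> has_derivative frechet_derivative \<phi> (at x)) (at x)"
    "\<And>b. b \<in> Basis \<Longrightarrow> continuous_on UNIV (\<lambda>x. frechet_derivative \<phi> (at x) b)"
    "continuous_on UNIV \<phi>"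
    "\<And>x b. x \<notin> K \<Longrightarrow> frechet_derivative \<phi> (at x) b = 0"
proof -
  have sm: "smooth_on UNIV \<phi>" using assms by (simp add: test_functions_def)
  obtain K where K: "compact K" "K \<subseteq> \<Omega>" "\<And>x. x \<notin> K \<Longrightarrow> \<phi> x = 0"
    using assms by (auto simp: test_functions_def)
  note d = smooth_on_has_derivative[OF sm]
  have "continuous_on UNIV \<phi>"
    using sm Ck_on_continuous[of 0 UNIV \<phi>] by (auto simp: smooth_on_def)
  then show ?thesis
    using that[OF K d] has_derivative_zero_outside[OF d(1) compact_imp_closed[OF K(1)] K(3)] by auto
qed

lemma locally_integrable_on_continuous:
  "continuous_on \<Omega> u \<Longrightarrow> locally_integrable_on \<Omega> u"
  unfolding locally_integrable_on_def set_integrable_def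
  by (intro allI impI borel_integrable_compact) (auto intro: continuous_on_subset)

text \<open>The directional derivative of \<open>u x * \<phi> x\<close> is continuous with compact
  support and therefore has integral zero; the product rule splits it into the two sides.\<close>

lemma has_weak_partial_classical:
  fixes u :: "'a::euclidean_space \<Rightarrow> real"
  assumes "open \<Omega>" and der: "\<And>x. x \<in> \<Omega> \<Longrightarrow> (u has_derivative u' x) (at x)"
    and cont: "continuous_on \<Omega> (\<lambda>x. u' x b)" and b: "b \<in> Basis"
  shows "has_weak_partial \<Omega> b u (\<lambda>x. u' x b)"
  unfolding has_weak_partial_def
proof (intro conjI ballI)
  have contu: "continuous_on \<Omega> u"
    using der by (meson continuous_at_imp_continuous_on has_derivative_continuous)
  show "locally_integrable_on \<Omega> u" "locally_integrable_on \<Omega> (\<lambda>x. u' x b)"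
    using contu cont by (auto intro: locally_integrable_on_continuous)
  fix \<phi> assume "\<phi> \<in> test_functions \<Omega>"
  then obtain K where K: "compact K" "K \<subseteq> \<Omega>" "\<And>x. x \<notin> K \<Longrightarrow> \<phi> x = 0"
    and d\<phi>: "\<And>x. (\<phi> has_derivative frechet_derivative \<phi> (at x)) (at x)"
    and cd\<phi>: "\<And>b. b \<in> Basis \<Longrightarrow> continuous_on UNIV (\<lambda>x. frechet_derivative \<phi> (at x) b)"
    and c\<phi>: "continuous_on UNIV \<phi>"
    and z\<phi>: "\<And>x b. x \<notin> K \<Longrightarrow> frechet_derivative \<phi> (at x) b = 0"
    by (rule test_functions_facts) blast
  have UN: "\<Omega> \<union> -K = UNIV" using K(2) by auto
  have ext: "continuous_on UNIV w" if "continuous_on \<Omega> w" "\<And>x. x \<notin> K \<Longrightarrow> w x = 0" for w :: "'a \<Rightarrow> real"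
  proof -
    have "continuous_on (\<Omega> \<union> -K) w"
      using that K(1) assms(1) continuous_on_cong[of "-K" "-K" w "\<lambda>x. 0"]
      by (intro continuous_on_open_Un) (auto intro: compact_imp_closed)
    then show ?thesis by (simp only: UN)
  qed
  define A where "A x = u x * frechet_derivative \<phi> (at x) b" for x
  define B where "B x = u' x b * \<phi> x" for x
  have cA: "continuous_on UNIV A"
    by (rule ext) (auto simp: A_def z\<phi> intro!: continuous_intros contu continuous_on_subset[OF cd\<phi>[OF b]])
  have cB: "continuous_on UNIV B"
    by (rule ext) (auto simp: B_def K(3) intro!: continuous_intros cont continuous_on_subset[OF c\<phi>])
  have zA: "A x = 0" if "x \<notin> K" for x using z\<phi> that by (simp add: A_def)
  have zB: "B x = 0" if "x \<notin> K" for x using K(3) that by (simp add: B_def)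
  \<comment> \<open>Outside \<Omega> nothing is known about the differentiability of
    \<open>u\<close>. Off \<open>K\<close> the product is zero in a neighbourhood, so its derivative
    there is zero whatever \<open>u\<close> does.\<close>
  define h' where "h' x y = (if x \<in> K then u x * frechet_derivative \<phi> (at x) y + u' x y * \<phi> x else 0)" for x y
  have h'b: "h' x b = A x + B x" for x
    by (auto simp: h'_def A_def B_def z\<phi> K(3))
  have "(LINT x|lborel. h' x b) = 0"
  proof (rule integral_directional_derivative_zero[where h="\<lambda>x. u x * \<phi> x" and K=K])
    show "((\<lambda>x. u x * \<phi> x) has_derivative h' x) (at x)" for x
    proof (cases "x \<in> K")
      case True
      then show ?thesis unfolding h'_def using der d\<phi> K(2) by (auto intro!: derivative_eq_intros)
    next
      case False
      have "((\<lambda>x. 0::real) has_derivative (\<lambda>y. 0)) (at x)" by simp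
      then have "((\<lambda>x. u x * \<phi> x) has_derivative (\<lambda>y. 0)) (at x)"
        by (rule has_derivative_transform_within_open[where s="-K"])
          (use K False compact_imp_closed in auto)
      then show ?thesis using False by (simp add: h'_def[abs_def])
    qed
    show "continuous_on UNIV (\<lambda>x. h' x b)"
      using continuous_on_add[OF cA cB] by (simp add: h'b)
  qed (use K in auto)
  moreover have "integrable lborel A" "integrable lborel B"
    using integrable_continuous_compact_support[OF cA K(1) zA]
      integrable_continuous_compact_support[OF cB K(1) zB] by auto
  ultimately have "(LINT x|lborel. A x) = - (LINT x|lborel. B x)"
    by (simp add: h'b)
  moreover have "(\<lambda>x. indicator \<Omega> x *\<^sub>R (u x * frechet_derivative \<phi> (at x) b)) = A"
    using K(2) z\<phi> by (fastforce simp: A_def indicator_def fun_eq_iff)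
  moreover have "(\<lambda>x. indicator \<Omega> x *\<^sub>R (u' x b * \<phi> x)) = B"
    using K(2,3) by (fastforce simp: B_def indicator_def fun_eq_iff)
  ultimately show "(LINT x:\<Omega>|lborel. u x * frechet_derivative \<phi> (at x) b) =
      - (LINT x:\<Omega>|lborel. u' x b * \<phi> x)"
    by (simp add: set_lebesgue_integral_def)
qed

section \<open>Weak derivatives on the half-line\<close>

text \<open>The positive and the negative part of \<open>f\<close> define two measures that agree
  and are finite on all half-lines. Half-lines determine such a measure, and a density is unique up
  to null sets; where the two parts are equal, both vanish.\<close>

lemma AE_zero_if_integral_Ioi_zero:
  fixes f :: "real \<Rightarrow> real"
  assumes f: "integrable lborel f" and zero: "\<And>c. (LINT x:{c<..}|lborel. f x) = 0"
  shows "AE x in lborel. f x = 0"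
proof -
  define p where "p x = max (f x) 0" for x
  define q where "q x = max (- f x) 0" for x
  have [measurable]: "f \<in> borel_measurable borel" using f by auto
  have int: "integrable lborel (\<lambda>x. indicator {c<..} x * p x)" "integrable lborel (\<lambda>x. indicator {c<..} x * q x)" for c
    by (rule Bochner_Integration.integrable_bound[OF f]; auto simp: p_def q_def indicator_def)+
  have pq: "(LINT x|lborel. indicator {c<..} x * p x) = (LINT x|lborel. indicator {c<..} x * q x)" for c
  proof -
    have "(LINT x|lborel. indicator {c<..} x * p x) - (LINT x|lborel. indicator {c<..} x * q x)
        = (LINT x|lborel. indicator {c<..} x * p x - indicator {c<..} x * q x)"
      using int by simp
    also have "\<dots> = (LINT x:{c<..}|lborel. f x)"
      unfolding set_lebesgue_integral_def by (rule Bochner_Integration.integral_cong) (auto simp: p_def q_def indicator_def)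
    finally show ?thesis using zero by simp
  qed
  have em: "emeasure (density lborel (\<lambda>x. ennreal (h x))) {c<..}
      = ennreal (LINT x|lborel. indicator {c<..} x * h x)"
    if [measurable]: "h \<in> borel_measurable borel" and "\<And>x. 0 \<le> h x"
      and "integrable lborel (\<lambda>x. indicator {c<..} x * h x)" for h :: "real \<Rightarrow> real" and c
  proof -
    have "emeasure (density lborel (\<lambda>x. ennreal (h x))) {c<..}
        = (\<integral>\<^sup>+x. ennreal (indicator {c<..} x * h x) \<partial>lborel)"
      by (subst emeasure_density) (auto intro!: nn_integral_cong simp: indicator_def)
    also have "\<dots> = ennreal (LINT x|lborel. indicator {c<..} x * h x)"
      using that by (intro nn_integral_eq_integral) auto
    finally show ?thesis .
  qed
  have meas[measurable]: "p \<in> borel_measurable borel" "q \<in> borel_measurable borel"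
    unfolding p_def q_def by measurable
  have nn: "0 \<le> p x" "0 \<le> q x" for x by (auto simp: p_def q_def)
  have "density lborel (\<lambda>x. ennreal (p x)) = density lborel (\<lambda>x. ennreal (q x))"
  proof (rule measure_eqI_lessThan)
    fix c
    show "emeasure (density lborel (\<lambda>x. ennreal (p x))) {c<..} < \<infinity>"
      using em[OF meas(1) nn(1) int(1)] by simp
    show "emeasure (density lborel (\<lambda>x. ennreal (p x))) {c<..}
      = emeasure (density lborel (\<lambda>x. ennreal (q x))) {c<..}"
      using em[OF meas(1) nn(1) int(1)] em[OF meas(2) nn(2) int(2)] pq by simp
  qed auto
  then have "AE x in lborel. ennreal (p x) = ennreal (q x)"
    by (intro sigma_finite_measure.density_unique[OF sigma_finite_lborel]) auto
  then show ?thesis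
    by eventually_elim (auto simp: nn p_def q_def max_def split: if_splits)
qed

lemma has_derivative_real_imp:
  assumes "(f has_derivative D) (at x)"
  shows "(f has_real_derivative D 1) (at x)"
proof -
  interpret bounded_linear D using assms by (rule has_derivative_bounded_linear)
  have "(*) (D 1) = D"
  proof
    show "D 1 * t = D t" for t using scaleR[of t 1] by (simp add: mult.commute)
  qed
  with assms show ?thesis by (simp add: has_field_derivative_def)
qed

lemma has_weak_partial_integrable:
  fixes u w :: "real \<Rightarrow> real"
  assumes "has_weak_partial {0<..} 1 u w" "0 < (a::real)"
  shows "set_integrable lborel {a..b} w"
proof -
  have "compact {a..b}" "{a..b} \<subseteq> {0<..}" using assms(2) by auto
  then show ?thesis using assms(1) unfolding has_weak_partial_def locally_integrable_on_def by blast
qed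

section \<open>Mollification on the half-line with the given cutoff\<close>

locale smooth_cutoff =
  fixes \<eta> :: "real \<Rightarrow> real"
  assumes cutoff: "cutoff \<eta>"
begin

text \<open>The hypothesis says nothing about \<eta> at negative arguments. This extension is smooth
  on the whole line because \<eta> vanishes on [0, 1], so it can be composed freely with affine maps
  and logarithms.\<close>

definition \<zeta> :: "real \<Rightarrow> real" where "\<zeta> s = (if s < 0 then 0 else \<eta> s)"

definition \<zeta>' :: "real \<Rightarrow> real" where "\<zeta>' s = frechet_derivative \<zeta> (at s) 1"

lemma eta_eq: "0 \<le> r \<Longrightarrow> \<eta> r = \<zeta> r"
  by (simp add: \<zeta>_def)

lemma zeta_0: "s \<le> 1 \<Longrightarrow> \<zeta> s = 0"
  and zeta_1: "2 \<le> s \<Longrightarrow> \<zeta> s = 1"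
  and zeta_bounds: "0 \<le> \<zeta> s" "\<zeta> s \<le> 1"
  using cutoff by (auto simp: \<zeta>_def cutoff_def)

lemma zeta_smooth: "smooth_on UNIV \<zeta>"
  unfolding smooth_on_def
proof
  fix k
  have "Ck_on k {0..} \<eta>" using cutoff by (auto simp: cutoff_def smooth_on_def)
  then have "Ck_on k {0<..} \<eta>" by (rule Ck_on_subset) auto
  then have "Ck_on k {0<..} \<zeta>" by (rule Ck_on_cong) (simp add: \<zeta>_def)
  then show "Ck_on k UNIV \<zeta>"
    by (rule Ck_on_zero_extend[where K="{1..}"]) (auto intro: zeta_0)
qed

lemma zeta_deriv: "(\<zeta> has_real_derivative \<zeta>' s) (at s)"
  unfolding \<zeta>'_def by (intro has_derivative_real_imp smooth_on_has_derivative zeta_smooth)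

lemma zeta'_cont: "continuous_on UNIV \<zeta>'"
  using smooth_on_has_derivative(2)[OF zeta_smooth, of 1] by (simp add: \<zeta>'_def[abs_def])

lemma zeta'_zero: "s \<notin> {1..2} \<Longrightarrow> \<zeta>' s = 0"
proof (rule DERIV_unique[OF zeta_deriv])
  assume s: "s \<notin> {1..2}"
  show "(\<zeta> has_real_derivative 0) (at s)"
  proof (cases "s < 1")
    case True
    show ?thesis
      by (rule has_field_derivative_transform_within_open[where f="\<lambda>_. 0" and S="{..<1}"]) (use True zeta_0 in auto)
  next
    case False
    show ?thesis
      by (rule has_field_derivative_transform_within_open[where f="\<lambda>_. 1" and S="{2<..}"]) (use False s zeta_1 in auto)
  qed
qed

lemma zeta'_bound: obtains C where "C \<ge> 0" "\<And>s. \<bar>\<zeta>' s\<bar> \<le> C"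
  using bounded_continuous_compact_support[OF zeta'_cont, of "{1..2}"] zeta'_zero by auto

text \<open>This makes \<zeta>' a mollifier kernel carried by [1, 2]. It may change sign, as \<eta>
  is not assumed monotone; boundedness is what the limits below rely on.\<close>

lemma zeta'_integral: "(LINT s|lborel. \<zeta>' s) = 1"
proof -
  have "(LINT s|lborel. \<zeta>' s) = (LINT s|lborel. indicator {1..2} s *\<^sub>R \<zeta>' s)"
    using zeta'_zero by (intro Bochner_Integration.integral_cong) (auto simp: indicator_def)
  also have "\<dots> = \<zeta> 2 - \<zeta> 1"
    by (rule integral_FTC_atLeastAtMost)
      (auto intro: has_field_derivative_at_within zeta_deriv continuous_on_subset[OF zeta'_cont]
        simp: has_real_derivative_iff_has_vector_derivative[symmetric])
  finally show ?thesis by (simp add: zeta_0 zeta_1)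
qed

text \<open>A smooth approximation of the indicator of (a, b]. Each step begins to rise at its own
  point and is complete within distance 1/(n+1) to the right, so the limit is 0 at \<open>a\<close>
  and 1 at \<open>b\<close>, and all supports lie in the one compact set [a, b+1].\<close>

definition bump :: "nat \<Rightarrow> real \<Rightarrow> real \<Rightarrow> real \<Rightarrow> real" where
  "bump n a b x = \<zeta> (1 + real (Suc n) * (x - a)) - \<zeta> (1 + real (Suc n) * (x - b))"

lemma bump_zero: "a \<le> b \<Longrightarrow> x \<notin> {a..b+1} \<Longrightarrow> bump n a b x = 0"
proof -
  assume *: "a \<le> b" "x \<notin> {a..b+1}"
  show "bump n a b x = 0"
  proof (cases "x < a")
    case True
    then have "real (Suc n) * (x - a) \<le> 0" "real (Suc n) * (x - b) \<le> 0"
      using *(1) by (auto intro!: mult_nonneg_nonpos)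
    then show ?thesis by (simp add: bump_def zeta_0)
  next
    case False
    then have "x - b \<ge> 1" "x - a \<ge> 1" using * by auto
    then have "real (Suc n) * (x - b) \<ge> 1" "real (Suc n) * (x - a) \<ge> 1"
      using mult_mono[of 1 "real (Suc n)" 1] by auto
    then show ?thesis by (simp add: bump_def zeta_1)
  qed
qed

lemma bump_test: "0 < a \<Longrightarrow> a \<le> b \<Longrightarrow> bump n a b \<in> test_functions {0<..}"
proof -
  assume ab: "0 < a" "a \<le> b"
  have "Ck_on k UNIV (\<lambda>x. \<zeta> (1 + real (Suc n) * (x - c)))" for k c
  proof (rule Ck_on_compose[where f=\<zeta> and B=UNIV and q="\<lambda>x. 1 + real (Suc n) * (x - c)"])
    show "Ck_on k UNIV \<zeta>" using zeta_smooth by (simp add: smooth_on_def)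
    show "Ck_on k UNIV (\<lambda>x. 1 + real (Suc n) * (x - c))"
      by (rule Ck_on_add Ck_on_mult Ck_on_diff Ck_on_const Ck_on_linear[OF bounded_linear_ident])+
  qed simp
  then have "smooth_on UNIV (bump n a b)"
    unfolding smooth_on_def bump_def by (intro allI Ck_on_diff)
  then show ?thesis
    using ab bump_zero[OF ab(2)] unfolding test_functions_def
    by (auto intro!: exI[of _ "{a..b+1}"])
qed

lemma bump_deriv:
  "frechet_derivative (bump n a b) (at x) 1 =
    real (Suc n) * \<zeta>' (1 + real (Suc n) * (x - a)) - real (Suc n) * \<zeta>' (1 + real (Suc n) * (x - b))"
proof -
  have 1: "((\<lambda>x. \<zeta> (1 + real (Suc n) * (x - c))) has_real_derivative
      \<zeta>' (1 + real (Suc n) * (x - c)) * real (Suc n)) (at x)" for c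
    by (rule DERIV_chain2[OF zeta_deriv]) (auto intro!: derivative_eq_intros)
  have "(bump n a b has_real_derivative
    real (Suc n) * \<zeta>' (1 + real (Suc n) * (x - a)) - real (Suc n) * \<zeta>' (1 + real (Suc n) * (x - b))) (at x)"
    unfolding bump_def[abs_def] using DERIV_diff[OF 1[of a] 1[of b]] by (simp add: mult.commute)
  then show ?thesis
    by (metis frechet_derivative_at has_field_derivative_def mult.right_neutral)
qed

lemma bump_bound: "\<bar>bump n a b x\<bar> \<le> 1"
  unfolding bump_def using zeta_bounds[of "1 + real (Suc n) * (x - a)"] zeta_bounds[of "1 + real (Suc n) * (x - b)"]
  by linarith

lemma zeta_step_tendsto:
  "(\<lambda>n. \<zeta> (1 + real (Suc n) * (x - c))) \<longlonglongrightarrow> indicator {c<..} x"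
proof (cases "x > c")
  case True
  have "0 < x - c" using True by simp
  then obtain N where N: "1 < real N * (x - c)" using reals_Archimedean3 by blast
  have "\<zeta> (1 + real (Suc n) * (x - c)) = 1" if "n \<ge> N" for n
  proof (rule zeta_1)
    have "real (Suc n) * (x - c) \<ge> real N * (x - c)"
      using that True by (intro mult_right_mono) auto
    then show "2 \<le> 1 + real (Suc n) * (x - c)" using N by linarith
  qed
  then have "eventually (\<lambda>n. \<zeta> (1 + real (Suc n) * (x - c)) = indicator {c<..} x) sequentially"
    using True by (auto simp: eventually_sequentially)
  then show ?thesis by (rule tendsto_eventually)
next
  case False
  then have "\<zeta> (1 + real (Suc n) * (x - c)) = 0" for n
    by (intro zeta_0) (auto intro: mult_nonneg_nonpos)
  then show ?thesis using False by simp
qed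

lemma bump_tendsto: "a \<le> b \<Longrightarrow> (\<lambda>n. bump n a b x) \<longlonglongrightarrow> indicator {a<..b} x"
  unfolding bump_def using tendsto_diff[OF zeta_step_tendsto[of x a] zeta_step_tendsto[of x b]]
  by (auto simp: indicator_def split: if_splits)

text \<open>The kernel is concentrated just to the right of \<open>c\<close>. The substitution t = 1
  + (n+1)(x - c) moves it to the fixed interval [1, 2] and leaves \<open>u\<close> evaluated at
  points of [c, c+1] that tend to \<open>c\<close>; continuity gives the limit and boundedness on
  [c, c+1] the domination.\<close>

lemma mollified_point_value:
  assumes u: "continuous_on {0<..} u" and c: "0 < c"
  shows "(\<lambda>n. LINT x:{0<..}|lborel. u x * (real (Suc n) * \<zeta>' (1 + real (Suc n) * (x - c)))) \<longlonglongrightarrow> u c"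
    and "set_integrable lborel {0<..} (\<lambda>x. u x * (real (Suc n) * \<zeta>' (1 + real (Suc n) * (x - c))))"
proof -
  have z: "\<zeta>' (1 + real (Suc n) * (x - c)) = 0" if "x \<notin> {c..c+1}" for n x
  proof (rule zeta'_zero)
    show "1 + real (Suc n) * (x - c) \<notin> {1..2}"
    proof (cases "x < c")
      case True
      then have "real (Suc n) * (x - c) < 0" by (intro mult_pos_neg) auto
      then show ?thesis by simp
    next
      case False
      then have "x - c > 1" using that by auto
      then have "real (Suc n) * (x - c) > 1"
        using mult_le_less_imp_less[of 1 "real (Suc n)" 1 "x - c"] by auto
      then show ?thesis by simp
    qed
  qed
  have "integrable lborel (\<lambda>x. indicator {c..c+1} x *\<^sub>R (u x * (real (Suc n) * \<zeta>' (1 + real (Suc n) * (x - c)))))"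
    using c by (intro borel_integrable_compact continuous_intros continuous_on_compose2[OF zeta'_cont]
        continuous_on_subset[OF u]) auto
  also have "(\<lambda>x. indicator {c..c+1} x *\<^sub>R (u x * (real (Suc n) * \<zeta>' (1 + real (Suc n) * (x - c)))))
    = (\<lambda>x. indicator {0<..} x *\<^sub>R (u x * (real (Suc n) * \<zeta>' (1 + real (Suc n) * (x - c)))))"
    using c z by (force simp: indicator_def)
  finally show "set_integrable lborel {0<..} (\<lambda>x. u x * (real (Suc n) * \<zeta>' (1 + real (Suc n) * (x - c))))"
    by (simp add: set_integrable_def)
  \<comment> \<open>\<open>u\<close> is only known to be continuous on the open half-line; cutting
    it off there yields a Borel function on the whole line, as the change of variables
    requires.\<close>
  define U where "U x = indicator {0<..} x * u x" for x
  have Um[measurable]: "U \<in> borel_measurable borel"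
    using borel_measurable_continuous_on_indicator[OF _ u] by (simp add: U_def[abs_def])
  have [measurable]: "\<zeta>' \<in> borel_measurable borel"
    using zeta'_cont by (rule borel_measurable_continuous_onI)
  define y where "y n t = c + (t - 1) / real (Suc n)" for n t
  have eq: "(LINT x:{0<..}|lborel. u x * (real (Suc n) * \<zeta>' (1 + real (Suc n) * (x - c))))
      = (LINT t|lborel. U (y n t) * \<zeta>' t)" for n
  proof -
    define k where "k = real (Suc n)"
    have k: "k > 0" by (simp add: k_def)
    have "(LINT x|lborel. U x * (k * \<zeta>' (1 + k * (x - c))))
      = \<bar>1/k\<bar> *\<^sub>R (LINT t|lborel. U ((c - 1/k) + 1/k * t) * (k * \<zeta>' (1 + k * (((c - 1/k) + 1/k * t) - c))))"
      using k by (intro lborel_integral_real_affine) auto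
    also have "\<dots> = (LINT t|lborel. U (c + (t - 1)/k) * \<zeta>' t)"
    proof -
      have e1: "(c - 1/k) + 1/k * t = c + (t - 1)/k" for t
        by (simp add: diff_divide_distrib)
      have e2: "1 + k * ((c + (t - 1)/k) - c) = t" for t
        using k by simp
      show ?thesis unfolding e1 e2 using k by (simp add: mult.left_commute)
    qed
    finally show ?thesis by (simp add: k_def y_def U_def set_lebesgue_integral_def mult.assoc)
  qed
  have "bounded (u ` {c..c+1})"
    using c by (intro compact_imp_bounded compact_continuous_image continuous_on_subset[OF u]) auto
  then obtain B where "\<forall>x\<in>{c..c+1}. \<bar>u x\<bar> \<le> B" by (auto simp: bounded_iff)
  then have B: "\<bar>u x\<bar> \<le> B" if "x \<in> {c..c+1}" for x using that by blast
  then have B0: "B \<ge> 0" using order_trans[OF abs_ge_zero B[of c]] by simp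
  obtain C where C: "C \<ge> 0" "\<And>s. \<bar>\<zeta>' s\<bar> \<le> C" using zeta'_bound by blast
  have y01: "y n t \<in> {c..c+1}" if "t \<in> {1..2}" for n t
    using that by (auto simp: y_def field_simps)
  have "(\<lambda>n. LINT t|lborel. U (y n t) * \<zeta>' t) \<longlonglongrightarrow> (LINT t|lborel. u c * \<zeta>' t)"
  proof (rule integral_dominated_convergence[where w="\<lambda>t. B * C * indicator {1..2} t"])
    show "AE t in lborel. (\<lambda>n. U (y n t) * \<zeta>' t) \<longlonglongrightarrow> u c * \<zeta>' t"
    proof (rule AE_I2)
      fix t
      show "(\<lambda>n. U (y n t) * \<zeta>' t) \<longlonglongrightarrow> u c * \<zeta>' t"
      proof (cases "t \<in> {1..2}")
        case True
        have "isCont u c" using u c continuous_on_eq_continuous_at[of "{0<..}" u] by auto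
        moreover have "(\<lambda>n. y n t) \<longlonglongrightarrow> c"
        proof -
          have "(\<lambda>n. c + (t - 1) * inverse (real (Suc n))) \<longlonglongrightarrow> c + (t - 1) * 0"
            by (intro tendsto_intros LIMSEQ_inverse_real_of_nat)
          then show ?thesis by (simp add: y_def divide_inverse)
        qed
        ultimately have "(\<lambda>n. u (y n t)) \<longlonglongrightarrow> u c" by (rule isCont_tendsto_compose)
        moreover have "U (y n t) = u (y n t)" for n using y01[OF True, of n] c by (simp add: U_def)
        ultimately show ?thesis by (auto intro: tendsto_intros)
      qed (simp add: zeta'_zero)
    qed
    show "integrable lborel (\<lambda>t::real. B * C * indicator {1..2} t)" by simp
    show "(\<lambda>t. u c * \<zeta>' t) \<in> borel_measurable lborel" by measurable
    show "AE t in lborel. norm (U (y n t) * \<zeta>' t) \<le> B * C * indicator {1..2} t" for n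
    proof (rule AE_I2)
      fix t show "norm (U (y n t) * \<zeta>' t) \<le> B * C * indicator {1..2} t"
      proof (cases "t \<in> {1..2}")
        case True
        have "\<bar>U (y n t)\<bar> \<le> B" using B[OF y01[OF True]] B0 by (auto simp: U_def indicator_def)
        then show ?thesis using True C B0 by (auto simp: abs_mult intro!: mult_mono)
      qed (use zeta'_zero B0 C in \<open>simp\<close>)
    qed
    show "(\<lambda>t. U (y n t) * \<zeta>' t) \<in> borel_measurable lborel" for n
      unfolding y_def by measurable
  qed
  then show "(\<lambda>n. LINT x:{0<..}|lborel. u x * (real (Suc n) * \<zeta>' (1 + real (Suc n) * (x - c)))) \<longlonglongrightarrow> u c"
    unfolding eq by (simp add: zeta'_integral)
qed

text \<open>Testing with \<open>bump n a b\<close> turns the left side of the weak formulation into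
  a difference of two mollified values tending to \<open>u a - u b\<close>. On the right the bumps
  tend to the indicator of (a, b], dominated by the absolute value of \<open>w\<close> on
  [a, b+1].\<close>

lemma has_weak_partial_FTC:
  fixes u w :: "real \<Rightarrow> real"
  assumes u: "continuous_on {0<..} u" and w: "has_weak_partial {0<..} 1 u w" and ab: "0 < a" "a \<le> b"
  shows "u b - u a = (LINT x:{a<..b}|lborel. w x)"
proof -
  have wint: "integrable lborel (\<lambda>x. indicator {a..b+1} x *\<^sub>R w x)"
    using has_weak_partial_integrable[OF w ab(1)] by (simp add: set_integrable_def)
  have 1: "(LINT x:{0<..}|lborel. u x * frechet_derivative (bump n a b) (at x) 1) =
      - (LINT x:{0<..}|lborel. w x * bump n a b x)" for n
    using w bump_test[OF ab] by (auto simp: has_weak_partial_def)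
  have "(LINT x:{0<..}|lborel. u x * frechet_derivative (bump n a b) (at x) 1)
    = (LINT x:{0<..}|lborel. u x * (real (Suc n) * \<zeta>' (1 + real (Suc n) * (x - a))))
    - (LINT x:{0<..}|lborel. u x * (real (Suc n) * \<zeta>' (1 + real (Suc n) * (x - b))))" for n
    unfolding bump_deriv right_diff_distrib[of "u _"]
    by (intro set_integral_diff mollified_point_value(2)[OF u]) (use ab in auto)
  moreover have "(\<lambda>n. (LINT x:{0<..}|lborel. u x * (real (Suc n) * \<zeta>' (1 + real (Suc n) * (x - a))))
    - (LINT x:{0<..}|lborel. u x * (real (Suc n) * \<zeta>' (1 + real (Suc n) * (x - b))))) \<longlonglongrightarrow> u a - u b"
    using ab by (intro tendsto_diff mollified_point_value(1)[OF u]) auto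
  ultimately have L: "(\<lambda>n. - (LINT x:{0<..}|lborel. w x * bump n a b x)) \<longlonglongrightarrow> u a - u b"
    by (simp add: 1)
  have supp: "indicator {0<..} x *\<^sub>R (w x * bump n a b x) = (indicator {a..b+1} x *\<^sub>R w x) * bump n a b x" for n x
    using ab bump_zero[OF ab(2), of x n] by (auto simp: indicator_def)
  have "(\<lambda>n. LINT x|lborel. indicator {0<..} x *\<^sub>R (w x * bump n a b x)) \<longlonglongrightarrow> (LINT x|lborel. indicator {a<..b} x *\<^sub>R w x)"
  proof (rule integral_dominated_convergence[where w="\<lambda>x. norm (indicator {a..b+1} x *\<^sub>R w x)"])
    have lim: "(\<lambda>n. indicator {0<..} x *\<^sub>R (w x * bump n a b x)) \<longlonglongrightarrow> indicator {a<..b} x *\<^sub>R w x" for x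
    proof -
      have "(\<lambda>n. indicator {0<..} x *\<^sub>R (w x * bump n a b x)) \<longlonglongrightarrow> indicator {0<..} x *\<^sub>R (w x * indicator {a<..b} x)"
        by (intro tendsto_intros bump_tendsto ab)
      moreover have "indicator {0<..} x *\<^sub>R (w x * indicator {a<..b} x) = indicator {a<..b} x *\<^sub>R w x"
        using ab by (auto simp: indicator_def)
      ultimately show ?thesis by (simp only:)
    qed
    then show "AE x in lborel. (\<lambda>n. indicator {0<..} x *\<^sub>R (w x * bump n a b x)) \<longlonglongrightarrow> indicator {a<..b} x *\<^sub>R w x"
      by simp
    have [measurable]: "bump n a b \<in> borel_measurable borel" for n
      using test_functions_facts[OF bump_test[OF ab]] by (metis borel_measurable_continuous_onI)
    have [measurable]: "(\<lambda>x. indicator {a..b+1} x *\<^sub>R w x) \<in> borel_measurable borel"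
      using wint by auto
    show M: "(\<lambda>x. indicator {0<..} x *\<^sub>R (w x * bump n a b x)) \<in> borel_measurable lborel" for n
      unfolding supp by measurable
    show "(\<lambda>x. indicator {a<..b} x *\<^sub>R w x) \<in> borel_measurable lborel"
      by (rule borel_measurable_LIMSEQ_metric[OF M lim])
    show "integrable lborel (\<lambda>x. norm (indicator {a..b+1} x *\<^sub>R w x))"
      using wint by (rule integrable_norm)
    show "AE x in lborel. norm (indicator {0<..} x *\<^sub>R (w x * bump n a b x)) \<le> norm (indicator {a..b+1} x *\<^sub>R w x)" for n
      unfolding supp norm_mult by (intro AE_I2 mult_left_le) (auto simp: bump_bound)
  qed
  then have "(\<lambda>n. - (LINT x:{0<..}|lborel. w x * bump n a b x)) \<longlonglongrightarrow> - (LINT x:{a<..b}|lborel. w x)"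
    unfolding set_lebesgue_integral_def by (rule tendsto_minus)
  from LIMSEQ_unique[OF L this] show ?thesis by simp
qed

text \<open>Both candidates have the same integral, an increment of \<open>u\<close>, over every
  interval (max a c, b]. Hence their difference, cut off to (a, b], integrates to zero over all
  half-lines; countably many such intervals exhaust (0, \<infinity>).\<close>

lemma has_weak_partial_unique:
  fixes u w1 w2 :: "real \<Rightarrow> real"
  assumes u: "continuous_on {0<..} u" and w1: "has_weak_partial {0<..} 1 u w1" and w2: "has_weak_partial {0<..} 1 u w2"
  shows "AE x in lborel. 0 < x \<longrightarrow> w1 x = w2 x"
proof -
  have loc: "AE x in lborel. indicator {a<..b} x * (w1 x - w2 x) = 0" if ab: "0 < a" "a \<le> b" for a b
  proof (rule AE_zero_if_integral_Ioi_zero[where f="\<lambda>x. indicator {a<..b} x * (w1 x - w2 x)"])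
    have int: "set_integrable lborel {a'<..b'} w" if "0 < a'" "a' \<le> b'" "has_weak_partial {0<..} 1 u w" for w a' b'
      by (rule set_integrable_subset[of _ "{a'..b'}"])
        (use that has_weak_partial_integrable in auto)
    have "integrable lborel (\<lambda>x. indicator {a<..b} x *\<^sub>R w1 x - indicator {a<..b} x *\<^sub>R w2 x)"
      using int[OF ab w1] int[OF ab w2] unfolding set_integrable_def by (rule Bochner_Integration.integrable_diff)
    then show "integrable lborel (\<lambda>x. indicator {a<..b} x * (w1 x - w2 x))"
      by (simp add: right_diff_distrib)
    fix c
    show "(LINT x:{c<..}|lborel. indicator {a<..b} x * (w1 x - w2 x)) = 0"
    proof (cases "max a c \<le> b")
      case True
      have "(LINT x:{c<..}|lborel. indicator {a<..b} x * (w1 x - w2 x)) = (LINT x:{max a c<..b}|lborel. w1 x - w2 x)"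
        unfolding set_lebesgue_integral_def by (rule Bochner_Integration.integral_cong) (auto simp: indicator_def)
      also have "\<dots> = (LINT x:{max a c<..b}|lborel. w1 x) - (LINT x:{max a c<..b}|lborel. w2 x)"
        by (intro set_integral_diff int) (use ab True w1 w2 in auto)
      also have "\<dots> = 0"
        using has_weak_partial_FTC[OF u w1, of "max a c" b] has_weak_partial_FTC[OF u w2, of "max a c" b] ab True by simp
      finally show ?thesis .
    next
      case False
      then have "indicator {c<..} x *\<^sub>R (indicator {a<..b} x * (w1 x - w2 x)) = 0" for x
        using ab by (auto simp: indicator_def)
      then show ?thesis unfolding set_lebesgue_integral_def by (simp only: integral_zero)
    qed
  qed
  have "AE x in lborel. \<forall>n. indicator {inverse (real (Suc n))<..real (Suc n)} x * (w1 x - w2 x) = 0"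
    unfolding AE_all_countable
  proof
    fix n show "AE x in lborel. indicator {inverse (real (Suc n))<..real (Suc n)} x * (w1 x - w2 x) = 0"
      by (rule loc) (auto simp: field_simps)
  qed
  then show ?thesis
  proof eventually_elim
    case (elim x)
    show ?case
    proof
      assume x: "0 < x"
      obtain n1 where n1: "inverse (real (Suc n1)) < x" using reals_Archimedean[OF x] by blast
      obtain n2 where n2: "x < real n2" using reals_Archimedean2 by blast
      define n where "n = max n1 n2"
      have "inverse (real (Suc n)) \<le> inverse (real (Suc n1))" by (simp add: n_def)
      then have "inverse (real (Suc n)) < x" using n1 by (rule order_le_less_trans)
      moreover have "x \<le> real (Suc n)" using n2 by (simp add: n_def)
      ultimately have "x \<in> {inverse (real (Suc n))<..real (Suc n)}" by simp
      then show "w1 x = w2 x" using elim[rule_format, of n] by simp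
    qed
  qed
qed

end

section \<open>Radial Sobolev functions have weak derivatives\<close>

text \<open>Polar coordinates for radial functions, obtained from the area of discs alone: sets
  \<open>{..r}\<close> form an intersection-stable generator, and the disc of radius
  \<open>r\<close> has area pi r^2. For negative \<open>r\<close> the density is negative as a real
  and becomes 0 under \<open>ennreal\<close>.\<close>

lemma distr_norm_lborel:
  "distr (lborel :: (real^2) measure) borel norm = density lborel (\<lambda>r. ennreal (2 * pi * r))"
proof (rule measure_eqI_generator_eq[where E="range (\<lambda>r::real. {..r})" and \<Omega>=UNIV and A="\<lambda>n. {..real n}"])
  show "Int_stable (range (\<lambda>r::real. {..r}))"
    by (auto simp: Int_stable_def)
  have M: "emeasure (distr (lborel :: (real^2) measure) borel norm) {..r} = ennreal (pi * (max r 0)\<^sup>2)" for r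
  proof -
    have "emeasure (distr (lborel :: (real^2) measure) borel norm) {..r} = emeasure lborel (norm -` {..r} \<inter> space (lborel :: (real^2) measure))"
      by (rule emeasure_distr) auto
    also have "norm -` {..r} \<inter> space (lborel :: (real^2) measure) = cball 0 r"
      by (auto simp: cball_def)
    also have "emeasure lborel (cball (0::real^2) r) = ennreal (pi * (max r 0)\<^sup>2)"
    proof (cases "r < 0")
      case False
      then show ?thesis by (simp add: emeasure_cball unit_ball_vol_2)
    qed simp
    finally show ?thesis .
  qed
  fix X assume "X \<in> range (\<lambda>r::real. {..r})"
  then obtain r where X: "X = {..r}" by auto
  have "emeasure (density lborel (\<lambda>r. ennreal (2 * pi * r))) {..r}
      = (\<integral>\<^sup>+t. ennreal (2 * pi * t) * indicator {0..max r 0} t \<partial>lborel)"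
    by (subst emeasure_density) (auto intro!: nn_integral_cong simp: indicator_def ennreal_neg mult_nonneg_nonpos)
  also have "\<dots> = ennreal (pi * (max r 0)\<^sup>2 - pi * 0\<^sup>2)"
    by (rule nn_integral_FTC_Icc) (auto intro!: derivative_eq_intros)
  finally show "emeasure (distr (lborel :: (real^2) measure) borel norm) X = emeasure (density lborel (\<lambda>r. ennreal (2 * pi * r))) X"
    by (simp add: X M)
next
  fix n
  have "emeasure (distr (lborel :: (real^2) measure) borel norm) {..real n} = emeasure lborel (norm -` {..real n} \<inter> space (lborel :: (real^2) measure))"
    by (rule emeasure_distr) auto
  also have "norm -` {..real n} \<inter> space (lborel :: (real^2) measure) = cball 0 (real n)"
    by (auto simp: cball_def)
  finally show "emeasure (distr (lborel :: (real^2) measure) borel norm) {..real n} \<noteq> \<infinity>"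
    by (simp add: emeasure_cball)
next
  show "(\<Union>i::nat. {..real i}) = UNIV"
    using real_arch_simple by auto
qed (auto simp: borel_eq_atMost)

lemma radial_integral:
  fixes h :: "real \<Rightarrow> real"
  assumes [measurable]: "h \<in> borel_measurable borel"
  shows "(LINT x|(lborel :: (real^2) measure). h (norm x)) = (LINT r:{0<..}|lborel. 2 * pi * r * h r)"
proof -
  have "(LINT x|(lborel :: (real^2) measure). h (norm x)) = (LINT r|distr (lborel :: (real^2) measure) borel norm. h r)"
    by (rule integral_distr[symmetric]) auto
  also have "\<dots> = (LINT r|density lborel (\<lambda>r. ennreal (max 0 (2 * pi * r))). h r)"
  proof -
    \<comment> \<open>The Bochner integral against a density requires a nonnegative real weight, so
      the truncation hidden in \<open>ennreal\<close> is made explicit.\<close>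
    have "ennreal (2 * pi * r) = ennreal (max 0 (2 * pi * r))" for r
      by (metis ennreal_neg linear max.absorb1 max.absorb2 order_refl ennreal_0)
    then show ?thesis by (simp only: distr_norm_lborel)
  qed
  also have "\<dots> = (LINT r|lborel. max 0 (2 * pi * r) *\<^sub>R h r)"
    by (rule integral_density) auto
  also have "\<dots> = (LINT r:{0<..}|lborel. 2 * pi * r * h r)"
    unfolding set_lebesgue_integral_def
  proof (intro Bochner_Integration.integral_cong refl)
    show "max 0 (2 * pi * r) *\<^sub>R h r = indicator {0<..} r *\<^sub>R (2 * pi * r * h r)" for r
    proof (cases "0 < r")
      case False
      then have "2 * pi * r \<le> 0" by (intro mult_nonneg_nonpos) auto
      then show ?thesis using False by (simp add: max_def)
    qed simp
  qed
  finally show ?thesis .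
qed

text \<open>Preimages of null sets under the norm are null by the polar formula, so the image under
  the norm of the measure with density \<open>W\<close> has a Radon-Nikodym density. That density is
  finite almost everywhere since annuli have finite mass and \<open>{..0}\<close> has none. The
  first identity asks for no integrability, since both sides are 0 when it fails.\<close>

lemma radial_disintegration_nonneg:
  fixes W :: "real^2 \<Rightarrow> real"
  assumes [measurable]: "W \<in> borel_measurable borel" and W0: "\<And>x. 0 \<le> W x"
    and Wint: "\<And>n. integrable lborel (\<lambda>x. W x * indicator {inverse (real (Suc n))..real (Suc n)} (norm x))"
  obtains p where "p \<in> borel_measurable borel"
    "\<And>\<phi> :: real \<Rightarrow> real. \<phi> \<in> borel_measurable borel \<Longrightarrow>
      (LINT x|lborel. W x * \<phi> (norm x)) = (LINT r|lborel. p r * \<phi> r)"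
    "\<And>\<phi> :: real \<Rightarrow> real. \<phi> \<in> borel_measurable borel \<Longrightarrow>
      integrable lborel (\<lambda>x. W x * \<phi> (norm x)) \<Longrightarrow> integrable lborel (\<lambda>r. p r * \<phi> r)"
proof -
  define N where "N = distr (density lborel (\<lambda>x. ennreal (W x))) borel (norm :: real^2 \<Rightarrow> real)"
  have Nset: "emeasure N A = (\<integral>\<^sup>+x. ennreal (W x * indicator A (norm x)) \<partial>lborel)" if [measurable]: "A \<in> sets borel" for A
  proof -
    have "emeasure N A = emeasure (density lborel (\<lambda>x. ennreal (W x))) (norm -` A \<inter> UNIV)"
      unfolding N_def by (subst emeasure_distr) auto
    also have "\<dots> = (\<integral>\<^sup>+x. ennreal (W x) * indicator (norm -` A \<inter> UNIV) x \<partial>lborel)"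
      by (rule emeasure_density) (use measurable_sets[of norm borel borel A] in auto)
    also have "\<dots> = (\<integral>\<^sup>+x. ennreal (W x * indicator A (norm x)) \<partial>lborel)"
      by (intro nn_integral_cong) (auto simp: indicator_def)
    finally show ?thesis .
  qed
  have null: "AE x in (lborel :: (real^2) measure). norm x \<notin> A" if A: "A \<in> null_sets lborel" for A
  proof -
    have [measurable]: "A \<in> sets borel" using A by auto
    have "AE r in density lborel (\<lambda>r. ennreal (2 * pi * r)). r \<notin> A"
      using AE_not_in[OF A] by (subst AE_density) (auto elim: eventually_mono)
    then have "AE r in distr (lborel :: (real^2) measure) borel norm. r \<notin> A"
      by (simp only: distr_norm_lborel)
    then show ?thesis by (subst (asm) AE_distr_iff) auto
  qed
  have "absolutely_continuous lborel N"
    unfolding absolutely_continuous_def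
  proof
    fix A :: "real set" assume A: "A \<in> null_sets lborel"
    then have [measurable]: "A \<in> sets borel" by auto
    have "(\<integral>\<^sup>+x. ennreal (W x * indicator A (norm x)) \<partial>lborel) = (\<integral>\<^sup>+x. 0 \<partial>(lborel :: (real^2) measure))"
      by (rule nn_integral_cong_AE) (use null[OF A] in eventually_elim, auto)
    then have "emeasure N A = 0" by (simp add: Nset)
    then show "A \<in> null_sets N" by (auto simp: null_sets_def N_def)
  qed
  then obtain p0 where p0[measurable]: "p0 \<in> borel_measurable lborel" and dens: "density lborel p0 = N"
    using sigma_finite_measure.Radon_Nikodym[OF sigma_finite_lborel, of N] by (auto simp: N_def)
  have fin: "AE r in lborel. p0 r * indicator A r \<noteq> \<infinity>"
    if "emeasure N A \<noteq> \<infinity>" and [measurable]: "A \<in> sets borel" for A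
    using that by (intro nn_integral_PInf_AE) (auto simp: dens[symmetric] emeasure_density)
  have "emeasure N {..0} = 0"
  proof -
    have "AE x in lborel. x \<noteq> (0 :: real^2)" by (rule AE_lborel_singleton)
    then have "(\<integral>\<^sup>+x. ennreal (W x * indicator {..0} (norm x)) \<partial>lborel) = (\<integral>\<^sup>+x. 0 \<partial>(lborel :: (real^2) measure))"
      by (intro nn_integral_cong_AE) (elim eventually_mono, auto)
    then show ?thesis by (simp add: Nset)
  qed
  then have f1: "AE r in lborel. p0 r * indicator {..0} r \<noteq> \<infinity>" by (intro fin) auto
  have f2: "AE r in lborel. \<forall>n. p0 r * indicator {inverse (real (Suc n))..real (Suc n)} r \<noteq> \<infinity>"
    unfolding AE_all_countable
  proof
    fix n
    have "(\<integral>\<^sup>+x. ennreal (W x * indicator {inverse (real (Suc n))..real (Suc n)} (norm x)) \<partial>lborel) < \<infinity>"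
      using integrableD(2)[OF Wint[of n]] W0 by (simp add: less_top)
    then show "AE r in lborel. p0 r * indicator {inverse (real (Suc n))..real (Suc n)} r \<noteq> \<infinity>"
      by (intro fin) (auto simp: Nset)
  qed
  define p where "p r = enn2real (p0 r)" for r
  have [measurable]: "p \<in> borel_measurable borel" using p0 unfolding p_def by measurable
  have "AE r in lborel. p0 r = ennreal (p r)"
    using f1 f2
  proof eventually_elim
    case (elim r)
    have "p0 r \<noteq> \<infinity>"
    proof (cases "r \<le> 0")
      case False
      then have r: "0 < r" by simp
      obtain n1 where n1: "inverse (real (Suc n1)) < r" using reals_Archimedean[OF r] by blast
      obtain n2 where n2: "r < real n2" using reals_Archimedean2 by blast
      define n where "n = max n1 n2"
      have "inverse (real (Suc n)) \<le> inverse (real (Suc n1))" by (simp add: n_def)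
      then have "inverse (real (Suc n)) \<le> r" using n1 by linarith
      moreover have "r \<le> real (Suc n)" using n2 by (simp add: n_def)
      ultimately have "indicator {inverse (real (Suc n))..real (Suc n)} r = (1::ennreal)" by simp
      then show ?thesis using elim(2)[rule_format, of n] by simp
    qed (use elim in simp)
    then show ?case by (simp add: p_def less_top)
  qed
  then have dens': "N = density lborel (\<lambda>r. ennreal (p r))"
    unfolding dens[symmetric] by (intro density_cong) auto
  have 1: "(LINT x|lborel. W x * \<phi> (norm x)) = (LINT r|lborel. p r * \<phi> r)"
    if [measurable]: "\<phi> \<in> borel_measurable borel" for \<phi> :: "real \<Rightarrow> real"
  proof -
    have "(LINT x|lborel. W x * \<phi> (norm x)) = (LINT x|density lborel (\<lambda>x. ennreal (W x)). \<phi> (norm x))"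
      by (subst integral_density) (auto simp: W0)
    also have "\<dots> = (LINT r|N. \<phi> r)" unfolding N_def by (rule integral_distr[symmetric]) auto
    also have "\<dots> = (LINT r|lborel. p r * \<phi> r)"
      unfolding dens' by (subst integral_density) (auto simp: p_def)
    finally show ?thesis .
  qed
  have 2: "integrable lborel (\<lambda>r. p r * \<phi> r)"
    if [measurable]: "\<phi> \<in> borel_measurable borel" and i: "integrable lborel (\<lambda>x. W x * \<phi> (norm x))" for \<phi> :: "real \<Rightarrow> real"
  proof -
    have "integrable (density lborel (\<lambda>x. ennreal (W x))) (\<lambda>x. \<phi> (norm x))"
      using i by (subst integrable_density) (auto simp: W0)
    then have "integrable N \<phi>" unfolding N_def by (subst integrable_distr_eq) auto
    then show ?thesis unfolding dens' by (subst (asm) integrable_density) (auto simp: p_def)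
  qed
  show ?thesis by (rule that[of p]) (use 1 2 in auto)
qed

text \<open>The signed measure with density \<open>W\<close> has an absolutely continuous image under the norm, and its
  density \<open>p\<close> plays the role of the integral of \<open>W\<close> over the circle of radius \<open>r\<close>.\<close>

lemma radial_disintegration:
  fixes W :: "real^2 \<Rightarrow> real"
  assumes [measurable]: "W \<in> borel_measurable borel"
    and Wint: "\<And>n. integrable lborel (\<lambda>x. W x * indicator {inverse (real (Suc n))..real (Suc n)} (norm x))"
  obtains p where "p \<in> borel_measurable borel"
    "\<And>\<phi> :: real \<Rightarrow> real. \<phi> \<in> borel_measurable borel \<Longrightarrow> integrable lborel (\<lambda>x. W x * \<phi> (norm x)) \<Longrightarrow>
      integrable lborel (\<lambda>r. p r * \<phi> r) \<and> (LINT x|lborel. W x * \<phi> (norm x)) = (LINT r|lborel. p r * \<phi> r)"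
proof -
  define P where "P x = max (W x) 0" for x
  define Q where "Q x = max (- W x) 0" for x
  have [measurable]: "P \<in> borel_measurable borel" "Q \<in> borel_measurable borel"
    unfolding P_def Q_def by measurable
  have PQ: "integrable lborel (\<lambda>x. P x * \<phi> (norm x))" "integrable lborel (\<lambda>x. Q x * \<phi> (norm x))"
    if "integrable lborel (\<lambda>x. W x * \<phi> (norm x))" and [measurable]: "\<phi> \<in> borel_measurable borel" for \<phi> :: "real \<Rightarrow> real"
    by (rule Bochner_Integration.integrable_bound[OF that(1)]; auto simp: P_def Q_def abs_mult intro!: AE_I2 mult_right_mono)+
  obtain p where p: "p \<in> borel_measurable borel"
    "\<And>\<phi> :: real \<Rightarrow> real. \<phi> \<in> borel_measurable borel \<Longrightarrow>
      (LINT x|lborel. P x * \<phi> (norm x)) = (LINT r|lborel. p r * \<phi> r)"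
    "\<And>\<phi> :: real \<Rightarrow> real. \<phi> \<in> borel_measurable borel \<Longrightarrow>
      integrable lborel (\<lambda>x. P x * \<phi> (norm x)) \<Longrightarrow> integrable lborel (\<lambda>r. p r * \<phi> r)"
    using radial_disintegration_nonneg[of P] PQ(1)[OF Wint] by (auto simp: P_def)
  obtain q where q: "q \<in> borel_measurable borel"
    "\<And>\<phi> :: real \<Rightarrow> real. \<phi> \<in> borel_measurable borel \<Longrightarrow>
      (LINT x|lborel. Q x * \<phi> (norm x)) = (LINT r|lborel. q r * \<phi> r)"
    "\<And>\<phi> :: real \<Rightarrow> real. \<phi> \<in> borel_measurable borel \<Longrightarrow>
      integrable lborel (\<lambda>x. Q x * \<phi> (norm x)) \<Longrightarrow> integrable lborel (\<lambda>r. q r * \<phi> r)"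
    using radial_disintegration_nonneg[of Q] PQ(2)[OF Wint] by (auto simp: Q_def)
  show ?thesis
  proof (rule that[of "\<lambda>r. p r - q r"])
    show "(\<lambda>r. p r - q r) \<in> borel_measurable borel" using p(1) q(1) by measurable
    fix \<phi> :: "real \<Rightarrow> real" assume \<phi>: "\<phi> \<in> borel_measurable borel" and i: "integrable lborel (\<lambda>x. W x * \<phi> (norm x))"
    have ip: "integrable lborel (\<lambda>r. p r * \<phi> r)" "integrable lborel (\<lambda>r. q r * \<phi> r)"
      using p(3)[OF \<phi> PQ(1)[OF i \<phi>]] q(3)[OF \<phi> PQ(2)[OF i \<phi>]] by auto
    have W: "W x * \<phi> (norm x) = P x * \<phi> (norm x) - Q x * \<phi> (norm x)" for x
      by (auto simp: P_def Q_def max_def)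
    have "(LINT x|lborel. W x * \<phi> (norm x)) = (LINT x|lborel. P x * \<phi> (norm x)) - (LINT x|lborel. Q x * \<phi> (norm x))"
      unfolding W by (rule Bochner_Integration.integral_diff[OF PQ[OF i \<phi>]])
    then show "integrable lborel (\<lambda>r. (p r - q r) * \<phi> r) \<and> (LINT x|lborel. W x * \<phi> (norm x)) = (LINT r|lborel. (p r - q r) * \<phi> r)"
      using ip by (simp add: p(2)[OF \<phi>] q(2)[OF \<phi>] left_diff_distrib)
  qed
qed

section \<open>Radial vector fields as test functions, and the radial weak derivative\<close>

lemma Ck_on_inner_self: "Ck_on k UNIV (\<lambda>x :: 'a::euclidean_space. x \<bullet> x)"
proof (cases k)
  case 0
  then show ?thesis by (auto intro: continuous_intros)
next
  case (Suc n)
  have "((\<lambda>x. x \<bullet> x) has_derivative (\<lambda>h. 2 * (x \<bullet> h))) (at x)" for x :: 'a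
    by (auto intro!: derivative_eq_intros simp: inner_commute)
  then show ?thesis unfolding Suc Ck_on.simps
    by (intro exI[of _ "\<lambda>x h. 2 * (x \<bullet> h)"] conjI ballI Ck_on_mult Ck_on_const Ck_on_linear bounded_linear_inner_left) auto
qed

text \<open>\<Phi> is the \<open>b\<close> component of the field. The norm is not smooth at the
  origin, so smoothness is read off from F(x \<bullet> x) with F(s) = \<phi>(sqrt s) / s away from
  0; the support in an annulus then permits the extension by zero.\<close>

lemma radial_vector_field:
  fixes \<phi> :: "real \<Rightarrow> real"
  assumes \<phi>: "\<phi> \<in> test_functions {0<..}"
    and a: "0 < a" "\<And>r. r \<notin> {a..B} \<Longrightarrow> \<phi> r = 0" and b: "b \<in> Basis"
  defines "\<Phi> \<equiv> \<lambda>x :: 'a::euclidean_space. \<phi> (norm x) / (norm x)\<^sup>2 * (x \<bullet> b)"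
  shows "\<Phi> \<in> test_functions UNIV"
    and "x \<noteq> 0 \<Longrightarrow> frechet_derivative \<Phi> (at x) b =
      (frechet_derivative \<phi> (at (norm x)) 1 / norm x ^ 3 - 2 * \<phi> (norm x) / norm x ^ 4) * (x \<bullet> b)\<^sup>2
      + \<phi> (norm x) / (norm x)\<^sup>2"
    and "x \<notin> {x. a \<le> norm x \<and> norm x \<le> B} \<Longrightarrow> frechet_derivative \<Phi> (at x) b = 0"
proof -
  define K where "K = {x :: 'a. a \<le> norm x \<and> norm x \<le> B}"
  have clK: "closed K" unfolding K_def by (intro closed_Collect_conj closed_Collect_le continuous_intros)
  moreover have "bounded K" unfolding K_def bounded_iff by auto
  ultimately have cK: "compact K" by (simp add: compact_eq_bounded_closed)
  have zero: "\<Phi> x = 0" if "x \<notin> K" for x using that a(2)[of "norm x"] by (auto simp: \<Phi>_def K_def)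
  have sm: "smooth_on UNIV \<phi>" using \<phi> by (simp add: test_functions_def)
  have "Ck_on k UNIV \<Phi>" for k
  proof (rule Ck_on_zero_extend[OF _ _ clK _ zero])
    define F where "F s = \<phi> (s powr (1/2)) * s powr (-1)" for s
    have "Ck_on k {0<..} F" unfolding F_def
      by (intro Ck_on_mult Ck_on_compose[where B=UNIV and f=\<phi> and q="\<lambda>s. s powr (1/2)"] Ck_on_powr)
        (use sm in \<open>auto simp: smooth_on_def\<close>)
    then have "Ck_on k (UNIV - {0}) (\<lambda>x::'a. F (x \<bullet> x))"
      by (rule Ck_on_compose[where f=F and q="\<lambda>x. x \<bullet> x"])
        (auto intro: Ck_on_subset[OF Ck_on_inner_self])
    then have "Ck_on k (UNIV - {0}) (\<lambda>x::'a. F (x \<bullet> x) * (x \<bullet> b))"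
      by (rule Ck_on_mult[OF _ Ck_on_linear[OF bounded_linear_inner_left]])
    then show "Ck_on k (UNIV - {0}) \<Phi>"
    proof (rule Ck_on_cong)
      fix x :: 'a assume "x \<in> UNIV - {0}"
      then have x: "norm x > 0" by simp
      have "(x \<bullet> x) powr (1/2) = norm x"
        by (simp add: norm_eq_sqrt_inner powr_half_sqrt)
      moreover have "(x \<bullet> x) powr (-1) = 1 / (norm x)\<^sup>2"
        using x by (simp add: powr_minus dot_square_norm divide_inverse)
      ultimately show "F (x \<bullet> x) * (x \<bullet> b) = \<Phi> x" by (simp add: F_def \<Phi>_def)
    qed
    show "K \<subseteq> UNIV - {0}" using a(1) by (auto simp: K_def)
  qed auto
  then show test: "\<Phi> \<in> test_functions UNIV"
    using cK zero by (auto simp: test_functions_def smooth_on_def)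
  have d\<Phi>: "(\<Phi> has_derivative frechet_derivative \<Phi> (at x)) (at x)" for x
    using test by (intro smooth_on_has_derivative(1)) (simp add: test_functions_def)
  show "frechet_derivative \<Phi> (at x) b = 0" if "x \<notin> {x. a \<le> norm x \<and> norm x \<le> B}"
    using has_derivative_zero_outside[OF d\<Phi> clK zero, of x] that by (simp add: K_def)
  show "frechet_derivative \<Phi> (at x) b =
      (frechet_derivative \<phi> (at (norm x)) 1 / norm x ^ 3 - 2 * \<phi> (norm x) / norm x ^ 4) * (x \<bullet> b)\<^sup>2
      + \<phi> (norm x) / (norm x)\<^sup>2" if x: "x \<noteq> 0"
  proof -
    define r where "r = norm x"
    have r: "r > 0" using x by (simp add: r_def)
    define D where "D = frechet_derivative \<phi> (at r) 1"
    have "(\<phi> has_real_derivative D) (at r)"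
      unfolding D_def by (intro has_derivative_real_imp smooth_on_has_derivative sm)
    then have "((\<lambda>t. \<phi> t / t\<^sup>2) has_real_derivative (D / r\<^sup>2 - 2 * \<phi> r / r ^ 3)) (at r)"
      using r by (auto intro!: derivative_eq_intros simp: field_simps power2_eq_square power3_eq_cube)
    then have "((\<lambda>t. \<phi> t / t\<^sup>2) has_derivative (*) (D / r\<^sup>2 - 2 * \<phi> r / r ^ 3)) (at (norm x))"
      by (simp add: has_field_derivative_def r_def)
    from has_derivative_compose[OF has_derivative_norm[OF x] this]
    have "((\<lambda>x. \<phi> (norm x) / (norm x)\<^sup>2) has_derivative (\<lambda>h. (D / r\<^sup>2 - 2 * \<phi> r / r ^ 3) * (sgn x \<bullet> h))) (at x)"
      by (simp add: inner_commute)
    then have "(\<Phi> has_derivative (\<lambda>h. \<phi> (norm x) / (norm x)\<^sup>2 * (h \<bullet> b) + (D / r\<^sup>2 - 2 * \<phi> r / r ^ 3) * (sgn x \<bullet> h) * (x \<bullet> b))) (at x)"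
      unfolding \<Phi>_def
      by (rule has_derivative_mult[OF _ bounded_linear_imp_has_derivative[OF bounded_linear_inner_left]])
    then have "frechet_derivative \<Phi> (at x) = (\<lambda>h. \<phi> (norm x) / (norm x)\<^sup>2 * (h \<bullet> b) + (D / r\<^sup>2 - 2 * \<phi> r / r ^ 3) * (sgn x \<bullet> h) * (x \<bullet> b))"
      by (rule frechet_derivative_at[symmetric])
    then have "frechet_derivative \<Phi> (at x) b = \<phi> r / r\<^sup>2 + (D / r\<^sup>2 - 2 * \<phi> r / r ^ 3) * ((x \<bullet> b) / r) * (x \<bullet> b)"
      using b by (simp add: r_def sgn_div_norm divide_inverse mult.commute)
    also have "\<dots> = (D / r ^ 3 - 2 * \<phi> r / r ^ 4) * (x \<bullet> b)\<^sup>2 + \<phi> r / r\<^sup>2"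
      using r by (simp add: field_simps power2_eq_square power3_eq_cube power4_eq_xxxx)
    finally show ?thesis by (simp add: D_def r_def)
  qed
qed


lemma compact_subset_Ioi:
  assumes "compact K" "K \<subseteq> {0<..}"
  obtains a B :: real where "0 < a" "a \<le> B" "K \<subseteq> {a..B}"
proof (cases "K = {}")
  case True
  then show ?thesis using that[of 1 1] by auto
next
  case False
  obtain a where a: "a \<in> K" "\<forall>t\<in>K. a \<le> t" using compact_attains_inf[OF assms(1) False] by blast
  obtain B where B: "B \<in> K" "\<forall>t\<in>K. t \<le> B" using compact_attains_sup[OF assms(1) False] by blast
  show ?thesis by (rule that[of a B]) (use a B assms(2) in auto)
qed

lemma integrable_mult_bounded:
  fixes f h :: "'a \<Rightarrow> real"
  assumes "integrable M f" "h \<in> borel_measurable M" "\<And>x. \<bar>h x\<bar> \<le> C"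
  shows "integrable M (\<lambda>x. f x * h x)"
proof (rule Bochner_Integration.integrable_bound)
  show "integrable M (\<lambda>x. f x * C)" using assms(1) by simp
  show "(\<lambda>x. f x * h x) \<in> borel_measurable M"
    using assms(1,2) by (intro borel_measurable_times) auto
  show "AE x in M. norm (f x * h x) \<le> norm (f x * C)"
  proof (rule AE_I2)
    fix x
    have "\<bar>h x\<bar> \<le> \<bar>C\<bar>" using assms(3)[of x] by linarith
    then show "norm (f x * h x) \<le> norm (f x * C)" by (simp add: abs_mult mult_left_mono)
  qed
qed

text \<open>Summing the weak formulations of the two partial derivatives, tested with the components
  of the radial field, leaves a divergence on the left and the radial part of the weak gradient on
  the right. The left side is radial and reduces by polar coordinates. The right side is not, since
  the weak gradient is not known to be radial; pushing it forward under the norm averages it over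
  circles.\<close>

lemma H_space_has_weak_partial:
  assumes "v \<in> H_space"
  obtains w where "has_weak_partial {0<..} 1 v w"
proof -
  have contv: "continuous_on {0<..} v" using assms by (simp add: H_space_def)
  define V where "V x = v (norm x)" for x :: "real^2"
  have "\<forall>b\<in>Basis. \<exists>w. w \<in> L2_space UNIV \<and> has_weak_partial UNIV b V w"
    using assms by (auto simp: H_space_def H1_space_def V_def[abs_def])
  then obtain wb where wb: "\<And>b. b \<in> Basis \<Longrightarrow> wb b \<in> L2_space UNIV"
    "\<And>b. b \<in> Basis \<Longrightarrow> has_weak_partial UNIV b V (wb b)"
    by (metis (no_types))
  have wm[measurable]: "wb b \<in> borel_measurable borel" if "b \<in> Basis" for b
    using wb(1)[OF that] by (simp add: L2_space_def set_borel_measurable_def)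
  \<comment> \<open>The radial component of the weak gradient, divided once more by
    \<open>norm x\<close>; it is locally integrable away from the origin only, which suffices
    because \<phi> is supported in some [a, B] with \<open>a > 0\<close>.\<close>
  define W where "W x = (\<Sum>b\<in>Basis. wb b x * (x \<bullet> b) / (norm x)\<^sup>2)" for x
  have wmb: "(\<lambda>x. wb b x * (x \<bullet> b) / (norm x)\<^sup>2) \<in> borel_measurable borel" if "b \<in> Basis" for b
    using wm[OF that] by measurable
  have Wm[measurable]: "W \<in> borel_measurable borel"
    unfolding W_def by (intro borel_measurable_sum wmb)
  have wloc: "integrable lborel (\<lambda>x. wb b x * (x \<bullet> b) / (norm x)\<^sup>2 * \<phi> (norm x))"
    if b: "b \<in> Basis" and a: "0 < a" and [measurable]: "\<phi> \<in> borel_measurable borel"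
      and C: "\<And>r. \<bar>\<phi> r\<bar> \<le> C" and zero: "\<And>r. r \<notin> {a..B} \<Longrightarrow> \<phi> r = 0" for b a B C and \<phi> :: "real \<Rightarrow> real"
  proof -
    have "integrable lborel (\<lambda>x. indicator (cball 0 B) x * wb b x)"
      using wb(2)[OF b] by (auto simp: has_weak_partial_def locally_integrable_on_def set_integrable_def)
    then have "integrable lborel (\<lambda>x. indicator (cball 0 B) x * wb b x * ((x \<bullet> b) / (norm x)\<^sup>2 * \<phi> (norm x)))"
    proof (rule integrable_mult_bounded[where C="C / a"])
      show "\<bar>(x \<bullet> b) / (norm x)\<^sup>2 * \<phi> (norm x)\<bar> \<le> C / a" for x :: "real^2"
      proof (cases "norm x \<in> {a..B}")
        case True
        then have x: "a \<le> norm x" by simp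
        have "\<bar>x \<bullet> b\<bar> \<le> norm x" using Basis_le_norm[OF b] .
        then have "\<bar>(x \<bullet> b) / (norm x)\<^sup>2\<bar> \<le> norm x / (norm x)\<^sup>2"
          by (simp add: abs_divide divide_right_mono)
        also have "\<dots> = 1 / norm x" using x a by (simp add: power2_eq_square)
        also have "\<dots> \<le> 1 / a" using x a by (intro frac_le) auto
        finally have "\<bar>(x \<bullet> b) / (norm x)\<^sup>2\<bar> * \<bar>\<phi> (norm x)\<bar> \<le> 1 / a * C"
          using a by (intro mult_mono C) auto
        then show ?thesis by (simp add: abs_mult)
      next
        case False
        have "C \<ge> 0" using C[of 0] by linarith
        then show ?thesis using False zero a by simp
      qed
    qed measurable
    moreover have "indicator (cball 0 B) x * wb b x * ((x \<bullet> b) / (norm x)\<^sup>2 * \<phi> (norm x)) =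
      wb b x * (x \<bullet> b) / (norm x)\<^sup>2 * \<phi> (norm x)" for x
      using zero[of "norm x"] by (auto simp: indicator_def)
    ultimately show ?thesis by (simp only:)
  qed
  have Wloc: "integrable lborel (\<lambda>x. W x * \<phi> (norm x))"
    if "0 < a" "\<phi> \<in> borel_measurable borel" "\<And>r. \<bar>\<phi> r\<bar> \<le> C" "\<And>r. r \<notin> {a..B} \<Longrightarrow> \<phi> r = 0"
    for a B C and \<phi> :: "real \<Rightarrow> real"
    unfolding W_def sum_distrib_right using that by (intro Bochner_Integration.integrable_sum wloc[where a=a]) auto
  have Wann: "integrable lborel (\<lambda>x. W x * indicator {inverse (real (Suc n))..real (Suc n)} (norm x))" for n
    by (rule Wloc[where a="inverse (real (Suc n))" and B="real (Suc n)" and C=1]) (auto simp: indicator_def)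
  obtain p where pm[measurable]: "p \<in> borel_measurable borel"
    and p: "\<And>\<phi> :: real \<Rightarrow> real. \<phi> \<in> borel_measurable borel \<Longrightarrow> integrable lborel (\<lambda>x. W x * \<phi> (norm x)) \<Longrightarrow>
      integrable lborel (\<lambda>r. p r * \<phi> r) \<and> (LINT x|lborel. W x * \<phi> (norm x)) = (LINT r|lborel. p r * \<phi> r)"
    by (rule radial_disintegration[OF Wm Wann]) blast
  define w where "w r = p r / (2 * pi)" for r
  have "has_weak_partial {0<..} 1 v w"
    unfolding has_weak_partial_def
  proof (intro conjI ballI)
    show "locally_integrable_on {0<..} v" by (rule locally_integrable_on_continuous[OF contv])
    show "locally_integrable_on {0<..} w"
      unfolding locally_integrable_on_def
    proof (intro allI impI)
      fix K :: "real set" assume K: "compact K \<and> K \<subseteq> {0<..}"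
      then obtain a B where aB: "0 < a" "a \<le> B" "K \<subseteq> {a..B}" using compact_subset_Ioi by metis
      have [measurable]: "K \<in> sets borel" using K by (auto intro: borel_closed compact_imp_closed)
      have "integrable lborel (\<lambda>x. W x * indicator K (norm x))"
        by (rule Wloc[OF aB(1), where B=B and C=1]) (use aB in \<open>auto simp: indicator_def\<close>)
      then have "integrable lborel (\<lambda>r. p r * indicator K r)" using p[of "indicator K"] by auto
      then show "set_integrable lborel K w" by (simp add: set_integrable_def w_def mult.commute)
    qed
    fix \<phi> :: "real \<Rightarrow> real" assume \<phi>: "\<phi> \<in> test_functions {0<..}"
    then obtain K where K: "compact K" "K \<subseteq> {0<..}" "\<And>x. x \<notin> K \<Longrightarrow> \<phi> x = 0"
      and d\<phi>: "\<And>x. (\<phi> has_derivative frechet_derivative \<phi> (at x)) (at x)"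
      and cd\<phi>: "\<And>b. b \<in> Basis \<Longrightarrow> continuous_on UNIV (\<lambda>x. frechet_derivative \<phi> (at x) b)"
      and c\<phi>: "continuous_on UNIV \<phi>"
      and z\<phi>: "\<And>x b. x \<notin> K \<Longrightarrow> frechet_derivative \<phi> (at x) b = 0"
      by (rule test_functions_facts) blast
    obtain a B where aB: "0 < a" "a \<le> B" "K \<subseteq> {a..B}" using compact_subset_Ioi[OF K(1,2)] .
    have \<phi>0: "\<phi> r = 0" if "r \<notin> {a..B}" for r using K(3) aB(3) that by blast
    have \<phi>'0: "frechet_derivative \<phi> (at r) 1 = 0" if "r \<notin> {a..B}" for r using z\<phi> aB(3) that by blast
    define \<phi>' where "\<phi>' r = frechet_derivative \<phi> (at r) 1" for r
    have c\<phi>': "continuous_on UNIV \<phi>'" using cd\<phi>[of 1] by (simp add: \<phi>'_def[abs_def])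
    have [measurable]: "\<phi> \<in> borel_measurable borel" "\<phi>' \<in> borel_measurable borel"
      using c\<phi> c\<phi>' by (auto intro: borel_measurable_continuous_onI)
    obtain C where C: "\<And>r. \<bar>\<phi> r\<bar> \<le> C"
      using bounded_continuous_compact_support[OF c\<phi> K(1,3)] by metis
    define \<Phi> where "\<Phi> b x = \<phi> (norm x) / (norm x)\<^sup>2 * (x \<bullet> b)" for b x :: "real^2"
    define A where "A = {x :: real^2. a \<le> norm x \<and> norm x \<le> B}"
    have clA: "closed A" unfolding A_def by (intro closed_Collect_conj closed_Collect_le continuous_intros)
    moreover have "bounded A" unfolding A_def bounded_iff by auto
    ultimately have cA: "compact A" by (simp add: compact_eq_bounded_closed)
    have A0: "norm x > 0" if "x \<in> A" for x using that aB(1) by (auto simp: A_def)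
    have vf1: "\<Phi> b \<in> test_functions UNIV" if "b \<in> Basis" for b
      unfolding \<Phi>_def[abs_def] by (rule radial_vector_field(1)[OF \<phi> aB(1) _ that]) (rule \<phi>0)
    have vf2: "frechet_derivative (\<Phi> b) (at x) b =
        (\<phi>' (norm x) / norm x ^ 3 - 2 * \<phi> (norm x) / norm x ^ 4) * (x \<bullet> b)\<^sup>2 + \<phi> (norm x) / (norm x)\<^sup>2"
      if "b \<in> Basis" "x \<noteq> 0" for b x
      unfolding \<Phi>_def[abs_def] \<phi>'_def by (rule radial_vector_field(2)[OF \<phi> aB(1) _ that]) (rule \<phi>0)
    have vf3: "frechet_derivative (\<Phi> b) (at x) b = 0" if "b \<in> Basis" "x \<notin> A" for b x
      using that(2) unfolding \<Phi>_def[abs_def] A_def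
      by (intro radial_vector_field(3)[OF \<phi> aB(1) _ that(1)]) (use \<phi>0 in auto)
    have int1: "integrable lborel (\<lambda>x. V x * frechet_derivative (\<Phi> b) (at x) b)" if b: "b \<in> Basis" for b
    proof -
      have "continuous_on UNIV (\<lambda>x. frechet_derivative (\<Phi> b) (at x) b)"
        using vf1[OF b] b by (intro smooth_on_has_derivative(2)) (auto simp: test_functions_def)
      moreover have "continuous_on A V"
        unfolding V_def[abs_def] by (rule continuous_on_compose2[OF contv]) (auto intro: continuous_intros dest: A0)
      ultimately have "integrable lborel (\<lambda>x. indicator A x *\<^sub>R (V x * frechet_derivative (\<Phi> b) (at x) b))"
        by (intro borel_integrable_compact cA continuous_intros) (auto intro: continuous_on_subset)
      moreover have "indicator A x *\<^sub>R (V x * frechet_derivative (\<Phi> b) (at x) b) = V x * frechet_derivative (\<Phi> b) (at x) b" for x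
        using vf3[OF b, of x] by (auto simp: indicator_def)
      ultimately show ?thesis by (simp only:)
    qed
    have int2: "integrable lborel (\<lambda>x. wb b x * \<Phi> b x)" if b: "b \<in> Basis" for b
    proof -
      have "integrable lborel (\<lambda>x. wb b x * (x \<bullet> b) / (norm x)\<^sup>2 * \<phi> (norm x))"
        by (rule wloc[OF b aB(1) _ C \<phi>0]) simp_all
      then show ?thesis by (simp add: \<Phi>_def ac_simps)
    qed
    \<comment> \<open>Dividing the field by the square of the norm is tailored to dimension two: the
      two basis vectors contribute \<open>2 * \<phi> (norm x) / (norm x)\<^sup>2\<close>, which
      cancels the term from differentiating the quotient and leaves only \<phi>'.\<close>
    have div: "(\<Sum>b\<in>Basis. V x * frechet_derivative (\<Phi> b) (at x) b) = v (norm x) * \<phi>' (norm x) / norm x" for x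
    proof (cases "x \<in> A")
      case True
      have r: "norm x > 0" using A0[OF True] .
      then have x: "x \<noteq> 0" by auto
      have "(\<Sum>b\<in>Basis. frechet_derivative (\<Phi> b) (at x) b)
        = (\<Sum>b\<in>Basis. (\<phi>' (norm x) / norm x ^ 3 - 2 * \<phi> (norm x) / norm x ^ 4) * (x \<bullet> b)\<^sup>2 + \<phi> (norm x) / (norm x)\<^sup>2)"
        using vf2[OF _ x] by (intro sum.cong) auto
      also have "\<dots> = (\<phi>' (norm x) / norm x ^ 3 - 2 * \<phi> (norm x) / norm x ^ 4) * (norm x)\<^sup>2 + 2 * (\<phi> (norm x) / (norm x)\<^sup>2)"
        unfolding sum.distrib sum_distrib_left[symmetric]
        by (simp add: norm_eq_sqrt_inner euclidean_inner[of x x] power2_eq_square sum_nonneg)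
      also have "\<dots> = \<phi>' (norm x) / norm x"
        using r by (simp add: field_simps power2_eq_square power3_eq_cube power4_eq_xxxx)
      finally show ?thesis by (simp add: sum_distrib_left[symmetric] V_def)
    next
      case False
      then have "frechet_derivative (\<Phi> b) (at x) b = 0" if "b \<in> Basis" for b
        using vf3[OF that] by simp
      moreover have "\<phi>' (norm x) = 0" using False \<phi>'0[of "norm x"] by (auto simp: \<phi>'_def A_def)
      ultimately show ?thesis by simp
    qed
    have "(\<Sum>b\<in>Basis. LINT x|lborel. V x * frechet_derivative (\<Phi> b) (at x) b)
        = (\<Sum>b\<in>Basis. - (LINT x|lborel. wb b x * \<Phi> b x))"
    proof (rule sum.cong)
      fix b :: "real^2" assume b: "b \<in> Basis"
      show "(LINT x|lborel. V x * frechet_derivative (\<Phi> b) (at x) b) = - (LINT x|lborel. wb b x * \<Phi> b x)"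
        using wb(2)[OF b] vf1[OF b] by (simp add: has_weak_partial_def set_lebesgue_integral_def)
    qed simp
    then have "(LINT x|lborel. (\<Sum>b\<in>Basis. V x * frechet_derivative (\<Phi> b) (at x) b)) =
      - (LINT x|lborel. (\<Sum>b\<in>Basis. wb b x * \<Phi> b x))"
      using int1 int2 by (simp add: Bochner_Integration.integral_sum sum_negf)
    moreover have "(\<Sum>b\<in>Basis. wb b x * \<Phi> b x) = W x * \<phi> (norm x)" for x
      by (auto simp: W_def \<Phi>_def sum_distrib_right intro!: sum.cong)
    ultimately have eq: "(LINT x|(lborel :: (real^2) measure). v (norm x) * \<phi>' (norm x) / norm x) = - (LINT x|lborel. W x * \<phi> (norm x))"
      by (simp add: div)
    \<comment> \<open>The factor 1/r will cancel the Jacobian. The indicator makes \<open>h\<close>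
      Borel, as \<open>v\<close> is arbitrary at nonpositive arguments; at the origin both
      expressions are 0 because division by zero gives 0.\<close>
    define h where "h r = (indicator {0<..} r * v r) * \<phi>' r / r" for r
    have "(\<lambda>r. indicator {0<..} r * v r) \<in> borel_measurable borel"
      using borel_measurable_continuous_on_indicator[OF _ contv] by simp
    then have [measurable]: "h \<in> borel_measurable borel" unfolding h_def by measurable
    have "v (norm x) * \<phi>' (norm x) / norm x = h (norm x)" for x :: "real^2"
      by (auto simp: h_def indicator_def)
    then have "(LINT x|(lborel :: (real^2) measure). v (norm x) * \<phi>' (norm x) / norm x) = (LINT r:{0<..}|lborel. 2 * pi * r * h r)"
      by (simp add: radial_integral)
    also have "\<dots> = 2 * pi * (LINT r:{0<..}|lborel. v r * \<phi>' r)"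
      unfolding set_lebesgue_integral_def integral_mult_right_zero[symmetric]
      by (intro Bochner_Integration.integral_cong) (auto simp: h_def indicator_def)
    finally have L: "(LINT x|(lborel :: (real^2) measure). v (norm x) * \<phi>' (norm x) / norm x) = 2 * pi * (LINT r:{0<..}|lborel. v r * \<phi>' r)" .
    have "(LINT x|lborel. W x * \<phi> (norm x)) = (LINT r|lborel. p r * \<phi> r)"
    proof -
      have "integrable lborel (\<lambda>x. W x * \<phi> (norm x))"
        by (rule Wloc[OF aB(1) _ C \<phi>0]) simp_all
      then show ?thesis using p[of \<phi>] by simp
    qed
    also have "\<dots> = 2 * pi * (LINT r:{0<..}|lborel. w r * \<phi> r)"
      unfolding set_lebesgue_integral_def integral_mult_right_zero[symmetric]
      using aB(1) \<phi>0 by (intro Bochner_Integration.integral_cong) (auto simp: w_def indicator_def)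
    finally have "2 * pi * (LINT r:{0<..}|lborel. v r * \<phi>' r) = 2 * pi * - (LINT r:{0<..}|lborel. w r * \<phi> r)"
      using eq L by simp
    then show "(LINT r:{0<..}|lborel. v r * frechet_derivative \<phi> (at r) 1) = - (LINT r:{0<..}|lborel. w r * \<phi> r)"
      unfolding mult_cancel_left by (simp add: \<phi>'_def)
  qed
  then show ?thesis by (rule that)
qed

section \<open>The competitor\<close>

text \<open>Constancy near 0 makes the composition with the norm differentiable at the origin, and
  vanishing beyond \<open>B\<close> gives square integrability. The constant \<open>c\<close> need
  not be 0: the third component of the competitor equals 1 near the origin.\<close>

lemma H_space_radial:
  assumes der: "\<And>r. 0 < r \<Longrightarrow> (u has_real_derivative u' r) (at r)"
    and cont: "continuous_on {0<..} u'"
    and e: "0 < e" "\<And>r. 0 \<le> r \<Longrightarrow> r \<le> e \<Longrightarrow> u r = c" and B: "\<And>r. B \<le> r \<Longrightarrow> u r = 0"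
  shows "u \<in> H_space"
proof -
  define U where "U x = u (norm x)" for x :: "real^2"
  \<comment> \<open>\<open>sgn x\<close> is the gradient of the norm for
    \<open>x \<noteq> 0\<close>; since \<open>sgn 0 = 0\<close>, the same formula gives the correct
    zero derivative at the origin.\<close>
  define D where "D x h = u' (norm x) * (h \<bullet> sgn x)" for x h :: "real^2"
  have u'0: "u' r = 0" if "0 < r" "r < e" for r
  proof (rule DERIV_unique[OF der[OF that(1)]])
    show "(u has_real_derivative 0) (at r)"
      by (rule has_field_derivative_transform_within_open[where f="\<lambda>_. c" and S="{0<..<e}"])
        (use that e in auto)
  qed
  have dU: "(U has_derivative D x) (at x)" for x
  proof (cases "x = 0")
    case True
    have "((\<lambda>x. c) has_derivative (\<lambda>_. 0)) (at x)" by simp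
    then have "(U has_derivative (\<lambda>_. 0)) (at x)"
      by (rule has_derivative_transform_within_open[where s="ball 0 e"]) (use True e in \<open>auto simp: U_def\<close>)
    then show ?thesis using True by (simp add: D_def[abs_def])
  next
    case False
    then have "(u has_derivative (*) (u' (norm x))) (at (norm x))"
      using der by (simp add: has_field_derivative_def)
    from has_derivative_compose[OF has_derivative_norm[OF False] this]
    show ?thesis by (simp add: U_def[abs_def] D_def[abs_def])
  qed
  have cD: "continuous_on UNIV (\<lambda>x. D x b)" for b
  proof -
    have "continuous_on (ball 0 e) (\<lambda>x. D x b)"
      by (subst continuous_on_cong[OF refl, where g="\<lambda>_. 0"]) (use u'0 in \<open>auto simp: D_def, metis norm_eq_zero norm_ge_zero order_le_less sgn_zero inner_zero_right\<close>)
    moreover have "continuous_on (UNIV - {0}) (\<lambda>x. D x b)"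
      unfolding D_def by (intro continuous_intros continuous_on_compose2[OF cont]) auto
    ultimately have "continuous_on (ball 0 e \<union> (UNIV - {0})) (\<lambda>x. D x b)"
      by (intro continuous_on_open_Un) auto
    moreover have "ball (0 :: real^2) e \<union> (UNIV - {0}) = UNIV" using e by auto
    ultimately show ?thesis by simp
  qed
  have cU: "continuous_on UNIV U"
    using dU by (meson continuous_at_imp_continuous_on has_derivative_continuous)
  have zU: "U x = 0" if "x \<notin> cball 0 B" for x using that B by (simp add: U_def)
  have zD: "D x b = 0" if "x \<notin> cball 0 B" for x b
    using has_derivative_zero_outside[OF dU closed_cball zU that] by simp
  have L2: "h \<in> L2_space UNIV" if "continuous_on UNIV h" "\<And>x. x \<notin> cball 0 B \<Longrightarrow> h x = 0" for h :: "real^2 \<Rightarrow> real"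
  proof -
    have "integrable lborel (\<lambda>x. (h x)\<^sup>2)"
      by (rule integrable_continuous_compact_support[where K="cball 0 B"])
        (use that in \<open>auto intro!: continuous_intros\<close>)
    moreover have "h \<in> borel_measurable borel" using that(1) by (rule borel_measurable_continuous_onI)
    ultimately show ?thesis by (simp add: L2_space_def set_integrable_def set_borel_measurable_def)
  qed
  have "U \<in> H1_space UNIV"
    unfolding H1_space_def
  proof (intro CollectI conjI ballI)
    show "U \<in> L2_space UNIV" using cU zU by (rule L2)
    fix b :: "real^2" assume b: "b \<in> Basis"
    show "\<exists>w\<in>L2_space UNIV. has_weak_partial UNIV b U w"
    proof (rule bexI[where x="\<lambda>x. D x b"])
      show "has_weak_partial UNIV b U (\<lambda>x. D x b)"
        using open_UNIV dU cD b by (rule has_weak_partial_classical)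
      show "(\<lambda>x. D x b) \<in> L2_space UNIV" using cD zD by (rule L2)
    qed
  qed
  moreover have "continuous_on {0<..} u"
    using der by (auto intro!: continuous_at_imp_continuous_on DERIV_isCont)
  ultimately show ?thesis by (simp add: H_space_def U_def[abs_def])
qed

lemma X_space_radial:
  assumes der: "\<And>r. 0 < r \<Longrightarrow> (u has_real_derivative u' r) (at r)"
    and cont: "continuous_on {0<..} u'"
    and e: "0 < e" "\<And>r. 0 \<le> r \<Longrightarrow> r \<le> e \<Longrightarrow> u r = 0" and B: "\<And>r. B \<le> r \<Longrightarrow> u r = 0"
  shows "u \<in> X_space"
proof -
  have cu: "continuous_on {0<..} u"
    using der by (auto intro!: continuous_at_imp_continuous_on DERIV_isCont)
  have "bounded (u ` {e..B})"
    using e(1) by (intro compact_imp_bounded compact_continuous_image continuous_on_subset[OF cu]) auto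
  then obtain C where C: "\<forall>x\<in>{e..B}. \<bar>u x\<bar> \<le> C" by (auto simp: bounded_iff)
  have "(\<integral>\<^sup>+r\<in>{0<..}. ennreal ((u r)\<^sup>2 / r\<^sup>2 * r) \<partial>lborel) \<le> (\<integral>\<^sup>+r. ennreal (C\<^sup>2 / e) * indicator {e..B} r \<partial>lborel)"
  proof (rule nn_integral_mono)
    fix r
    show "ennreal ((u r)\<^sup>2 / r\<^sup>2 * r) * indicator {0<..} r \<le> ennreal (C\<^sup>2 / e) * indicator {e..B} r"
    proof (cases "r \<in> {e..B}")
      case True
      then have r: "0 < r" "e \<le> r" using e(1) by auto
      have "\<bar>u r\<bar> \<le> \<bar>C\<bar>" using C True by force
      then have "(u r)\<^sup>2 \<le> C\<^sup>2" by (simp only: abs_le_square_iff)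
      then have "(u r)\<^sup>2 / r \<le> C\<^sup>2 / e" using r e(1) by (intro frac_le) auto
      moreover have "(u r)\<^sup>2 / r\<^sup>2 * r = (u r)\<^sup>2 / r" using r by (simp add: power2_eq_square)
      ultimately show ?thesis using True r by (simp add: ennreal_leI)
    next
      case False
      then have "0 < r \<Longrightarrow> u r = 0" using e(2)[of r] B[of r] by (cases "r \<le> e") auto
      then show ?thesis by (auto simp: indicator_def)
    qed
  qed
  also have "\<dots> < \<infinity>"
    by (auto simp: nn_integral_cmult ennreal_mult_less_top emeasure_lborel_Icc_eq)
  finally show ?thesis using H_space_radial[OF assms] by (simp add: X_space_def)
qed

lemma has_weak_partial_weak_deriv:
  "has_weak_partial {0<..} 1 u w \<Longrightarrow> has_weak_partial {0<..} 1 u (weak_deriv u)"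
  unfolding weak_deriv_def by (rule someI[of "has_weak_partial {0<..} 1 u" w])

section \<open>The logarithmic profile and its energy\<close>

context smooth_cutoff
begin

text \<open>The classical derivative is one weak derivative, so the choice behind
  \<open>weak_deriv\<close> has a witness; uniqueness up to null sets then identifies the chosen
  function, which is enough under an integral.\<close>

lemma weak_deriv_classical:
  assumes der: "\<And>r. 0 < r \<Longrightarrow> (u has_real_derivative u' r) (at r)"
    and cont: "continuous_on {0<..} u'"
  shows "AE r in lborel. 0 < r \<longrightarrow> weak_deriv u r = u' r"
proof -
  have "has_weak_partial {0<..} 1 u (\<lambda>x. (*) (u' x) 1)"
    by (rule has_weak_partial_classical) (use der cont in \<open>auto simp: has_field_derivative_def\<close>)
  then have w: "has_weak_partial {0<..} 1 u u'" by simp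
  have "continuous_on {0<..} u"
    using der by (auto intro!: continuous_at_imp_continuous_on DERIV_isCont)
  then show ?thesis using has_weak_partial_weak_deriv[OF w] w by (rule has_weak_partial_unique)
qed

lemma eta_deriv: "0 < r \<Longrightarrow> (\<eta> has_real_derivative \<zeta>' r) (at r)"
  by (rule has_field_derivative_transform_within_open[OF zeta_deriv, where S="{0<..}"]) (auto simp: \<zeta>_def)

text \<open>The angle \<theta> of the competitor, as a function of ln(r/A)/L. The shift by 1 is
  there because \<zeta> rises on [1, 2], so the transition fills exactly the range from
  \<open>A\<close> to \<open>A * exp L\<close>.\<close>

definition ang :: "real \<Rightarrow> real \<Rightarrow> real \<Rightarrow> real" where
  "ang A L r = pi / 2 * \<zeta> (1 + ln (r / A) / L)"

definition ang' :: "real \<Rightarrow> real \<Rightarrow> real \<Rightarrow> real" where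
  "ang' A L r = pi / 2 * \<zeta>' (1 + ln (r / A) / L) / (L * r)"

context
  fixes A L :: real
  assumes A: "4 \<le> A" and L: "0 < L"
begin

lemma ang_deriv: "0 < r \<Longrightarrow> (ang A L has_real_derivative ang' A L r) (at r)"
proof -
  assume r: "0 < r"
  have 1: "((\<lambda>r. 1 + ln (r / A) / L) has_real_derivative 1 / (L * r)) (at r)"
    using r A L by (auto intro!: derivative_eq_intros simp: field_simps)
  have "((\<lambda>r. \<zeta> (1 + ln (r / A) / L)) has_real_derivative \<zeta>' (1 + ln (r / A) / L) * (1 / (L * r))) (at r)"
    by (rule DERIV_chain2[OF zeta_deriv 1])
  from DERIV_cmult[OF this, of "pi / 2"] show ?thesis
    by (simp add: ang_def[abs_def] ang'_def)
qed

lemma ang'_cont: "continuous_on {0<..} (ang' A L)"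
  unfolding ang'_def using A L
  by (intro continuous_intros continuous_on_compose2[OF zeta'_cont]) auto

lemma ang_0: "0 \<le> r \<Longrightarrow> r \<le> A \<Longrightarrow> ang A L r = 0"
proof -
  assume r: "0 \<le> r" "r \<le> A"
  have "ln (r / A) \<le> 0"
  \<comment> \<open>At \<open>r = 0\<close> the convention \<open>ln 0 = 0\<close> gives \<zeta> 1 =
    0, which is the right value.\<close>
  proof (cases "r = 0")
    case False
    then show ?thesis using r A by (intro ln_le_zero_iff[THEN iffD2]) auto
  qed simp
  then have "1 + ln (r / A) / L \<le> 1" using L by (simp add: divide_nonpos_pos)
  then show ?thesis by (simp add: ang_def zeta_0)
qed

lemma ang_1: "A * exp L \<le> r \<Longrightarrow> ang A L r = pi / 2"
proof -
  assume r: "A * exp L \<le> r"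
  have "0 < A * exp L" using A by simp
  then have "0 < r" using r by linarith
  have "exp L \<le> r / A" using r A by (simp add: field_simps)
  then have "L \<le> ln (r / A)" using \<open>0 < r\<close> A by (simp add: ln_ge_iff)
  then have "2 \<le> 1 + ln (r / A) / L" using L by (simp add: field_simps)
  then show ?thesis by (simp add: ang_def zeta_1)
qed

lemma ang'_0: "0 < r \<Longrightarrow> r \<notin> {A..A * exp L} \<Longrightarrow> ang' A L r = 0"
proof -
  assume r: "0 < r" "r \<notin> {A..A * exp L}"
  have "1 + ln (r / A) / L \<notin> {1..2}"
  proof (cases "r < A")
    case True
    then have "ln (r / A) < 0" using r A by (intro ln_less_zero) auto
    then have "ln (r / A) / L < 0" using L by (rule divide_neg_pos)
    then show ?thesis by simp
  next
    case False
    then have "exp L < r / A" using r A by (auto simp: field_simps)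
    then have "ln (exp L) < ln (r / A)" using r A by (subst ln_less_cancel_iff) auto
    then have "1 < ln (r / A) / L" using L by (simp add: field_simps)
    then show ?thesis by simp
  qed
  then show ?thesis by (simp add: ang'_def zeta'_zero)
qed

lemma exp_A: "2 \<le> A * exp L" "A \<le> A * exp L"
proof -
  have "A * 1 \<le> A * exp L" using A L by (intro mult_left_mono) auto
  then show "2 \<le> A * exp L" "A \<le> A * exp L" using A by linarith+
qed

text \<open>The first two components coincide with \<eta> and d \<eta> both near the origin, where
  all vanish, and far out, where the limits are reached exactly. Hence \<open>u\<close> and
  \<open>v\<close> live on a compact part of (0, \<infinity>). With \<open>A \<ge> 4\<close> the
  profile \<zeta>(2 r / A) starts at A/2 \<ge> 2, beyond the transition of \<eta>.\<close>

lemma competitor_in_Y_space: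
  "(\<lambda>r. sin (ang A L r), \<lambda>r. of_int d * \<zeta> (2 * r / A), \<lambda>r. cos (ang A L r)) \<in> Y_space d \<eta>"
proof -
  define u where "u r = sin (ang A L r) - \<eta> r" for r
  define v where "v r = (of_int d * \<zeta> (2 * r / A) - of_int d * \<eta> r) / r" for r
  have "(\<lambda>r. cos (ang A L r)) \<in> H_space"
  proof (rule H_space_radial)
    show "((\<lambda>r. cos (ang A L r)) has_real_derivative - sin (ang A L r) * ang' A L r) (at r)" if "0 < r" for r
      using ang_deriv[OF that] by (auto intro!: derivative_eq_intros)
    show "continuous_on {0<..} (\<lambda>r. - sin (ang A L r) * ang' A L r)"
      using ang_deriv by (intro continuous_intros ang'_cont)
        (auto intro!: continuous_at_imp_continuous_on DERIV_isCont)
    show "0 < A" using A by simp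
    show "cos (ang A L r) = 1" if "0 \<le> r" "r \<le> A" for r using ang_0 that by simp
    show "cos (ang A L r) = 0" if "A * exp L \<le> r" for r by (simp only: ang_1[OF that] cos_pi_half)
  qed
  moreover have "u \<in> X_space"
  proof (rule X_space_radial)
    show "(u has_real_derivative cos (ang A L r) * ang' A L r - \<zeta>' r) (at r)" if "0 < r" for r
      unfolding u_def[abs_def] using ang_deriv[OF that] eta_deriv[OF that] by (auto intro!: derivative_eq_intros)
    show "continuous_on {0<..} (\<lambda>r. cos (ang A L r) * ang' A L r - \<zeta>' r)"
      using ang_deriv by (intro continuous_intros ang'_cont continuous_on_subset[OF zeta'_cont])
        (auto intro!: continuous_at_imp_continuous_on DERIV_isCont)
    show "(0::real) < 1" by simp
    show "u r = 0" if "0 \<le> r" "r \<le> 1" for r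
      using ang_0[of r] that A by (simp add: u_def eta_eq zeta_0)
    show "u r = 0" if "A * exp L \<le> r" for r
    proof -
      have "sin (ang A L r) = 1" by (simp only: ang_1[OF that] sin_pi_half)
      then show ?thesis using exp_A that by (simp add: u_def eta_eq zeta_1)
    qed
  qed
  moreover have "v \<in> X_space"
  proof (rule X_space_radial)
    define w where "w r = ((of_int d * (\<zeta>' (2 * r / A) * (2 / A)) - of_int d * \<zeta>' r) * r
      - (of_int d * \<zeta> (2 * r / A) - of_int d * \<zeta> r)) / (r * r)" for r
    have cz: "continuous_on UNIV \<zeta>" using zeta_deriv by (auto intro!: continuous_at_imp_continuous_on DERIV_isCont)
    show "(v has_real_derivative w r) (at r)" if "0 < r" for r
    proof -
      have "((\<lambda>r. 2 * r / A) has_real_derivative 2 / A) (at r)" using A by (auto intro!: derivative_eq_intros)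
      from DERIV_chain2[OF zeta_deriv this]
      have 1: "((\<lambda>r. \<zeta> (2 * r / A)) has_real_derivative \<zeta>' (2 * r / A) * (2 / A)) (at r)" .
      show ?thesis
        unfolding v_def[abs_def] w_def eta_eq[OF less_imp_le[OF that], symmetric]
        using DERIV_divide[OF DERIV_diff[OF DERIV_cmult[OF 1, of "of_int d"] DERIV_cmult[OF eta_deriv[OF that], of "of_int d"]] DERIV_ident] that
        by simp
    qed
    show "continuous_on {0<..} w"
      unfolding w_def using A
      by (intro continuous_intros continuous_on_compose2[OF zeta'_cont] continuous_on_compose2[OF cz]) auto
    show "(0::real) < 1" by simp
    show "v r = 0" if "0 \<le> r" "r \<le> 1" for r
    proof -
      have "2 * r / A \<le> 1" using that A by (simp add: field_simps)
      then show ?thesis using that by (simp add: v_def eta_eq zeta_0)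
    qed
    show "v r = 0" if "A \<le> r" for r
    proof -
      have "2 \<le> 2 * r / A" using that A by (simp add: field_simps)
      then show ?thesis using that A by (simp add: v_def eta_eq zeta_1)
    qed
  qed
  moreover have "(\<lambda>r. sin (ang A L r)) = (\<lambda>r. \<eta> r + u r)" by (simp add: u_def)
  moreover have "of_int d * \<zeta> (2 * r / A) = of_int d * \<eta> r + r * v r" for r
  proof (cases "r = 0")
    case True
    then show ?thesis by (simp add: eta_eq zeta_0)
  qed (simp add: v_def)
  ultimately show ?thesis unfolding Y_space_def by auto
qed

text \<open>The profile is chosen so that only three terms survive. As sin^2 + cos^2 = 1, the
  gradients of \<open>f\<close> and \<open>m\<close> combine to the square of \<theta>' and the
  potential vanishes; the coupling vanishes since \<open>f\<close> is 0 up to \<open>A\<close> and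
  \<open>S\<close> is \<open>d\<close> from \<open>A\<close> on.\<close>

lemma competitor_energy:
  assumes C: "0 \<le> C" "\<And>s. \<bar>\<zeta>' s\<bar> \<le> C" and g: "0 \<le> g"
  shows "energy d \<kappa> g (\<lambda>r. sin (ang A L r), \<lambda>r. of_int d * \<zeta> (2 * r / A), \<lambda>r. cos (ang A L r))
    \<le> ennreal ((pi / 2 * C)\<^sup>2 / L + (2 * of_int d * C)\<^sup>2 / A\<^sup>2 + \<kappa>\<^sup>2 * g * (A * exp L)\<^sup>2)"
proof -
  define B where "B = A * exp L"
  have B: "A \<le> B" "0 < B" using exp_A A by (auto simp: B_def)
  define f where "f r = sin (ang A L r)" for r
  define S where "S r = of_int d * \<zeta> (2 * r / A)" for r
  define m where "m r = cos (ang A L r)" for r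
  \<comment> \<open>Majorants for the angular, the \<open>S'\<close> and the mass term. The first
    integrates to a multiple of ln B - ln A = L, which against the factor 1/L^2 leaves 1/L. The
    second uses |S'| \<le> 2 |d| C / A and 1/r \<le> 2/A on an interval of length A/2.\<close>
  define b1 where "b1 r = ennreal ((pi / 2 * C / L)\<^sup>2 / r) * indicator {A..B} r" for r
  define b2 where "b2 r = ennreal ((2 * of_int d * C / A)\<^sup>2 * (2 / A)) * indicator {A/2..A} r" for r
  define b3 where "b3 r = ennreal (\<kappa>\<^sup>2 * g * B) * indicator {0..B} r" for r
  have wf: "AE r in lborel. 0 < r \<longrightarrow> weak_deriv f r = cos (ang A L r) * ang' A L r"
  proof (rule weak_deriv_classical)
    show "(f has_real_derivative cos (ang A L r) * ang' A L r) (at r)" if "0 < r" for r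
      unfolding f_def[abs_def] using ang_deriv[OF that] by (auto intro!: derivative_eq_intros)
    show "continuous_on {0<..} (\<lambda>r. cos (ang A L r) * ang' A L r)"
      using ang_deriv by (intro continuous_intros ang'_cont)
        (auto intro!: continuous_at_imp_continuous_on DERIV_isCont)
  qed
  have wm: "AE r in lborel. 0 < r \<longrightarrow> weak_deriv m r = - sin (ang A L r) * ang' A L r"
  proof (rule weak_deriv_classical)
    show "(m has_real_derivative - sin (ang A L r) * ang' A L r) (at r)" if "0 < r" for r
      unfolding m_def[abs_def] using ang_deriv[OF that] by (auto intro!: derivative_eq_intros)
    show "continuous_on {0<..} (\<lambda>r. - sin (ang A L r) * ang' A L r)"
      using ang_deriv by (intro continuous_intros ang'_cont)
        (auto intro!: continuous_at_imp_continuous_on DERIV_isCont)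
  qed
  have wS: "AE r in lborel. 0 < r \<longrightarrow> weak_deriv S r = of_int d * (\<zeta>' (2 * r / A) * (2 / A))"
  proof (rule weak_deriv_classical)
    show "(S has_real_derivative of_int d * (\<zeta>' (2 * r / A) * (2 / A))) (at r)" for r
    proof -
      have "((\<lambda>r. 2 * r / A) has_real_derivative 2 / A) (at r)" using A by (auto intro!: derivative_eq_intros)
      from DERIV_cmult[OF DERIV_chain2[OF zeta_deriv this]] show ?thesis unfolding S_def[abs_def] .
    qed
    show "continuous_on {0<..} (\<lambda>r. of_int d * (\<zeta>' (2 * r / A) * (2 / A)))"
      using A by (intro continuous_intros continuous_on_compose2[OF zeta'_cont]) auto
  qed
  define E where "E r = ((weak_deriv f r)\<^sup>2 + (weak_deriv S r / r)\<^sup>2 + (weak_deriv m r)\<^sup>2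
        + \<kappa>\<^sup>2 * g * (m r)\<^sup>2 + (of_int d - S r)\<^sup>2 * (f r)\<^sup>2 / r\<^sup>2
        + \<kappa>\<^sup>2 / 2 * (1 - (f r)\<^sup>2 - (m r)\<^sup>2)\<^sup>2) * r" for r
  have "AE r in lborel. ennreal (E r) * indicator {0<..} r \<le> b1 r + b2 r + b3 r"
    using wf wm wS
  proof eventually_elim
    case (elim r)
    show ?case
    proof (cases "0 < r")
      case True
      have grad: "(weak_deriv f r)\<^sup>2 + (weak_deriv m r)\<^sup>2 = (ang' A L r)\<^sup>2"
        using elim True by (simp add: power_mult_distrib distrib_right[symmetric])
      have pot: "1 - (f r)\<^sup>2 - (m r)\<^sup>2 = 0"
        by (simp add: f_def m_def cos_squared_eq)
      have cross: "(of_int d - S r)\<^sup>2 * (f r)\<^sup>2 / r\<^sup>2 = 0"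
      proof (cases "r \<le> A")
        case True
        then show ?thesis using ang_0[of r] \<open>0 < r\<close> by (simp add: f_def)
      next
        case False
        then have "2 \<le> 2 * r / A" using A by (simp add: field_simps)
        then show ?thesis by (simp add: S_def zeta_1)
      qed
      have E: "E r = (ang' A L r)\<^sup>2 * r + (weak_deriv S r / r)\<^sup>2 * r + \<kappa>\<^sup>2 * g * (m r)\<^sup>2 * r"
        unfolding E_def cross pot grad[symmetric] by (simp add: algebra_simps)
      have 1: "ennreal ((ang' A L r)\<^sup>2 * r) \<le> b1 r"
      proof (cases "r \<in> {A..B}")
        case True
        have "\<bar>ang' A L r\<bar> = pi / 2 * \<bar>\<zeta>' (1 + ln (r / A) / L)\<bar> / (L * r)"
          using L \<open>0 < r\<close> by (simp add: ang'_def abs_mult)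
        also have "\<dots> \<le> pi / 2 * C / (L * r)"
          using L \<open>0 < r\<close> C by (intro divide_right_mono mult_left_mono) auto
        finally have "(ang' A L r)\<^sup>2 \<le> (pi / 2 * C / (L * r))\<^sup>2"
          by (metis abs_ge_zero power2_abs power_mono)
        then have "(ang' A L r)\<^sup>2 * r \<le> (pi / 2 * C / (L * r))\<^sup>2 * r"
          using \<open>0 < r\<close> by (intro mult_right_mono) auto
        also have "\<dots> = (pi / 2 * C / L)\<^sup>2 / r"
          using \<open>0 < r\<close> L by (simp add: field_simps power2_eq_square)
        finally show ?thesis using True by (simp add: b1_def ennreal_leI)
      next
        case False
        then show ?thesis using ang'_0[OF True] by (simp add: B_def)
      qed
      have 2: "ennreal ((weak_deriv S r / r)\<^sup>2 * r) \<le> b2 r"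
      proof (cases "r \<in> {A/2..A}")
        case True
        have "\<bar>weak_deriv S r\<bar> = \<bar>of_int d\<bar> * \<bar>\<zeta>' (2 * r / A)\<bar> * (2 / A)"
          using elim \<open>0 < r\<close> A by (simp add: abs_mult)
        also have "\<dots> \<le> \<bar>of_int d\<bar> * C * (2 / A)"
          using A C by (intro mult_right_mono mult_left_mono) auto
        also have "\<dots> = \<bar>2 * of_int d * C / A\<bar>" using A C by (simp add: abs_mult)
        finally have "(weak_deriv S r)\<^sup>2 \<le> (2 * of_int d * C / A)\<^sup>2"
          by (simp only: abs_le_square_iff)
        moreover have "1 / r \<le> 2 / A" using True A by (simp add: field_simps)
        ultimately have "(weak_deriv S r)\<^sup>2 * (1 / r) \<le> (2 * of_int d * C / A)\<^sup>2 * (2 / A)"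
          using \<open>0 < r\<close> by (intro mult_mono) auto
        moreover have "(weak_deriv S r / r)\<^sup>2 * r = (weak_deriv S r)\<^sup>2 * (1 / r)"
          using \<open>0 < r\<close> by (simp add: power2_eq_square)
        ultimately show ?thesis using True by (simp add: b2_def ennreal_leI)
      next
        case False
        then have "2 * r / A \<notin> {1..2}" using A by (auto simp: field_simps)
        then show ?thesis using elim True by (simp add: zeta'_zero)
      qed
      have 3: "ennreal (\<kappa>\<^sup>2 * g * (m r)\<^sup>2 * r) \<le> b3 r"
      proof (cases "r \<le> B")
        case True
        have "(m r)\<^sup>2 * r \<le> 1 * B"
          using True B \<open>0 < r\<close> by (intro mult_mono) (auto simp: m_def abs_square_le_1)
        then have "\<kappa>\<^sup>2 * g * ((m r)\<^sup>2 * r) \<le> \<kappa>\<^sup>2 * g * B"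
          using g by (intro mult_left_mono) auto
        then show ?thesis using True \<open>0 < r\<close> by (simp add: b3_def ennreal_leI mult.assoc)
      next
        case False
        then have "A * exp L \<le> r" by (simp add: B_def)
        then have "m r = 0" by (simp only: m_def ang_1 cos_pi_half)
        then show ?thesis by simp
      qed
      have "ennreal (E r) = ennreal ((ang' A L r)\<^sup>2 * r) + ennreal ((weak_deriv S r / r)\<^sup>2 * r) + ennreal (\<kappa>\<^sup>2 * g * (m r)\<^sup>2 * r)"
        unfolding E using True g by (simp add: ennreal_plus[symmetric] del: ennreal_plus)
      also have "\<dots> \<le> b1 r + b2 r + b3 r" using 1 2 3 by (intro add_mono)
      finally show ?thesis using True by simp
    qed simp
  qed
  then have "(\<integral>\<^sup>+r\<in>{0<..}. ennreal (E r) \<partial>lborel) \<le> (\<integral>\<^sup>+r. b1 r + b2 r + b3 r \<partial>lborel)"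
    by (rule nn_integral_mono_AE)
  also have "\<dots> = (\<integral>\<^sup>+r. b1 r \<partial>lborel) + (\<integral>\<^sup>+r. b2 r \<partial>lborel) + (\<integral>\<^sup>+r. b3 r \<partial>lborel)"
    by (simp add: nn_integral_add b1_def b2_def b3_def)
  also have "(\<integral>\<^sup>+r. b1 r \<partial>lborel) = ennreal ((pi / 2 * C / L)\<^sup>2 * ln B - (pi / 2 * C / L)\<^sup>2 * ln A)"
    unfolding b1_def using B A
    by (intro nn_integral_FTC_Icc) (auto intro!: derivative_eq_intros simp: has_real_derivative_iff_has_vector_derivative[symmetric])
  also have "(pi / 2 * C / L)\<^sup>2 * ln B - (pi / 2 * C / L)\<^sup>2 * ln A = (pi / 2 * C)\<^sup>2 / L"
    using A L by (simp add: B_def ln_mult power2_eq_square field_simps)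
  also have "(\<integral>\<^sup>+r. b2 r \<partial>lborel) = ennreal ((2 * of_int d * C)\<^sup>2 / A\<^sup>2)"
  proof -
    have "(\<integral>\<^sup>+r. b2 r \<partial>lborel) = ennreal ((2 * of_int d * C / A)\<^sup>2 * (2 / A)) * ennreal (A - A / 2)"
      unfolding b2_def using A by (subst nn_integral_cmult_indicator) auto
    also have "\<dots> = ennreal ((2 * of_int d * C / A)\<^sup>2 * (2 / A) * (A - A / 2))"
      using A by (intro ennreal_mult[symmetric]) auto
    also have "(2 * of_int d * C / A)\<^sup>2 * (2 / A) * (A - A / 2) = (2 * of_int d * C)\<^sup>2 / A\<^sup>2"
      using A by (simp add: field_simps power2_eq_square)
    finally show ?thesis .
  qed
  also have "(\<integral>\<^sup>+r. b3 r \<partial>lborel) = ennreal (\<kappa>\<^sup>2 * g * B\<^sup>2)"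
  proof -
    have "(\<integral>\<^sup>+r. b3 r \<partial>lborel) = ennreal (\<kappa>\<^sup>2 * g * B) * ennreal (B - 0)"
      unfolding b3_def using B by (subst nn_integral_cmult_indicator) auto
    also have "\<dots> = ennreal (\<kappa>\<^sup>2 * g * B * (B - 0))"
      using B g by (intro ennreal_mult[symmetric]) auto
    finally show ?thesis by (simp add: power2_eq_square mult.assoc)
  qed
  also have "ennreal ((pi / 2 * C)\<^sup>2 / L) + ennreal ((2 * of_int d * C)\<^sup>2 / A\<^sup>2) + ennreal (\<kappa>\<^sup>2 * g * B\<^sup>2)
    = ennreal ((pi / 2 * C)\<^sup>2 / L + (2 * of_int d * C)\<^sup>2 / A\<^sup>2 + \<kappa>\<^sup>2 * g * (A * exp L)\<^sup>2)"
    using L g by (simp add: B_def ennreal_plus[symmetric] del: ennreal_plus)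
  finally have int: "(\<integral>\<^sup>+r\<in>{0<..}. ennreal (E r) \<partial>lborel) \<le>
    ennreal ((pi / 2 * C)\<^sup>2 / L + (2 * of_int d * C)\<^sup>2 / A\<^sup>2 + \<kappa>\<^sup>2 * g * (A * exp L)\<^sup>2)" .
  \<comment> \<open>The prefactor 1/2 of the energy is merely bounded by 1, as the constant is
    immaterial.\<close>
  have "ennreal 1 / ennreal 2 = ennreal (1 / 2)" by (rule divide_ennreal) auto
  also have "\<dots> \<le> ennreal 1" by (rule ennreal_leI) simp
  finally have "(1 / 2 :: ennreal) \<le> 1" by simp
  then have "1 / 2 * (\<integral>\<^sup>+r\<in>{0<..}. ennreal (E r) \<partial>lborel) \<le> 1 * (\<integral>\<^sup>+r\<in>{0<..}. ennreal (E r) \<partial>lborel)"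
    by (rule mult_right_mono) simp
  also note int[folded mult_1]
  finally show ?thesis by (simp add: energy_def E_def f_def[abs_def] S_def[abs_def] m_def[abs_def])
qed

end

end

section \<open>Regularity of admissible triples\<close>

lemma locally_integrable_times_test:
  fixes u h :: "'a::euclidean_space \<Rightarrow> real"
  assumes u: "locally_integrable_on \<Omega> u" and h: "continuous_on UNIV h"
    and K: "compact K" "K \<subseteq> \<Omega>" "\<And>x. x \<notin> K \<Longrightarrow> h x = 0"
  shows "set_integrable lborel \<Omega> (\<lambda>x. u x * h x)"
proof -
  obtain C where C: "\<And>x. \<bar>h x\<bar> \<le> C"
    using bounded_continuous_compact_support[OF h K(1,3)] by blast
  have "integrable lborel (\<lambda>x. (indicator K x *\<^sub>R u x) * h x)"
    using u K C h unfolding locally_integrable_on_def set_integrable_def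
    by (intro integrable_mult_bounded[where C=C]) (auto intro: borel_measurable_continuous_onI)
  also have "(\<lambda>x. (indicator K x *\<^sub>R u x) * h x) = (\<lambda>x. indicator \<Omega> x *\<^sub>R (u x * h x))"
    using K(2,3) by (fastforce simp: indicator_def)
  finally show ?thesis by (simp add: set_integrable_def)
qed

lemma has_weak_partial_add:
  assumes 1: "has_weak_partial \<Omega> b u w" and 2: "has_weak_partial \<Omega> b u' w'" and b: "b \<in> Basis"
  shows "has_weak_partial \<Omega> b (\<lambda>x. u x + u' x) (\<lambda>x. w x + w' x)"
  unfolding has_weak_partial_def
proof (intro conjI ballI)
  have loc: "locally_integrable_on \<Omega> u" "locally_integrable_on \<Omega> u'" "locally_integrable_on \<Omega> w" "locally_integrable_on \<Omega> w'"
    using 1 2 by (auto simp: has_weak_partial_def)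
  then show "locally_integrable_on \<Omega> (\<lambda>x. u x + u' x)" "locally_integrable_on \<Omega> (\<lambda>x. w x + w' x)"
    unfolding locally_integrable_on_def by (blast intro: set_integral_add(1))+
  fix \<phi> assume \<phi>: "\<phi> \<in> test_functions \<Omega>"
  then obtain K where K: "compact K" "K \<subseteq> \<Omega>" "\<And>x. x \<notin> K \<Longrightarrow> \<phi> x = 0"
    and cd\<phi>: "\<And>b. b \<in> Basis \<Longrightarrow> continuous_on UNIV (\<lambda>x. frechet_derivative \<phi> (at x) b)"
    and c\<phi>: "continuous_on UNIV \<phi>"
    and z\<phi>: "\<And>x b. x \<notin> K \<Longrightarrow> frechet_derivative \<phi> (at x) b = 0"
    by (rule test_functions_facts) blast
  note A = locally_integrable_times_test[OF _ cd\<phi>[OF b] K(1,2) z\<phi>]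
  note B = locally_integrable_times_test[OF _ c\<phi> K]
  have "(LINT x:\<Omega>|lborel. (u x + u' x) * frechet_derivative \<phi> (at x) b)
    = (LINT x:\<Omega>|lborel. u x * frechet_derivative \<phi> (at x) b) + (LINT x:\<Omega>|lborel. u' x * frechet_derivative \<phi> (at x) b)"
    unfolding distrib_right using loc by (intro set_integral_add(2) A)
  also have "\<dots> = - ((LINT x:\<Omega>|lborel. w x * \<phi> x) + (LINT x:\<Omega>|lborel. w' x * \<phi> x))"
    using 1 2 \<phi> by (simp add: has_weak_partial_def)
  also have "(LINT x:\<Omega>|lborel. w x * \<phi> x) + (LINT x:\<Omega>|lborel. w' x * \<phi> x) = (LINT x:\<Omega>|lborel. (w x + w' x) * \<phi> x)"
    unfolding distrib_right using loc by (intro set_integral_add(2)[symmetric] B)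
  finally show "(LINT x:\<Omega>|lborel. (u x + u' x) * frechet_derivative \<phi> (at x) b) = - (LINT x:\<Omega>|lborel. (w x + w' x) * \<phi> x)" .
qed

text \<open>If \<phi> is a test function on the half-line, so is r \<phi>(r); testing the weak
  derivative of \<open>v\<close> with it gives the product rule. It is needed because the second
  component of an admissible triple contains r v(r).\<close>

lemma has_weak_partial_ident_mult:
  fixes v w :: "real \<Rightarrow> real"
  assumes v: "continuous_on {0<..} v" and w: "has_weak_partial {0<..} 1 v w"
  shows "has_weak_partial {0<..} 1 (\<lambda>r. r * v r) (\<lambda>r. v r + r * w r)"
  unfolding has_weak_partial_def
proof (intro conjI ballI)
  have loc: "locally_integrable_on {0<..} w" using w by (simp add: has_weak_partial_def)
  have locv: "locally_integrable_on {0<..} v" using v by (rule locally_integrable_on_continuous)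
  show "locally_integrable_on {0<..} (\<lambda>r. r * v r)"
    by (intro locally_integrable_on_continuous continuous_intros v)
  show "locally_integrable_on {0<..} (\<lambda>r. v r + r * w r)"
    unfolding locally_integrable_on_def
  proof (intro allI impI)
    fix K :: "real set" assume K: "compact K \<and> K \<subseteq> {0<..}"
    obtain C where C: "\<And>r. r \<in> K \<Longrightarrow> \<bar>r\<bar> \<le> C"
      using compact_imp_bounded[of K] K by (auto simp: bounded_iff)
    have Km: "K \<in> sets borel" using K by (auto intro: borel_closed compact_imp_closed)
    have "integrable lborel (\<lambda>r. (indicator K r *\<^sub>R w r) * (indicator K r * r))"
      by (rule integrable_mult_bounded[where C="max C 0"])
        (use loc K C Km in \<open>auto simp: locally_integrable_on_def set_integrable_def indicator_def le_max_iff_disj\<close>)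
    also have "(\<lambda>r. (indicator K r *\<^sub>R w r) * (indicator K r * r)) = (\<lambda>r. indicator K r *\<^sub>R (r * w r))"
      by (auto simp: indicator_def)
    finally have "set_integrable lborel K (\<lambda>r. r * w r)" by (simp add: set_integrable_def)
    moreover have "set_integrable lborel K v" using locv K by (simp add: locally_integrable_on_def)
    ultimately show "set_integrable lborel K (\<lambda>r. v r + r * w r)" by (intro set_integral_add(1))
  qed
  fix \<phi> :: "real \<Rightarrow> real" assume \<phi>: "\<phi> \<in> test_functions {0<..}"
  then obtain K where K: "compact K" "K \<subseteq> {0<..}" "\<And>x. x \<notin> K \<Longrightarrow> \<phi> x = 0"
    and d\<phi>: "\<And>x. (\<phi> has_derivative frechet_derivative \<phi> (at x)) (at x)"
    and cd\<phi>: "\<And>b. b \<in> Basis \<Longrightarrow> continuous_on UNIV (\<lambda>x. frechet_derivative \<phi> (at x) b)"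
    and c\<phi>: "continuous_on UNIV \<phi>"
    and z\<phi>: "\<And>x b. x \<notin> K \<Longrightarrow> frechet_derivative \<phi> (at x) b = 0"
    by (rule test_functions_facts) blast
  define \<psi> where "\<psi> r = r * \<phi> r" for r
  have "Ck_on k UNIV \<psi>" for k
    unfolding \<psi>_def using \<phi>
    by (intro Ck_on_mult[OF Ck_on_linear[OF bounded_linear_ident]]) (simp add: test_functions_def smooth_on_def)
  then have \<psi>: "\<psi> \<in> test_functions {0<..}"
    using K by (auto simp: test_functions_def smooth_on_def \<psi>_def)
  have d\<psi>: "frechet_derivative \<psi> (at r) 1 = r * frechet_derivative \<phi> (at r) 1 + \<phi> r" for r
  proof -
    have "(\<psi> has_derivative (\<lambda>h. r * frechet_derivative \<phi> (at r) h + h * \<phi> r)) (at r)"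
      unfolding \<psi>_def by (rule has_derivative_mult[OF has_derivative_ident d\<phi>])
    then have "frechet_derivative \<psi> (at r) = (\<lambda>h. r * frechet_derivative \<phi> (at r) h + h * \<phi> r)"
      by (rule frechet_derivative_at[symmetric])
    then show ?thesis by simp
  qed
  have c\<psi>: "continuous_on UNIV \<psi>" unfolding \<psi>_def by (intro continuous_intros c\<phi>)
  have cd\<psi>: "continuous_on UNIV (\<lambda>r. r * frechet_derivative \<phi> (at r) 1)"
    by (intro continuous_intros cd\<phi>) simp
  have I1: "set_integrable lborel {0<..} (\<lambda>r. v r * (r * frechet_derivative \<phi> (at r) 1))"
    by (rule locally_integrable_times_test[OF locv cd\<psi> K(1,2)]) (simp add: z\<phi>)
  have I2: "set_integrable lborel {0<..} (\<lambda>r. v r * \<phi> r)"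
    by (rule locally_integrable_times_test[OF locv c\<phi> K])
  have I3: "set_integrable lborel {0<..} (\<lambda>r. w r * \<psi> r)"
    by (rule locally_integrable_times_test[OF loc c\<psi> K(1,2)]) (simp add: \<psi>_def K(3))
  have "(LINT r:{0<..}|lborel. v r * (r * frechet_derivative \<phi> (at r) 1)) + (LINT r:{0<..}|lborel. v r * \<phi> r)
    = (LINT r:{0<..}|lborel. v r * frechet_derivative \<psi> (at r) 1)"
    unfolding d\<psi> distrib_left by (rule set_integral_add(2)[OF I1 I2, symmetric])
  also have "\<dots> = - (LINT r:{0<..}|lborel. w r * \<psi> r)"
    using w \<psi> by (simp add: has_weak_partial_def)
  finally have "(LINT r:{0<..}|lborel. v r * (r * frechet_derivative \<phi> (at r) 1))
    = - ((LINT r:{0<..}|lborel. v r * \<phi> r) + (LINT r:{0<..}|lborel. w r * \<psi> r))" by simp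
  also have "(LINT r:{0<..}|lborel. v r * \<phi> r) + (LINT r:{0<..}|lborel. w r * \<psi> r)
    = (LINT r:{0<..}|lborel. v r * \<phi> r + w r * \<psi> r)"
    by (rule set_integral_add(2)[OF I2 I3, symmetric])
  also have "(\<lambda>r. v r * \<phi> r + w r * \<psi> r) = (\<lambda>r. (v r + r * w r) * \<phi> r)"
    by (simp add: \<psi>_def algebra_simps)
  also have "(\<lambda>r. v r * (r * frechet_derivative \<phi> (at r) 1)) = (\<lambda>r. r * v r * frechet_derivative \<phi> (at r) 1)"
    by (simp add: ac_simps)
  finally show "(LINT r:{0<..}|lborel. r * v r * frechet_derivative \<phi> (at r) 1) =
    - (LINT r:{0<..}|lborel. (v r + r * w r) * \<phi> r)" .
qed

lemma locally_integrable_on_Ioi_measurable: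
  fixes w :: "real \<Rightarrow> real"
  assumes "locally_integrable_on {0<..} w"
  shows "(\<lambda>r. indicator {0<..} r * w r) \<in> borel_measurable borel"
proof (rule borel_measurable_LIMSEQ_metric)
  fix n
  have "0 < inverse (real (Suc n))" by simp
  then have "{inverse (real (Suc n))..real n} \<subseteq> {0<..}"
    by (meson atLeastAtMost_iff greaterThan_iff less_le_trans subsetI)
  then have "set_integrable lborel {inverse (real (Suc n))..real n} w"
    using assms unfolding locally_integrable_on_def by blast
  then show "(\<lambda>r. indicator {inverse (real (Suc n))..real n} r * w r) \<in> borel_measurable borel"
    by (auto simp: set_integrable_def)
next
  fix r :: real
  show "(\<lambda>n. indicator {inverse (real (Suc n))..real n} r * w r) \<longlonglongrightarrow> indicator {0<..} r * w r"
  proof (cases "0 < r")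
    case True
    obtain n1 where n1: "inverse (real (Suc n1)) < r" using reals_Archimedean[OF True] by blast
    obtain n2 where n2: "r < real n2" using reals_Archimedean2 by blast
    have "indicator {inverse (real (Suc n))..real n} r * w r = indicator {0<..} r * w r" if "n \<ge> max n1 n2" for n
    proof -
      have "inverse (real (Suc n)) \<le> inverse (real (Suc n1))" using that by simp
      then have "inverse (real (Suc n)) \<le> r" using n1 by linarith
      moreover have "r \<le> real n" using n2 that by simp
      ultimately show ?thesis using True by simp
    qed
    then show ?thesis by (intro tendsto_eventually eventually_sequentiallyI[of "max n1 n2"])
  next
    case False
    then have "r < inverse (real (Suc n))" for n
      using inverse_positive_iff_positive[of "real (Suc n)"] by linarith
    then show ?thesis using False by (simp add: not_le[symmetric])
  qed
qed

text \<open>If |r v(r)| stayed above \<delta> near 0, then v^2/r would dominate \<delta>^2/r^3,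
  which is not integrable. A single small point close to 0 is enough, because increments of
  \<open>S\<close> are controlled separately.\<close>

lemma X_space_mult_ident_small:
  assumes "v \<in> X_space" "0 < \<delta>"
  obtains a where "0 < a" "a < \<delta>" "\<bar>a * v a\<bar> < \<delta>"
proof -
  have "\<exists>a. 0 < a \<and> a < \<delta> \<and> \<bar>a * v a\<bar> < \<delta>"
  proof (rule ccontr)
    assume "\<not> ?thesis"
    then have big: "\<delta> \<le> \<bar>a * v a\<bar>" if "0 < a" "a < \<delta>" for a using that by force
    define J where "J = (\<integral>\<^sup>+r\<in>{0<..}. ennreal ((v r)\<^sup>2 / r\<^sup>2 * r) \<partial>lborel)"
    have "J < \<infinity>" using assms(1) by (simp add: X_space_def J_def)
    then obtain I where I: "0 \<le> I" "J = ennreal I" by (cases J) auto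
    \<comment> \<open>The interval [t/2, t] alone contributes at least (\<delta>/t)^2 / 2, and with
      this \<open>t\<close> that is (2 + 2 I)^2 / 2, more than the whole integral
      \<open>I\<close>.\<close>
    define t where "t = \<delta> / (2 + 2 * I)"
    have t: "0 < t" "t < \<delta>" using assms(2) I(1) by (auto simp: t_def field_simps add_pos_nonneg)
    have "ennreal (\<delta>\<^sup>2 / t ^ 3) * ennreal (t - t / 2) = (\<integral>\<^sup>+r. ennreal (\<delta>\<^sup>2 / t ^ 3) * indicator {t/2..t} r \<partial>lborel)"
      using t by (subst nn_integral_cmult_indicator) auto
    also have "\<dots> \<le> J"
      unfolding J_def
    proof (rule nn_integral_mono)
      fix r show "ennreal (\<delta>\<^sup>2 / t ^ 3) * indicator {t/2..t} r \<le> ennreal ((v r)\<^sup>2 / r\<^sup>2 * r) * indicator {0<..} r"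
      proof (cases "r \<in> {t/2..t}")
        case True
        then have r: "0 < r" "r \<le> t" "r < \<delta>" using t by auto
        have "\<delta>\<^sup>2 \<le> (r * v r)\<^sup>2" using big[OF r(1,3)] assms(2) abs_le_square_iff[of \<delta> "r * v r"] by simp
        then have "\<delta>\<^sup>2 / t ^ 3 \<le> (r * v r)\<^sup>2 / r ^ 3" using r by (intro frac_le) (auto intro: power_mono)
        also have "\<dots> = (v r)\<^sup>2 / r\<^sup>2 * r" using r by (simp add: field_simps power2_eq_square power3_eq_cube)
        finally show ?thesis using True r by (simp add: ennreal_leI)
      qed simp
    qed
    finally have "ennreal (\<delta>\<^sup>2 / t ^ 3 * (t - t / 2)) \<le> ennreal I"
      using t I by (subst ennreal_mult) auto
    then have "\<delta>\<^sup>2 / t ^ 3 * (t - t / 2) \<le> I" using I by (simp add: ennreal_le_iff)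
    moreover have "\<delta>\<^sup>2 / t ^ 3 * (t - t / 2) = (\<delta> / t)\<^sup>2 / 2"
      using t by (simp add: field_simps power2_eq_square power3_eq_cube)
    moreover have "\<delta> / t = 2 + 2 * I" using assms(2) I by (simp add: t_def)
    moreover have "(2 + 2 * I)\<^sup>2 / 2 > I" using I by (simp add: power2_eq_square algebra_simps add_pos_nonneg)
    ultimately show False by simp
  qed
  then show ?thesis using that by blast
qed

section \<open>The energy integrand and the regularity of its arguments\<close>

lemma tendsto_zero_ennrealI:
  fixes F :: "'a \<Rightarrow> ennreal"
  assumes "\<And>e. 0 < e \<Longrightarrow> eventually (\<lambda>n. F n \<le> ennreal e) G"
  shows "(F \<longlongrightarrow> 0) G"
proof (rule order_tendstoI)
  fix a :: ennreal assume "0 < a"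
  then obtain x where x: "0 < x" "x < a" using dense by blast
  then obtain e where e: "0 < e" "ennreal e < a" by (cases x) auto
  show "eventually (\<lambda>n. F n < a) G"
    using assms[OF e(1)] by eventually_elim (use e(2) in auto)
qed simp


definition energy_density ::
    "int \<Rightarrow> real \<Rightarrow> real \<Rightarrow> (real \<Rightarrow> real) \<Rightarrow> (real \<Rightarrow> real) \<Rightarrow> (real \<Rightarrow> real) \<Rightarrow> real \<Rightarrow> real" where
  "energy_density d \<kappa> g f S m r =
    (weak_deriv f r)\<^sup>2 + (weak_deriv S r / r)\<^sup>2 + (weak_deriv m r)\<^sup>2
        + \<kappa>\<^sup>2 * g * (m r)\<^sup>2 + (of_int d - S r)\<^sup>2 * (f r)\<^sup>2 / r\<^sup>2
        + \<kappa>\<^sup>2 / 2 * (1 - (f r)\<^sup>2 - (m r)\<^sup>2)\<^sup>2"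

lemma energy_density_ge:
  assumes "0 \<le> g"
  shows "(weak_deriv f r)\<^sup>2 + (weak_deriv m r)\<^sup>2 + (of_int d - S r)\<^sup>2 * (f r)\<^sup>2 / r\<^sup>2
        + \<kappa>\<^sup>2 / 2 * (1 - (f r)\<^sup>2 - (m r)\<^sup>2)\<^sup>2 \<le> energy_density d \<kappa> g f S m r"
    and "(weak_deriv S r / r)\<^sup>2 \<le> energy_density d \<kappa> g f S m r"
    and "0 \<le> energy_density d \<kappa> g f S m r"
proof -
  have "0 \<le> (weak_deriv S r / r)\<^sup>2" "0 \<le> \<kappa>\<^sup>2 * g * (m r)\<^sup>2" "0 \<le> (weak_deriv f r)\<^sup>2" "0 \<le> (weak_deriv m r)\<^sup>2"
    "0 \<le> (of_int d - S r)\<^sup>2 * (f r)\<^sup>2 / r\<^sup>2" "0 \<le> \<kappa>\<^sup>2 / 2 * (1 - (f r)\<^sup>2 - (m r)\<^sup>2)\<^sup>2"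
    using assms by simp_all
  then show "(weak_deriv f r)\<^sup>2 + (weak_deriv m r)\<^sup>2 + (of_int d - S r)\<^sup>2 * (f r)\<^sup>2 / r\<^sup>2
        + \<kappa>\<^sup>2 / 2 * (1 - (f r)\<^sup>2 - (m r)\<^sup>2)\<^sup>2 \<le> energy_density d \<kappa> g f S m r"
    and "(weak_deriv S r / r)\<^sup>2 \<le> energy_density d \<kappa> g f S m r"
    and "0 \<le> energy_density d \<kappa> g f S m r"
    unfolding energy_density_def by linarith+
qed

lemma energy_eq:
  "energy d \<kappa> g (f, S, m) = 1 / 2 * (\<integral>\<^sup>+r\<in>{0<..}. ennreal (energy_density d \<kappa> g f S m r * r) \<partial>lborel)"
  by (simp add: energy_def energy_density_def)

text \<open>\<open>u\<close> and \<open>u - c\<close> have exactly the same weak derivatives, so the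
  choice operator returns the same function for both. The equality is therefore pointwise and holds
  even for \<open>u\<close> without any weak derivative.\<close>

lemma weak_deriv_diff_const:
  "weak_deriv (\<lambda>r. u r - c) = weak_deriv u"
proof -
  have const: "has_weak_partial {0<..} 1 (\<lambda>_::real. a) (\<lambda>_. 0)" for a :: real
    using has_weak_partial_classical[of "{0::real<..}" "\<lambda>_. a" "\<lambda>_ _. 0" 1] by simp
  have "has_weak_partial {0<..} 1 (\<lambda>r. u r + a) w" if "has_weak_partial {0<..} 1 u w" for u w :: "real \<Rightarrow> real" and a
    using has_weak_partial_add[OF that const[of a]] by simp
  from this[of u _ "- c"] this[of "\<lambda>r. u r - c" _ c]
  have "has_weak_partial {0<..} 1 (\<lambda>r. u r - c) w \<longleftrightarrow> has_weak_partial {0<..} 1 u w" for w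
    by auto
  then show ?thesis by (simp add: weak_deriv_def)
qed

context smooth_cutoff
begin

text \<open>Existence of weak derivatives comes from the radial theory for \<open>u\<close>,
  \<open>v\<close> and \<open>m\<close>, and from the product rule for \<open>r * v r\<close>. The
  last claim is the usable form of \<open>S\<close> vanishing at the origin: on [0, 1] the cutoff is
  zero and \<open>S a\<close> is just \<open>a * v a\<close>.\<close>

lemma Y_space_regular:
  assumes "(f, S, m) \<in> Y_space d \<eta>"
  shows "continuous_on {0<..} f" "continuous_on {0<..} S" "continuous_on {0<..} m"
    and "has_weak_partial {0<..} 1 f (weak_deriv f)"
    and "has_weak_partial {0<..} 1 S (weak_deriv S)"
    and "has_weak_partial {0<..} 1 m (weak_deriv m)"
    and "S 0 = 0"
    and "\<And>\<delta>. 0 < \<delta> \<Longrightarrow> \<exists>a. 0 < a \<and> a < \<delta> \<and> \<bar>S a\<bar> < \<delta>"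
proof -
  obtain u v where f: "f = (\<lambda>r. \<eta> r + u r)" and S: "S = (\<lambda>r. of_int d * \<eta> r + r * v r)"
    and u: "u \<in> X_space" and v: "v \<in> X_space" and m: "m \<in> H_space"
    using assms unfolding Y_space_def by auto
  have uH: "u \<in> H_space" and vH: "v \<in> H_space" using u v by (auto simp: X_space_def)
  have cont: "continuous_on {0<..} u" "continuous_on {0<..} v"
    using uH vH by (auto simp: H_space_def)
  have ceta: "continuous_on {0<..} \<eta>"
    using eta_deriv by (auto intro!: continuous_at_imp_continuous_on DERIV_isCont)
  show "continuous_on {0<..} m" using m by (simp add: H_space_def)
  show "continuous_on {0<..} f" "continuous_on {0<..} S"
    unfolding f S by (intro continuous_intros cont ceta)+
  have eta: "has_weak_partial {0<..} 1 (\<lambda>r. c * \<eta> r) (\<lambda>r. c * \<zeta>' r)" for c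
  proof -
    have "has_weak_partial {0<..} 1 (\<lambda>r. c * \<eta> r) (\<lambda>r. (*) (c * \<zeta>' r) 1)"
    proof (rule has_weak_partial_classical)
      show "((\<lambda>r. c * \<eta> r) has_derivative (*) (c * \<zeta>' r)) (at r)" if "r \<in> {0<..}" for r
        using DERIV_cmult[OF eta_deriv, of r c] that by (simp add: has_field_derivative_def)
      show "continuous_on {0<..} (\<lambda>r. c * \<zeta>' r * 1)"
        by (intro continuous_intros continuous_on_subset[OF zeta'_cont]) auto
    qed auto
    then show ?thesis by simp
  qed
  obtain wu where wu: "has_weak_partial {0<..} 1 u wu" using H_space_has_weak_partial[OF uH] .
  obtain wv where wv: "has_weak_partial {0<..} 1 v wv" using H_space_has_weak_partial[OF vH] .
  obtain wm where wm: "has_weak_partial {0<..} 1 m wm" using H_space_has_weak_partial[OF m] .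
  show "has_weak_partial {0<..} 1 m (weak_deriv m)" using wm by (rule has_weak_partial_weak_deriv)
  have "has_weak_partial {0<..} 1 f (\<lambda>r. 1 * \<zeta>' r + wu r)"
    unfolding f using has_weak_partial_add[OF eta[of 1] wu] by simp
  then show "has_weak_partial {0<..} 1 f (weak_deriv f)" by (rule has_weak_partial_weak_deriv)
  have "has_weak_partial {0<..} 1 S (\<lambda>r. of_int d * \<zeta>' r + (v r + r * wv r))"
    unfolding S using has_weak_partial_add[OF eta[of "of_int d"] has_weak_partial_ident_mult[OF cont(2) wv]] by simp
  then show "has_weak_partial {0<..} 1 S (weak_deriv S)" by (rule has_weak_partial_weak_deriv)
  show "S 0 = 0" by (simp add: S eta_eq zeta_0)
  fix \<delta> :: real assume "0 < \<delta>"
  then have "0 < min \<delta> 1" by simp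
  then obtain a where a: "0 < a" "a < min \<delta> 1" "\<bar>a * v a\<bar> < min \<delta> 1"
    using X_space_mult_ident_small[OF v] by metis
  then have "S a = a * v a" by (simp add: S eta_eq zeta_0)
  then show "\<exists>a. 0 < a \<and> a < \<delta> \<and> \<bar>S a\<bar> < \<delta>" using a by auto
qed

end

section \<open>Estimates by the energy and convergence\<close>

context smooth_cutoff
begin

context
  fixes d :: int and \<kappa> g :: real and f S m :: "real \<Rightarrow> real" and T :: ennreal
  assumes Y: "(f, S, m) \<in> Y_space d \<eta>" and g: "0 \<le> g"
  defines "T \<equiv> (\<integral>\<^sup>+r\<in>{0<..}. ennreal (energy_density d \<kappa> g f S m r * r) \<partial>lborel)"
begin

text \<open>Splitting off sums and constants from a nonnegative integral requires measurability. All
  six functions are known only on (0, \<infinity>), so each is first multiplied by the indicator of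
  that set.\<close>

lemma energy_density_measurable:
  "(\<lambda>r. ennreal (energy_density d \<kappa> g f S m r * r) * indicator {0<..} r) \<in> borel_measurable borel"
proof -
  define W where "W h r = indicator {0<..} r * h r" for h :: "real \<Rightarrow> real" and r :: real
  have "W (weak_deriv f) \<in> borel_measurable borel" "W (weak_deriv S) \<in> borel_measurable borel"
    "W (weak_deriv m) \<in> borel_measurable borel"
    using Y_space_regular(4-6)[OF Y]
    by (auto simp: W_def[abs_def] has_weak_partial_def intro!: locally_integrable_on_Ioi_measurable)
  moreover have "W f \<in> borel_measurable borel" "W S \<in> borel_measurable borel" "W m \<in> borel_measurable borel"
    using Y_space_regular(1-3)[OF Y]
    by (auto simp: W_def[abs_def] intro!: locally_integrable_on_Ioi_measurable locally_integrable_on_continuous)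
  ultimately have [measurable]: "W (weak_deriv f) \<in> borel_measurable borel" "W (weak_deriv S) \<in> borel_measurable borel"
    "W (weak_deriv m) \<in> borel_measurable borel" "W f \<in> borel_measurable borel" "W S \<in> borel_measurable borel" "W m \<in> borel_measurable borel"
    by auto
  have "(\<lambda>r. ennreal (((W (weak_deriv f) r)\<^sup>2 + (W (weak_deriv S) r / r)\<^sup>2 + (W (weak_deriv m) r)\<^sup>2
        + \<kappa>\<^sup>2 * g * (W m r)\<^sup>2 + (of_int d - W S r)\<^sup>2 * (W f r)\<^sup>2 / r\<^sup>2
        + \<kappa>\<^sup>2 / 2 * (1 - (W f r)\<^sup>2 - (W m r)\<^sup>2)\<^sup>2) * r) * indicator {0<..} r) \<in> borel_measurable borel"
    by measurable
  also have "(\<lambda>r. ennreal (((W (weak_deriv f) r)\<^sup>2 + (W (weak_deriv S) r / r)\<^sup>2 + (W (weak_deriv m) r)\<^sup>2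
        + \<kappa>\<^sup>2 * g * (W m r)\<^sup>2 + (of_int d - W S r)\<^sup>2 * (W f r)\<^sup>2 / r\<^sup>2
        + \<kappa>\<^sup>2 / 2 * (1 - (W f r)\<^sup>2 - (W m r)\<^sup>2)\<^sup>2) * r) * indicator {0<..} r)
    = (\<lambda>r. ennreal (energy_density d \<kappa> g f S m r * r) * indicator {0<..} r)"
    by (auto simp: W_def energy_density_def indicator_def)
  finally show ?thesis .
qed

text \<open>By Young's inequality \<open>\<bar>S'\<bar> \<le> (S'/r)\<^sup>2 r / (2\<epsilon>) + \<epsilon> r / 2\<close>.\<close>

lemma S_increment_bound:
  assumes t: "T \<le> ennreal t" "0 \<le> t" and e: "0 < \<epsilon>" and ab: "0 < a" "a \<le> b" "b \<le> R"
  shows "\<bar>S b - S a\<bar> \<le> t / (2 * \<epsilon>) + \<epsilon> * R\<^sup>2 / 2"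
proof -
  define w where "w = weak_deriv S"
  have w: "has_weak_partial {0<..} 1 S w" unfolding w_def by (rule Y_space_regular(5)[OF Y])
  have "set_integrable lborel {a<..b} w"
    by (rule set_integrable_subset[OF has_weak_partial_integrable[OF w ab(1), of b]]) auto
  then have int: "integrable lborel (\<lambda>r. indicator {a<..b} r *\<^sub>R w r)" by (simp add: set_integrable_def)
  have R: "0 < R" using ab by linarith
  have young: "\<bar>w r\<bar> \<le> 1 / (2 * \<epsilon>) * (energy_density d \<kappa> g f S m r * r) + \<epsilon> * R / 2" if r: "0 < r" "r \<le> R" for r
  proof -
    have "0 \<le> (\<bar>w r\<bar> / r - \<epsilon>)\<^sup>2 * r / (2 * \<epsilon>)" using r e by simp
    also have "\<dots> = 1 / (2 * \<epsilon>) * ((w r / r)\<^sup>2 * r) + \<epsilon> * r / 2 - \<bar>w r\<bar>"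
      using r e by (simp add: power2_eq_square field_simps)
    finally have "\<bar>w r\<bar> \<le> 1 / (2 * \<epsilon>) * ((w r / r)\<^sup>2 * r) + \<epsilon> * r / 2" by simp
    also have "\<dots> \<le> 1 / (2 * \<epsilon>) * (energy_density d \<kappa> g f S m r * r) + \<epsilon> * R / 2"
      using r e energy_density_ge(2)[OF g, of S r d \<kappa> f m]
      by (intro add_mono mult_left_mono mult_right_mono divide_right_mono) (auto simp: w_def)
    finally show ?thesis .
  qed
  have "ennreal \<bar>S b - S a\<bar> = ennreal (norm (LINT r|lborel. indicator {a<..b} r *\<^sub>R w r))"
    using has_weak_partial_FTC[OF Y_space_regular(2)[OF Y] w ab(1,2)] by (simp add: set_lebesgue_integral_def)
  also have "\<dots> \<le> (\<integral>\<^sup>+r. ennreal (norm (indicator {a<..b} r *\<^sub>R w r)) \<partial>lborel)"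
    using int by (rule integral_norm_bound_ennreal)
  also have "\<dots> \<le> (\<integral>\<^sup>+r. ennreal (1 / (2 * \<epsilon>)) * (ennreal (energy_density d \<kappa> g f S m r * r) * indicator {0<..} r)
      + ennreal (\<epsilon> * R / 2) * indicator {0..R} r \<partial>lborel)"
  proof (rule nn_integral_mono)
    fix r show "ennreal (norm (indicator {a<..b} r *\<^sub>R w r)) \<le> ennreal (1 / (2 * \<epsilon>)) * (ennreal (energy_density d \<kappa> g f S m r * r) * indicator {0<..} r)
      + ennreal (\<epsilon> * R / 2) * indicator {0..R} r"
    proof (cases "r \<in> {a<..b}")
      case True
      then have r: "0 < r" "r \<le> R" using ab by auto
      have "ennreal \<bar>w r\<bar> \<le> ennreal (1 / (2 * \<epsilon>) * (energy_density d \<kappa> g f S m r * r) + \<epsilon> * R / 2)"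
        by (rule ennreal_leI[OF young[OF r]])
      also have "\<dots> = ennreal (1 / (2 * \<epsilon>)) * ennreal (energy_density d \<kappa> g f S m r * r) + ennreal (\<epsilon> * R / 2)"
      proof -
        have 0: "0 \<le> energy_density d \<kappa> g f S m r * r" using r energy_density_ge(3)[OF g] by simp
        then have "ennreal (1 / (2 * \<epsilon>) * (energy_density d \<kappa> g f S m r * r)) =
            ennreal (1 / (2 * \<epsilon>)) * ennreal (energy_density d \<kappa> g f S m r * r)"
          using e by (intro ennreal_mult) auto
        moreover have "0 \<le> 1 / (2 * \<epsilon>) * (energy_density d \<kappa> g f S m r * r)"
          by (rule mult_nonneg_nonneg[OF _ 0]) (use e in simp)
        moreover have "0 \<le> \<epsilon> * R / 2" using e R by simp
        ultimately show ?thesis by (simp only: ennreal_plus)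
      qed
      finally show ?thesis using True r by simp
    qed simp
  qed
  also have "\<dots> = ennreal (1 / (2 * \<epsilon>)) * T + ennreal (\<epsilon> * R / 2) * ennreal R"
    using energy_density_measurable R
    by (subst nn_integral_add) (auto simp: nn_integral_cmult T_def)
  also have "\<dots> \<le> ennreal (1 / (2 * \<epsilon>)) * ennreal t + ennreal (\<epsilon> * R / 2) * ennreal R"
    using t by (intro add_mono mult_left_mono) auto
  also have "\<dots> = ennreal (t / (2 * \<epsilon>) + \<epsilon> * R\<^sup>2 / 2)"
    using t e R by (simp add: ennreal_mult[symmetric] ennreal_plus[symmetric] power2_eq_square mult.assoc del: ennreal_plus)
  finally show ?thesis
    using t e by (subst (asm) ennreal_le_iff) auto
qed

text \<open>Compare \<open>S r\<close> with \<open>S a\<close> at points \<open>a\<close> close to 0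
  where \<open>S a\<close> is as small as desired; the increment bound does not depend on
  \<open>a\<close>. The point 0 is treated apart, by its explicit value.\<close>

lemma S_bound:
  assumes t: "T \<le> ennreal t" "0 \<le> t" and e: "0 < \<epsilon>" and r: "0 \<le> r" "r \<le> R"
  shows "\<bar>S r\<bar> \<le> t / (2 * \<epsilon>) + \<epsilon> * R\<^sup>2 / 2"
proof (cases "r = 0")
  case True
  then show ?thesis using Y_space_regular(7)[OF Y] t e by simp
next
  case False
  show ?thesis
  proof (rule field_le_epsilon)
    fix \<delta> :: real assume "0 < \<delta>"
    then obtain a where a: "0 < a" "a < min \<delta> r" "\<bar>S a\<bar> < min \<delta> r"
      using Y_space_regular(8)[OF Y, of "min \<delta> r"] r False by auto
    then have "\<bar>S r - S a\<bar> \<le> t / (2 * \<epsilon>) + \<epsilon> * R\<^sup>2 / 2"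
      using r by (intro S_increment_bound[OF t e]) auto
    then show "\<bar>S r\<bar> \<le> t / (2 * \<epsilon>) + \<epsilon> * R\<^sup>2 / 2 + \<delta>" using a(3) by linarith
  qed
qed

lemma half_gap:
  fixes s :: real
  assumes "d \<noteq> 0" "\<bar>s\<bar> \<le> 1 / 2"
  shows "1 / 4 \<le> (of_int d - s)\<^sup>2"
proof -
  have "1 \<le> \<bar>of_int d :: real\<bar>" using assms(1) by linarith
  then have "\<bar>1 / 2 :: real\<bar> \<le> \<bar>of_int d - s\<bar>" using assms(2) by linarith
  then have "(1 / 2)\<^sup>2 \<le> (of_int d - s)\<^sup>2" by (simp only: abs_le_square_iff)
  then show ?thesis by (simp add: power2_eq_square)
qed

lemma f_over_r_bound:
  assumes "d \<noteq> 0" "\<bar>S r\<bar> \<le> 1 / 2"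
  shows "(f r)\<^sup>2 / r\<^sup>2 \<le> 4 * ((of_int d - S r)\<^sup>2 * (f r)\<^sup>2 / r\<^sup>2)"
proof -
  have "1 * ((f r)\<^sup>2 / r\<^sup>2) \<le> (4 * (of_int d - S r)\<^sup>2) * ((f r)\<^sup>2 / r\<^sup>2)"
    using half_gap[OF assms] by (intro mult_right_mono) auto
  then show ?thesis by simp
qed

text \<open>Since \<open>d\<close> is a nonzero integer and |S| \<le> 1/2, the square of d - S is at
  least 1/4, so the coupling term controls f^2/r^2 with factor 4. Below \<open>R\<close> one has f^2
  \<le> R^2 (f^2/r^2), whence the constant 4 (R^2 + 1), which also covers the gradient.\<close>

lemma f_X_bound:
  assumes d: "d \<noteq> 0" and R: "0 < R" and S: "\<And>r. 0 < r \<Longrightarrow> r < R \<Longrightarrow> \<bar>S r\<bar> \<le> 1 / 2"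
  shows "X_sqnorm_upto R f \<le> ennreal (4 * (R\<^sup>2 + 1)) * T"
proof -
  have "X_sqnorm_upto R f \<le> (\<integral>\<^sup>+r. ennreal (4 * (R\<^sup>2 + 1)) * (ennreal (energy_density d \<kappa> g f S m r * r) * indicator {0<..} r) \<partial>lborel)"
    unfolding X_sqnorm_upto_def
  proof (rule nn_integral_mono)
    fix r show "ennreal (((weak_deriv f r)\<^sup>2 + (f r)\<^sup>2 + (f r)\<^sup>2 / r\<^sup>2) * r) * indicator {0<..<R} r
      \<le> ennreal (4 * (R\<^sup>2 + 1)) * (ennreal (energy_density d \<kappa> g f S m r * r) * indicator {0<..} r)"
    proof (cases "r \<in> {0<..<R}")
      case True
      then have r: "0 < r" "r < R" by auto
      define X where "X = (of_int d - S r)\<^sup>2 * (f r)\<^sup>2 / r\<^sup>2"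
      have X: "0 \<le> X" "(f r)\<^sup>2 / r\<^sup>2 \<le> 4 * X"
        using f_over_r_bound[OF d S[OF r]] by (auto simp: X_def)
      have "(f r)\<^sup>2 = r\<^sup>2 * ((f r)\<^sup>2 / r\<^sup>2)" using r by simp
      also have "\<dots> \<le> R\<^sup>2 * (4 * X)" using X r by (intro mult_mono power_mono) auto
      finally have f: "(f r)\<^sup>2 \<le> R\<^sup>2 * (4 * X)" .
      have c: "1 \<le> 4 * (R\<^sup>2 + 1)" by (simp add: add_increasing)
      have "0 \<le> \<kappa>\<^sup>2 / 2 * (1 - (f r)\<^sup>2 - (m r)\<^sup>2)\<^sup>2" "0 \<le> (weak_deriv m r)\<^sup>2" by simp_all
      then have "(weak_deriv f r)\<^sup>2 + X \<le> energy_density d \<kappa> g f S m r"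
        using energy_density_ge(1)[OF g, of f r m d S \<kappa>] unfolding X_def by linarith
      then have *: "4 * (R\<^sup>2 + 1) * ((weak_deriv f r)\<^sup>2 + X) \<le> 4 * (R\<^sup>2 + 1) * energy_density d \<kappa> g f S m r"
        by (intro mult_left_mono) auto
      have **: "1 * (weak_deriv f r)\<^sup>2 \<le> 4 * (R\<^sup>2 + 1) * (weak_deriv f r)\<^sup>2"
        using c by (intro mult_right_mono) auto
      have "(weak_deriv f r)\<^sup>2 + (f r)\<^sup>2 + (f r)\<^sup>2 / r\<^sup>2 \<le> 4 * (R\<^sup>2 + 1) * energy_density d \<kappa> g f S m r"
      proof -
        have "4 * (R\<^sup>2 + 1) * ((weak_deriv f r)\<^sup>2 + X) = 4 * (R\<^sup>2 + 1) * (weak_deriv f r)\<^sup>2 + (R\<^sup>2 * (4 * X) + 4 * X)"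
          by (simp add: algebra_simps)
        then show ?thesis using f X * ** by linarith
      qed
      then have "((weak_deriv f r)\<^sup>2 + (f r)\<^sup>2 + (f r)\<^sup>2 / r\<^sup>2) * r \<le> 4 * (R\<^sup>2 + 1) * energy_density d \<kappa> g f S m r * r"
        using r by (intro mult_right_mono) auto
      then have "ennreal (((weak_deriv f r)\<^sup>2 + (f r)\<^sup>2 + (f r)\<^sup>2 / r\<^sup>2) * r) \<le> ennreal (4 * (R\<^sup>2 + 1) * (energy_density d \<kappa> g f S m r * r))"
        by (intro ennreal_leI) (simp add: mult.assoc)
      also have "\<dots> = ennreal (4 * (R\<^sup>2 + 1)) * ennreal (energy_density d \<kappa> g f S m r * r)"
        using r energy_density_ge(3)[OF g] by (intro ennreal_mult) auto
      finally show ?thesis using True by simp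
    qed simp
  qed
  also have "\<dots> = ennreal (4 * (R\<^sup>2 + 1)) * T"
    using energy_density_measurable by (simp add: nn_integral_cmult T_def)
  finally show ?thesis .
qed

text \<open>For \<open>m \<ge> 0\<close>, (m - 1)^2 \<le> |m - 1| |m + 1| \<le> |1 - f^2 - m^2| +
  f^2. The energy contains the square of the first summand, so Young's inequality is used and leaves
  an error proportional to \<epsilon>; the coefficient 1/(\<epsilon> \<kappa>^2) converts its
  quadratic part into the potential term.\<close>

lemma m_H_bound:
  assumes d: "d \<noteq> 0" and \<kappa>: "0 < \<kappa>" and e: "0 < \<epsilon>" and R: "0 < R"
    and S: "\<And>r. 0 < r \<Longrightarrow> r < R \<Longrightarrow> \<bar>S r\<bar> \<le> 1 / 2" and m: "\<And>r. 0 < r \<Longrightarrow> 0 \<le> m r"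
  shows "H_sqnorm_upto R (\<lambda>r. m r - 1) \<le> ennreal (1 + 4 * R\<^sup>2 + 1 / (\<epsilon> * \<kappa>\<^sup>2)) * T + ennreal (\<epsilon> * R\<^sup>2 / 2)"
proof -
  define M where "M = 1 + 4 * R\<^sup>2 + 1 / (\<epsilon> * \<kappa>\<^sup>2)"
  have M: "0 \<le> M" using e \<kappa> by (simp add: M_def)
  have "H_sqnorm_upto R (\<lambda>r. m r - 1) \<le> (\<integral>\<^sup>+r. ennreal M * (ennreal (energy_density d \<kappa> g f S m r * r) * indicator {0<..} r)
      + ennreal (\<epsilon> * R / 2) * indicator {0..R} r \<partial>lborel)"
    unfolding H_sqnorm_upto_def weak_deriv_diff_const
  proof (rule nn_integral_mono)
    fix r show "ennreal (((weak_deriv m r)\<^sup>2 + (m r - 1)\<^sup>2) * r) * indicator {0<..<R} r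
      \<le> ennreal M * (ennreal (energy_density d \<kappa> g f S m r * r) * indicator {0<..} r) + ennreal (\<epsilon> * R / 2) * indicator {0..R} r"
    proof (cases "r \<in> {0<..<R}")
      case True
      then have r: "0 < r" "r < R" by auto
      define X where "X = (of_int d - S r)\<^sup>2 * (f r)\<^sup>2 / r\<^sup>2"
      define Z where "Z = (1 - (f r)\<^sup>2 - (m r)\<^sup>2)\<^sup>2"
      define E where "E = energy_density d \<kappa> g f S m r"
      have X: "0 \<le> X" "(f r)\<^sup>2 / r\<^sup>2 \<le> 4 * X"
        using f_over_r_bound[OF d S[OF r]] by (auto simp: X_def)
      have Z: "0 \<le> Z" by (simp add: Z_def)
      have "(f r)\<^sup>2 = r\<^sup>2 * ((f r)\<^sup>2 / r\<^sup>2)" using r by simp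
      also have "\<dots> \<le> R\<^sup>2 * (4 * X)" using X r by (intro mult_mono power_mono) auto
      finally have f: "(f r)\<^sup>2 \<le> 4 * R\<^sup>2 * X" by simp
      have "0 \<le> (weak_deriv f r)\<^sup>2" by simp
      then have EE: "(weak_deriv m r)\<^sup>2 + X + \<kappa>\<^sup>2 / 2 * Z \<le> E"
        using energy_density_ge(1)[OF g, of f r m d S \<kappa>] unfolding X_def Z_def E_def by linarith
      have E0: "0 \<le> E" "(weak_deriv m r)\<^sup>2 \<le> E" "X \<le> E" "\<kappa>\<^sup>2 / 2 * Z \<le> E"
      proof -
        have "0 \<le> (weak_deriv m r)\<^sup>2" "0 \<le> \<kappa>\<^sup>2 / 2 * Z" using Z by simp_all
        then show "0 \<le> E" "(weak_deriv m r)\<^sup>2 \<le> E" "X \<le> E" "\<kappa>\<^sup>2 / 2 * Z \<le> E" using EE X(1) by linarith+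
      qed
      have "(m r - 1)\<^sup>2 = \<bar>m r - 1\<bar> * \<bar>m r - 1\<bar>" by (simp add: power2_eq_square)
      also have "\<dots> \<le> \<bar>m r - 1\<bar> * \<bar>m r + 1\<bar>"
        using m[OF r(1)] by (intro mult_left_mono) auto
      also have "\<dots> = \<bar>(1 - (f r)\<^sup>2 - (m r)\<^sup>2) + (f r)\<^sup>2\<bar>"
        by (simp add: abs_mult[symmetric] power2_eq_square algebra_simps abs_minus_commute)
      also have "\<dots> \<le> \<bar>1 - (f r)\<^sup>2 - (m r)\<^sup>2\<bar> + (f r)\<^sup>2"
        using abs_triangle_ineq[of "1 - (f r)\<^sup>2 - (m r)\<^sup>2" "(f r)\<^sup>2"] by simp
      also have "\<bar>1 - (f r)\<^sup>2 - (m r)\<^sup>2\<bar> \<le> Z / (2 * \<epsilon>) + \<epsilon> / 2"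
      proof -
        have "0 \<le> (\<bar>1 - (f r)\<^sup>2 - (m r)\<^sup>2\<bar> - \<epsilon>)\<^sup>2 / (2 * \<epsilon>)" using e by simp
        also have "\<dots> = Z / (2 * \<epsilon>) + \<epsilon> / 2 - \<bar>1 - (f r)\<^sup>2 - (m r)\<^sup>2\<bar>"
          using e by (simp add: Z_def power2_diff add_divide_distrib diff_divide_distrib power2_eq_square[of \<epsilon>])
        finally show ?thesis by simp
      qed
      also have "Z / (2 * \<epsilon>) = 1 / (\<epsilon> * \<kappa>\<^sup>2) * (\<kappa>\<^sup>2 / 2 * Z)" using \<kappa> e by (simp add: field_simps)
      finally have "(m r - 1)\<^sup>2 \<le> 1 / (\<epsilon> * \<kappa>\<^sup>2) * (\<kappa>\<^sup>2 / 2 * Z) + \<epsilon> / 2 + (f r)\<^sup>2" by simp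
      moreover have "1 / (\<epsilon> * \<kappa>\<^sup>2) * (\<kappa>\<^sup>2 / 2 * Z) \<le> 1 / (\<epsilon> * \<kappa>\<^sup>2) * E"
        using E0(4) e by (intro mult_left_mono) auto
      moreover have "4 * R\<^sup>2 * X \<le> 4 * R\<^sup>2 * E" using E0(3) by (intro mult_left_mono) auto
      moreover have "M * E = E + 4 * R\<^sup>2 * E + 1 / (\<epsilon> * \<kappa>\<^sup>2) * E" by (simp add: M_def distrib_right)
      ultimately have "(weak_deriv m r)\<^sup>2 + (m r - 1)\<^sup>2 \<le> M * E + \<epsilon> / 2" using f E0(2) by linarith
      then have "((weak_deriv m r)\<^sup>2 + (m r - 1)\<^sup>2) * r \<le> (M * E + \<epsilon> / 2) * r"
        using r by (intro mult_right_mono) auto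
      also have "\<dots> \<le> M * (E * r) + \<epsilon> * R / 2"
        using r e by (simp add: distrib_right)
      finally have "ennreal (((weak_deriv m r)\<^sup>2 + (m r - 1)\<^sup>2) * r) \<le> ennreal (M * (E * r) + \<epsilon> * R / 2)"
        by (rule ennreal_leI)
      also have "\<dots> = ennreal M * ennreal (E * r) + ennreal (\<epsilon> * R / 2)"
        using M E0(1) r R e by (subst ennreal_plus) (auto simp: ennreal_mult)
      finally show ?thesis using True by (simp add: E_def)
    qed simp
  qed
  also have "\<dots> = ennreal M * T + ennreal (\<epsilon> * R / 2) * ennreal R"
    using energy_density_measurable R
    by (subst nn_integral_add) (auto simp: nn_integral_cmult T_def)
  also have "ennreal (\<epsilon> * R / 2) * ennreal R = ennreal (\<epsilon> * R\<^sup>2 / 2)"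
    using e R by (simp add: ennreal_mult[symmetric] power2_eq_square mult.assoc)
  finally show ?thesis by (simp add: M_def)
qed

end

text \<open>Minimality compares the energy with that of the competitor, whose parameters depend on
  the tolerance \<open>x\<close> but not on \<open>n\<close>; the mass term then tends to 0 with
  \<open>g n\<close>.\<close>

lemma minimizer_energy_small:
  assumes g: "\<And>n. 0 < g n" "g \<longlonglongrightarrow> 0"
    and min: "\<And>n. is_arg_min (energy d \<kappa> (g n)) (\<lambda>p. p \<in> Y_space d \<eta>) (f n, S n, m n)"
    and x: "0 < x"
  shows "\<forall>\<^sub>F n in sequentially.
    (\<integral>\<^sup>+r\<in>{0<..}. ennreal (energy_density d \<kappa> (g n) (f n) (S n) (m n) r * r) \<partial>lborel) \<le> ennreal x"
proof -
  obtain C where C: "0 \<le> C" "\<And>s. \<bar>\<zeta>' s\<bar> \<le> C" using zeta'_bound by blast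
  define K1 where "K1 = (pi / 2 * C)\<^sup>2"
  define K2 where "K2 = (2 * of_int d * C)\<^sup>2"
  have K: "0 \<le> K1" "0 \<le> K2" by (auto simp: K1_def K2_def)
  \<comment> \<open>\<open>L\<close> and \<open>A\<close> make the angular and the \<open>S'\<close>
    cost at most x/8 each, and the mass term is eventually below x/4. The total is at most x/2, and
    the integral is twice the energy. The summands 1 and 4 secure \<open>0 < L\<close> and
    \<open>4 \<le> A\<close> even if \<open>K1\<close> or \<open>K2\<close> is zero.\<close>
  define L where "L = 1 + 8 * K1 / x"
  define A where "A = 4 + 8 * K2 / x"
  have L: "0 < L" using K x by (simp add: L_def add_pos_nonneg)
  have A: "4 \<le> A" using K x by (simp add: A_def)
  have 1: "K1 / L \<le> x / 8" using K x L by (simp add: L_def field_simps)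
  have "K2 / A\<^sup>2 \<le> K2 / A"
    using A K by (intro divide_left_mono) (auto simp: power2_eq_square)
  also have "\<dots> \<le> x / 8" using K x A by (simp add: A_def field_simps)
  finally have 2: "K2 / A\<^sup>2 \<le> x / 8" .
  have "(\<lambda>n. \<kappa>\<^sup>2 * g n * (A * exp L)\<^sup>2) \<longlonglongrightarrow> \<kappa>\<^sup>2 * 0 * (A * exp L)\<^sup>2"
    by (intro tendsto_intros g)
  then have "\<forall>\<^sub>F n in sequentially. \<kappa>\<^sup>2 * g n * (A * exp L)\<^sup>2 < x / 4"
    using x by (intro order_tendstoD(2)[of _ 0]) auto
  then show ?thesis
  proof eventually_elim
    case (elim n)
    define T where "T = (\<integral>\<^sup>+r\<in>{0<..}. ennreal (energy_density d \<kappa> (g n) (f n) (S n) (m n) r * r) \<partial>lborel)"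
    have "energy d \<kappa> (g n) (f n, S n, m n)
      \<le> energy d \<kappa> (g n) (\<lambda>r. sin (ang A L r), \<lambda>r. of_int d * \<zeta> (2 * r / A), \<lambda>r. cos (ang A L r))"
      using min[of n] competitor_in_Y_space[OF A L, of d] unfolding is_arg_min_def by (meson not_less)
    also have "\<dots> \<le> ennreal (K1 / L + K2 / A\<^sup>2 + \<kappa>\<^sup>2 * g n * (A * exp L)\<^sup>2)"
      unfolding K1_def K2_def by (rule competitor_energy[OF A L C less_imp_le[OF g(1)]])
    also have "\<dots> \<le> ennreal (x / 2)" using 1 2 elim by (intro ennreal_leI) linarith
    finally have "1 / 2 * T \<le> ennreal (x / 2)" by (simp add: energy_eq T_def)
    then have "2 * (1 / 2 * T) \<le> 2 * ennreal (x / 2)" by (rule mult_left_mono) simp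
    moreover have "2 * (1 / 2 * T) = T"
    proof -
      have half: "(1 / 2 :: ennreal) = ennreal (1 / 2)" using divide_ennreal[of 1 2] by simp
      have "(2 :: ennreal) * (1 / 2) = ennreal 2 * ennreal (1 / 2)" by (simp only: half ennreal_numeral)
      also have "\<dots> = ennreal (2 * (1 / 2))" by (rule ennreal_mult[symmetric]) auto
      finally have "(2 :: ennreal) * (1 / 2) = 1" by (simp only:) simp
      then show ?thesis by (simp only: mult.assoc[symmetric] mult_1)
    qed
    moreover have "2 * ennreal (x / 2) = ennreal x"
      using x ennreal_mult[of 2 "x / 2"] by simp
    ultimately show ?case by (simp add: T_def)
  qed
qed

end

theorem theorem4p8:
  fixes d :: int and \<kappa> :: real and \<eta> :: "real \<Rightarrow> real"
    and g :: "nat \<Rightarrow> real" and f S m :: "nat \<Rightarrow> real \<Rightarrow> real"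
  assumes "d \<noteq> 0" and "0 < \<kappa>" and "cutoff \<eta>"
    and "\<And>n. 0 < g n" and "g \<longlonglongrightarrow> 0"
    and "\<And>n. is_arg_min (energy d \<kappa> (g n)) (\<lambda>p. p \<in> Y_space d \<eta>) (f n, S n, m n)"
    and "\<And>n r. 0 < r \<Longrightarrow> 0 \<le> f n r"
    and "\<And>n r. 0 < r \<Longrightarrow> 0 \<le> m n r"
  shows "tendsto_X_loc f (\<lambda>_. 0)
    \<and> (\<forall>R>0. uniform_limit {0..R} S (\<lambda>_. 0) sequentially)
    \<and> tendsto_H_loc m (\<lambda>_. 1)"
proof -
  interpret smooth_cutoff \<eta> by standard (rule assms(3))
  define T where "T n = (\<integral>\<^sup>+r\<in>{0<..}. ennreal (energy_density d \<kappa> (g n) (f n) (S n) (m n) r * r) \<partial>lborel)" for n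
  have Y: "(f n, S n, m n) \<in> Y_space d \<eta>" for n using assms(6)[of n] by (simp add: is_arg_min_def)
  have g: "0 \<le> g n" for n using assms(4)[of n] by simp
  have T: "\<forall>\<^sub>F n in sequentially. T n \<le> ennreal x" if "0 < x" for x
    unfolding T_def by (rule minimizer_energy_small[OF assms(4-6) that])
  have S: "\<forall>\<^sub>F n in sequentially. \<forall>r\<in>{0..R}. \<bar>S n r\<bar> < e" if R: "0 < R" and e: "0 < e" for R e
  proof -
    \<comment> \<open>Balanced against \<epsilon> = e/R^2 in \<open>S_bound\<close>: the two terms
      become e/4 and e/2, so the sum stays strictly below \<open>e\<close>.\<close>
    have "0 < e\<^sup>2 / (2 * R\<^sup>2)" using R e by simp
    from T[OF this] show ?thesis
    proof eventually_elim
      case (elim n)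
      show ?case
      proof
        fix r assume r: "r \<in> {0..R}"
        have "\<bar>S n r\<bar> \<le> e\<^sup>2 / (2 * R\<^sup>2) / (2 * (e / R\<^sup>2)) + e / R\<^sup>2 * R\<^sup>2 / 2"
          by (rule S_bound[OF Y g elim[unfolded T_def]]) (use R e r in auto)
        also have "\<dots> = 3 / 4 * e" using R e by (simp add: field_simps power2_eq_square)
        also have "\<dots> < e" using e by simp
        finally show "\<bar>S n r\<bar> < e" .
      qed
    qed
  qed
  have Shalf: "\<forall>\<^sub>F n in sequentially. \<forall>r. 0 < r \<longrightarrow> r < R \<longrightarrow> \<bar>S n r\<bar> \<le> 1 / 2" if "0 < R" for R
    using S[OF that, of "1/2"] by (auto elim!: eventually_mono intro: less_imp_le)
  have "tendsto_X_loc f (\<lambda>_. 0)"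
    unfolding tendsto_X_loc_def
  proof (intro allI impI tendsto_zero_ennrealI)
    fix R e :: real assume R: "0 < R" and e: "0 < e"
    have c: "0 < 4 * (R\<^sup>2 + 1)" by (simp add: add_nonneg_pos)
    then have "0 < e / (4 * (R\<^sup>2 + 1))" using e by simp
    from T[OF this] Shalf[OF R] show "\<forall>\<^sub>F n in sequentially. X_sqnorm_upto R (\<lambda>r. f n r - 0) \<le> ennreal e"
    proof eventually_elim
      case (elim n)
      have "X_sqnorm_upto R (f n) \<le> ennreal (4 * (R\<^sup>2 + 1)) * T n"
        unfolding T_def by (rule f_X_bound[OF Y g assms(1) R]) (use elim(2) in auto)
      also have "\<dots> \<le> ennreal (4 * (R\<^sup>2 + 1)) * ennreal (e / (4 * (R\<^sup>2 + 1)))"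
        using elim(1) by (rule mult_left_mono) simp
      also have "\<dots> = ennreal e"
        using c e by (subst ennreal_mult[symmetric]) auto
      finally show ?case by simp
    qed
  qed
  moreover have "uniform_limit {0..R} S (\<lambda>_. 0) sequentially" if "0 < R" for R
    unfolding uniform_limit_iff using S[OF that] by simp
  moreover have "tendsto_H_loc m (\<lambda>_. 1)"
    unfolding tendsto_H_loc_def
  proof (intro allI impI tendsto_zero_ennrealI)
    fix R e :: real assume R: "0 < R" and e: "0 < e"
    \<comment> \<open>This makes the Young error \<epsilon> R^2 / 2 equal to e/2. The constant
      \<open>M\<close> is then fixed, and integrals below e/(2 M) contribute the other half.\<close>
    define \<epsilon> where "\<epsilon> = e / R\<^sup>2"
    have \<epsilon>: "0 < \<epsilon>" using R e by (simp add: \<epsilon>_def)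
    define M where "M = 1 + 4 * R\<^sup>2 + 1 / (\<epsilon> * \<kappa>\<^sup>2)"
    have M: "0 < M" using \<epsilon> assms(2) by (simp add: M_def add_pos_nonneg)
    then have "0 < e / (2 * M)" using e by simp
    from T[OF this] Shalf[OF R] show "\<forall>\<^sub>F n in sequentially. H_sqnorm_upto R (\<lambda>r. m n r - 1) \<le> ennreal e"
    proof eventually_elim
      case (elim n)
      have "H_sqnorm_upto R (\<lambda>r. m n r - 1) \<le> ennreal M * T n + ennreal (\<epsilon> * R\<^sup>2 / 2)"
        unfolding T_def M_def by (rule m_H_bound[OF Y g assms(1,2) \<epsilon> R]) (use elim(2) assms(8) in auto)
      also have "\<dots> \<le> ennreal M * ennreal (e / (2 * M)) + ennreal (\<epsilon> * R\<^sup>2 / 2)"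
        using elim(1) by (intro add_mono mult_left_mono) auto
      also have "\<dots> = ennreal (e / 2) + ennreal (e / 2)"
        using M e R by (subst ennreal_mult[symmetric]) (auto simp: \<epsilon>_def)
      also have "\<dots> = ennreal e"
        using e by (subst ennreal_plus[symmetric]) auto
      finally show ?case .
    qed
  qed
  ultimately show ?thesis by blast
qed

end
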